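(* There exists a polynomial-time deterministic non-preemptive online algorithm for minimizing total flow time on $m$ identical machines whose competitive ratio is $O\!\left(n/m^2+\sqrt{n/m}\,\log m\right)$ against the optimal offline preemptive schedule.
   Context: Online scheduling of $n$ jobs on $m$ identical machines; each job $j$ has release time $r_j\ge0$ and processing time $p_j>0$, becomes known only at $r_j$, and $n,m$ are known to the algorithm in advance. Each machine processes at most one job at a time; non-preemptive means a started job runs to completion without interruption. Flow time of $j$ is $C_j-r_j$; the objective is the total flow time $F$. $\mathrm{OPT}(J)$ is the minimum total flow time over offline preemptive schedules without migration (jobs may be interrupted and resumed later on the same machine without loss). An algorithm is $\Gamma$-competitive if $F(\mathrm{ALG}(J))\le\Gamma\cdot\mathrm{OPT}(J)$ for every instance $J$.
   Formalization: The competitive ratio is bounded by O(max(1, n/m² + √(n/m) log m)): for n much smaller than m (e.g. n = 1, m → ∞) the stated expression tends to 0 while a ratio is at least 1; for m ≤ n the bound is exactly the stated one. *)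

theory Defs
  imports Complex_Main "HOL-Library.Log_Nat" "HOL-Library.Landau_Symbols"
begin

section \<open>Instances and schedules\<close>

text \<open>A job is a pair (release time, processing time); the number of jobs is the length of the list.\<close>

type_synonym jobs = "(real \<times> real) list"

definition rel :: "jobs \<Rightarrow> nat \<Rightarrow> real" where
  "rel J j = fst (J ! j)"

definition ptime :: "jobs \<Rightarrow> nat \<Rightarrow> real" where
  "ptime J j = snd (J ! j)"

definition valid_jobs :: "jobs \<Rightarrow> bool" where
  "valid_jobs J \<longleftrightarrow> (\<forall>j<length J. 0 \<le> rel J j \<and> 0 < ptime J j)"

text \<open>A non-preemptive schedule lists, for every job, its machine and its starting time.\<close>

type_synonym schedule = "(nat \<times> real) list"

definition machine :: "schedule \<Rightarrow> nat \<Rightarrow> nat" where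
  "machine S j = fst (S ! j)"

definition start :: "schedule \<Rightarrow> nat \<Rightarrow> real" where
  "start S j = snd (S ! j)"

definition nonpreemptive_schedule :: "nat \<Rightarrow> jobs \<Rightarrow> schedule \<Rightarrow> bool" where
  "nonpreemptive_schedule m J S \<longleftrightarrow>
     length S = length J \<and>
     (\<forall>j<length J. machine S j < m \<and> rel J j \<le> start S j) \<and>
     (\<forall>i<length J. \<forall>j<length J. i \<noteq> j \<and> machine S i = machine S j \<longrightarrow>
        start S i + ptime J i \<le> start S j \<or> start S j + ptime J j \<le> start S i)"

definition flow :: "jobs \<Rightarrow> schedule \<Rightarrow> real" where
  "flow J S = (\<Sum>j<length J. start S j + ptime J j - rel J j)"

text \<open>
  A preemptive schedule without migration assigns every job \<open>j\<close> to one machine \<open>\<sigma> j\<close> and consists of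
  finitely many pieces \<open>(j, a, b)\<close>, meaning that \<open>j\<close> is processed on \<open>\<sigma> j\<close> during \<open>[a, b)\<close>.
\<close>

definition preemptive_schedule ::
    "nat \<Rightarrow> jobs \<Rightarrow> (nat \<Rightarrow> nat) \<Rightarrow> (nat \<times> real \<times> real) set \<Rightarrow> bool" where
  "preemptive_schedule m J \<sigma> Q \<longleftrightarrow>
     finite Q \<and>
     (\<forall>j<length J. \<sigma> j < m) \<and>
     (\<forall>(j, a, b)\<in>Q. j < length J \<and> rel J j \<le> a \<and> a < b) \<and>
     (\<forall>(i, a, b)\<in>Q. \<forall>(j, c, d)\<in>Q. (i, a, b) \<noteq> (j, c, d) \<and> \<sigma> i = \<sigma> j \<longrightarrow> b \<le> c \<or> d \<le> a) \<and>
     (\<forall>j<length J. (\<Sum>(i, a, b)\<in>{q \<in> Q. fst q = j}. b - a) = ptime J j)"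

definition completion :: "(nat \<times> real \<times> real) set \<Rightarrow> nat \<Rightarrow> real" where
  "completion Q j = Max {b. \<exists>a. (j, a, b) \<in> Q}"

definition preemptive_flow :: "jobs \<Rightarrow> (nat \<times> real \<times> real) set \<Rightarrow> real" where
  "preemptive_flow J Q = (\<Sum>j<length J. completion Q j - rel J j)"

definition OPT :: "nat \<Rightarrow> jobs \<Rightarrow> real" where
  "OPT m J = Inf {preemptive_flow J Q | \<sigma> Q. preemptive_schedule m J \<sigma> Q}"

section \<open>Deterministic online algorithms\<close>

text \<open>
  The first argument is the number of machines; the number of jobs is the length of the list.
  An algorithm maps an instance to the schedule that it produces on it.
\<close>

type_synonym algorithm = "nat \<Rightarrow> jobs \<Rightarrow> schedule"

text \<open>
  Two instances with the same number of jobs that look the same at time \<open>t\<close>: the same jobs have been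
  released so far, with the same data.
\<close>

definition same_until :: "real \<Rightarrow> jobs \<Rightarrow> jobs \<Rightarrow> bool" where
  "same_until t J J' \<longleftrightarrow> length J = length J' \<and>
     (\<forall>j<length J. rel J j \<le> t \<or> rel J' j \<le> t \<longrightarrow> J ! j = J' ! j)"

text \<open>
  An algorithm is online if all decisions taken up to time \<open>t\<close> are determined by \<open>n\<close>, \<open>m\<close> and the
  jobs released up to time \<open>t\<close>.  Equal list lengths in \<^const>\<open>same_until\<close> express that \<open>n\<close> is known
  in advance.
\<close>

definition online_nonpreemptive :: "algorithm \<Rightarrow> bool" where
  "online_nonpreemptive A \<longleftrightarrow>
     (\<forall>m\<ge>1. \<forall>J. valid_jobs J \<longrightarrow> nonpreemptive_schedule m J (A m J)) \<and>
     (\<forall>m\<ge>1. \<forall>J J' t. valid_jobs J \<and> valid_jobs J' \<and> same_until t J J' \<longrightarrow>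
        (\<forall>j<length J. start (A m J) j \<le> t \<longrightarrow> A m J' ! j = A m J ! j))"

definition competitive :: "algorithm \<Rightarrow> nat \<Rightarrow> nat \<Rightarrow> real \<Rightarrow> bool" where
  "competitive A n m \<Gamma> \<longleftrightarrow>
     (\<forall>J. length J = n \<and> valid_jobs J \<longrightarrow> flow J (A m J) \<le> \<Gamma> * OPT m J)"

section \<open>Polynomial time\<close>

text \<open>
  The machine model is a random access machine with integer cells, programmed by while-programs, under
  the logarithmic cost criterion: every value that occurs during the evaluation of an expression,
  including addresses, is charged its bit length.  Up to polynomials this is Turing machine time.
\<close>

datatype expr =
    Num int
  | Cell expr
  | Plus expr expr
  | Minus expr expr
  | Times expr expr
  | Quot expr expr

datatype prog =
    Skip
  | Store expr expr
  | Seq prog prog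
  | IfPos expr prog prog
  | WhilePos expr prog

type_synonym mem = "int \<Rightarrow> int"

fun val :: "expr \<Rightarrow> mem \<Rightarrow> int" where
  "val (Num k) M = k"
| "val (Cell e) M = M (val e M)"
| "val (Plus e f) M = val e M + val f M"
| "val (Minus e f) M = val e M - val f M"
| "val (Times e f) M = val e M * val f M"
| "val (Quot e f) M = val e M div val f M"

definition bits :: "int \<Rightarrow> nat" where
  "bits k = 1 + floorlog 2 (nat \<bar>k\<bar>)"

fun cost :: "expr \<Rightarrow> mem \<Rightarrow> nat" where
  "cost (Num k) M = bits k"
| "cost (Cell e) M = cost e M + bits (val (Cell e) M)"
| "cost (Plus e f) M = cost e M + cost f M + bits (val (Plus e f) M)"
| "cost (Minus e f) M = cost e M + cost f M + bits (val (Minus e f) M)"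
| "cost (Times e f) M = cost e M + cost f M + bits (val (Times e f) M)"
| "cost (Quot e f) M = cost e M + cost f M + bits (val (Quot e f) M)"

text \<open>\<open>run P M t M'\<close>: started in memory \<open>M\<close>, the program \<open>P\<close> halts after time \<open>t\<close> in memory \<open>M'\<close>.\<close>

inductive run :: "prog \<Rightarrow> mem \<Rightarrow> nat \<Rightarrow> mem \<Rightarrow> bool" where
  Skip: "run Skip M 1 M"
| Store: "run (Store a e) M (1 + cost a M + cost e M) (M(val a M := val e M))"
| Seq: "run P M t M' \<Longrightarrow> run Q M' u M'' \<Longrightarrow> run (Seq P Q) M (t + u) M''"
| IfTrue: "0 < val e M \<Longrightarrow> run P M t M' \<Longrightarrow> run (IfPos e P Q) M (1 + cost e M + t) M'"
| IfFalse: "\<not> 0 < val e M \<Longrightarrow> run Q M t M' \<Longrightarrow> run (IfPos e P Q) M (1 + cost e M + t) M'"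
| WhileTrue: "0 < val e M \<Longrightarrow> run P M t M' \<Longrightarrow> run (WhilePos e P) M' u M'' \<Longrightarrow>
    run (WhilePos e P) M (1 + cost e M + t + u) M''"
| WhileFalse: "\<not> 0 < val e M \<Longrightarrow> run (WhilePos e P) M (1 + cost e M) M"

text \<open>
  Only rational data can be given to a machine.  The input consists of \<open>n\<close>, \<open>m\<close> and the numerators and
  denominators of all release and processing times; it is stored from cell 0 on, all other cells being 0.
\<close>

definition encode_rat :: "rat \<Rightarrow> int list" where
  "encode_rat q = [fst (quotient_of q), snd (quotient_of q)]"

definition encode :: "nat \<Rightarrow> (rat \<times> rat) list \<Rightarrow> int list" where
  "encode m K = [int (length K), int m] @ concat (map (\<lambda>(r, p). encode_rat r @ encode_rat p) K)"

definition load :: "int list \<Rightarrow> mem" where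
  "load xs = (\<lambda>a. if 0 \<le> a \<and> a < int (length xs) then xs ! nat a else 0)"

definition input_size :: "int list \<Rightarrow> nat" where
  "input_size xs = sum_list (map bits xs)"

text \<open>Cells \<open>3j\<close>, \<open>3j+1\<close>, \<open>3j+2\<close> of the final memory contain the machine of job \<open>j\<close> and a fraction
  representing its starting time.\<close>

definition outputs :: "mem \<Rightarrow> schedule \<Rightarrow> bool" where
  "outputs M S \<longleftrightarrow> (\<forall>j<length S.
     M (3 * int j) = int (machine S j) \<and>
     M (3 * int j + 2) \<noteq> 0 \<and>
     start S j = of_int (M (3 * int j + 1)) / of_int (M (3 * int j + 2)))"

definition real_jobs :: "(rat \<times> rat) list \<Rightarrow> jobs" where
  "real_jobs K = map (\<lambda>(r, p). (of_rat r, of_rat p)) K"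

text \<open>
  One fixed program, for all \<open>n\<close> and \<open>m\<close>, computes the schedule in time polynomial in the bit length of
  the input.  For an online algorithm this means that every decision can also be computed in polynomial
  time when it is due: unknown jobs are replaced by jobs released in the far future, which does not
  change any decision taken before their release.
\<close>

definition polynomial_time :: "algorithm \<Rightarrow> bool" where
  "polynomial_time A \<longleftrightarrow>
     (\<exists>P c k. \<forall>m\<ge>1. \<forall>K. valid_jobs (real_jobs K) \<longrightarrow>
        (\<exists>t M. run P (load (encode m K)) t M \<and>
               t \<le> c * input_size (encode m K) ^ k \<and>
               outputs M (A m (real_jobs K))))"

section \<open>The bound\<close>

text \<open>
  For \<open>n\<close> much smaller than \<open>m\<close> the expression \<open>n / m\<^sup>2 + sqrt (n / m) * log m\<close> tends to 0, whereas a
  competitive ratio is never below 1; the bound is therefore read as the maximum of 1 and this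
  expression.  In the relevant range \<open>m \<le> n\<close> the maximum is just the expression itself.
\<close>

lemma max_one_bound:
  fixes n m :: nat
  assumes "1 \<le> m" "m \<le> n"
  shows "max 1 (real n / (real m)\<^sup>2 + sqrt (real n / real m) * log 2 (real m))
           = real n / (real m)\<^sup>2 + sqrt (real n / real m) * log 2 (real m)"
proof (cases "m = 1")
  case True
  then show ?thesis using assms by simp
next
  case False
  then have m: "real m \<ge> 2" using assms by linarith
  have a: "1 \<le> sqrt (real n / real m)" using assms by simp
  have b: "1 \<le> log 2 (real m)" using m by (simp add: le_log_iff)
  have "1 * 1 \<le> sqrt (real n / real m) * log 2 (real m)"
    using a b by (intro mult_mono) auto
  moreover have "0 \<le> real n / (real m)\<^sup>2" by simp
  ultimately show ?thesis by linarith
qed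

end

theory Submission
  imports "HOL-Analysis.Analysis" Defs
begin

text \<open>
  If \<open>n \<le> m\<close>, every job gets its own machine.  Otherwise let \<open>W(t)\<close> be the total processing time
  released by time \<open>t\<close> and \<open>G = sqrt (n / m)\<close>.  Machine \<open>i = 0, \<dots>, m - 1\<close> admits a job of size \<open>p\<close>
  at time \<open>t\<close> only if \<open>G i p \<le> W(t)\<close>, and an idle machine always starts the shortest pending job that
  it admits.

  If the shortest of \<open>N\<close> pending jobs is not admitted everywhere, its size is at most \<open>W / N\<close>, so at
  least \<open>N / G\<close> machines admit it and are busy; since \<open>W \<le> OPT\<close>, such times cost \<open>O(G) OPT\<close>.
  At all other times every machine is busy, and long jobs block at most \<open>W / (G i)\<close> of the capacity of
  machine \<open>i \<ge> 1\<close>, while machine \<open>0\<close> loses at most the length of a fully busy period, which is at most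
  \<open>W / m\<close>.  Hence for every size \<open>x\<close> the volume of started jobs of size at most \<open>x\<close> is at least
  what any preemptive schedule has processed a time \<open>\<Delta>\<close> earlier, \<open>\<Delta>\<close> being of order
  \<open>W / m\<^sup>2 + W ln n / (G m) + W / n\<close>, up to a lag \<open>G m x\<close> inherited from the time when jobs of size \<open>x\<close>
  were still long.  Integrating against \<open>dx / x\<^sup>2\<close> turns volumes into numbers of jobs, and the lag into
  \<open>O(G m ln n)\<close> jobs.  Together this gives the ratio \<open>O(n / m\<^sup>2 + G ln n)\<close>, where \<open>ln n\<close> can be replaced by
  \<open>log m\<close> because \<open>n / m\<^sup>2\<close> dominates for \<open>n > m\<^sup>4\<close>.
\<close>

text \<open>A started job cannot be interrupted, and the final volume is unknown while decisions are
  made; admission is therefore measured against the work released so far, which changes only at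
  releases. Thresholds linear in the machine number serve two opposite needs: the jobs that block
  the machines when a busy period begins have lengths bounded by a harmonic series, and the number
  of machines that admit a size p grows like W / (G p), in step with the number of pending jobs of
  size at least p that W allows. The analysis leaves the terms n H / (G m) and G ln n; the choice G
  = sqrt (n / m) makes n / (G m) equal to G and so balances them. The case n \<le> m matters also
  for the running time: m is given in binary, so scanning m n^2 candidates is polynomial in the
  input length only because m < n holds there. As the square root is irrational in general,
  admission is tested in squared form, an integer comparison once all times are multiplied by a
  common denominator.\<close>

section \<open>Lengths of intervals, and from volumes to numbers of jobs\<close>

lemma interval_cover_le:
  fixes s p :: "nat \<Rightarrow> real"
  assumes "finite K" "\<And>k. k \<in> K \<Longrightarrow> 0 \<le> p k" "{b<..<t} \<subseteq> (\<Union>k\<in>K. {s k..<s k + p k})"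
  shows "t - b \<le> (\<Sum>k\<in>K. p k)"
proof (cases "b \<le> t")
  case True
  have fm: "(\<Union>k\<in>K. {s k..<s k + p k}) \<in> fmeasurable lborel"
    using assms(1)
    by (intro fmeasurable.finite_UN) (auto simp: fmeasurable_def intro: emeasure_bounded_finite[simplified])
  have "t - b = measure lborel {b<..<t}" using True by simp
  also have "\<dots> \<le> measure lborel (\<Union>k\<in>K. {s k..<s k + p k})"
    by (rule measure_mono_fmeasurable[OF assms(3) _ fm]) simp
  also have "\<dots> \<le> (\<Sum>k\<in>K. measure lborel {s k..<s k + p k})"
    by (rule measure_UNION_le[OF assms(1)]) simp
  also have "\<dots> = (\<Sum>k\<in>K. p k)" using assms(2) by (intro sum.cong) auto
  finally show ?thesis .
next
  case False
  have "0 \<le> (\<Sum>k\<in>K. p k)" using assms(2) by (rule sum_nonneg)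
  then show ?thesis using False by linarith
qed

lemma interval_pack_le:
  fixes l h :: "'a \<Rightarrow> real"
  assumes "finite K" "\<And>k. k \<in> K \<Longrightarrow> x \<le> l k \<and> l k \<le> h k \<and> h k \<le> y" "x \<le> y"
    and "\<And>k k'. k \<in> K \<Longrightarrow> k' \<in> K \<Longrightarrow> k \<noteq> k' \<Longrightarrow> h k \<le> l k' \<or> h k' \<le> l k"
  shows "(\<Sum>k\<in>K. h k - l k) \<le> y - x"
proof -
  have "(\<Sum>k\<in>K. h k - l k) = (\<Sum>k\<in>K. measure lborel {l k..<h k})"
    using assms(2) by (intro sum.cong) auto
  also have "\<dots> = measure lborel (\<Union>k\<in>K. {l k..<h k})"
  proof (rule measure_finite_Union[symmetric])
    show "disjoint_family_on (\<lambda>k. {l k..<h k}) K"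
      using assms(4) by (fastforce simp: disjoint_family_on_def)
  qed (use assms(1) emeasure_bounded_finite[of "{l k..<h k}" for k] in \<open>auto simp: less_top\<close>)
  also have "\<dots> \<le> measure lborel {x..y}"
    using assms(1,2)
    by (intro measure_mono_fmeasurable) (auto simp: fmeasurable_def intro!: sets.finite_UN emeasure_bounded_finite[simplified], fastforce+)
  also have "\<dots> = y - x" using assms(3) by simp
  finally show ?thesis .
qed

text \<open>A job of size p contributes p / x^2 for x from p to \<tau>, with integral 1 - p /
  \<tau>. So the integrated volumes are cardinalities minus total volume over \<tau>. That boundary
  term is settled by the inequality at x = \<tau>, at the price \<open>c\<close>; the lag c x
  integrates to c ln (\<tau> / \<open>x\<^sub>0\<close>) \<le> c ln n.\<close>

lemma card_weighted_dominance:
  fixes p :: "'a \<Rightarrow> real"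
  assumes fin: "finite A" "finite B"
    and pos: "\<And>j. j \<in> A \<union> B \<Longrightarrow> 0 < p j \<and> p j \<le> \<tau>"
    and x0: "0 < x\<^sub>0" "\<tau> \<le> n * x\<^sub>0" "1 \<le> n" and c: "0 \<le> c" and tau: "0 < \<tau>"
    and dom: "\<And>x. 0 < x \<Longrightarrow> x \<le> \<tau> \<Longrightarrow>
      (\<Sum>j | j \<in> B \<and> p j \<le> x. p j) \<le> (\<Sum>j | j \<in> A \<and> p j \<le> x. p j) + (if x \<le> x\<^sub>0 then 0 else c * x)"
  shows "real (card B) \<le> real (card A) + c * (1 + ln n)"
proof -
  \<comment> \<open>A positive lower bound of all sizes: starting the integration here avoids the
    pole at 0 and loses nothing, since both volumes vanish below \<open>e\<close>.\<close>
  define e where "e = Min (insert (min x\<^sub>0 \<tau>) (p ` (A \<union> B)))"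
  have "0 < e"
    using fin pos x0 tau unfolding e_def by (auto simp: Min_gr_iff)
  moreover have "e \<le> min x\<^sub>0 \<tau>" "\<And>j. j \<in> A \<union> B \<Longrightarrow> e \<le> p j"
    using fin unfolding e_def by (blast intro!: Min_le finite_insert[THEN iffD2] finite_imageI finite_UnI)+
  ultimately have e: "0 < e" "e \<le> x\<^sub>0" "e \<le> \<tau>" "\<And>j. j \<in> A \<union> B \<Longrightarrow> e \<le> p j"
    by auto
  have I: "((\<lambda>x. if p j \<le> x then p j / x\<^sup>2 else 0) has_integral (1 - p j / \<tau>)) {e..\<tau>}"
    if "j \<in> A \<union> B" for j
  proof -
    have pj: "0 < p j" "e \<le> p j" "p j \<le> \<tau>" using that e pos by auto
    have "((\<lambda>x. p j / x\<^sup>2) has_integral (- p j / \<tau> - (- p j / p j))) {p j..\<tau>}"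
    proof (rule fundamental_theorem_of_calculus[OF pj(3)])
      fix x assume "x \<in> {p j..\<tau>}"
      then have "x \<noteq> 0" using pj by auto
      then show "((\<lambda>x. - p j / x) has_vector_derivative p j / x\<^sup>2) (at x within {p j..\<tau>})"
        by (auto intro!: derivative_eq_intros
            simp: has_real_derivative_iff_has_vector_derivative[symmetric] power2_eq_square)
    qed
    then have "((\<lambda>x. if x \<in> {p j..\<tau>} then p j / x\<^sup>2 else 0) has_integral (1 - p j / \<tau>)) {e..\<tau>}"
      using pj by (subst has_integral_restrict) auto
    then show ?thesis by (rule has_integral_cong[THEN iffD1, rotated]) auto
  qed
  have S: "((\<lambda>x. (\<Sum>j | j \<in> X \<and> p j \<le> x. p j) / x\<^sup>2) has_integral (card X - (\<Sum>j\<in>X. p j) / \<tau>)) {e..\<tau>}"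
    if "X = A \<or> X = B" for X
  proof -
    have fX: "finite X" using that fin by auto
    have "((\<lambda>x. \<Sum>j\<in>X. if p j \<le> x then p j / x\<^sup>2 else 0) has_integral (\<Sum>j\<in>X. 1 - p j / \<tau>)) {e..\<tau>}"
      using that fX by (intro has_integral_sum I) auto
    moreover have "(\<lambda>x. \<Sum>j\<in>X. if p j \<le> x then p j / x\<^sup>2 else 0) =
        (\<lambda>x. (\<Sum>j | j \<in> X \<and> p j \<le> x. p j) / x\<^sup>2)"
      using fX by (auto simp: sum_divide_distrib sum.If_cases Int_def)
    ultimately show ?thesis by (simp add: sum_subtractf sum_divide_distrib)
  qed
  have L: "((\<lambda>x. if x\<^sub>0 \<le> x then c / x else 0) has_integral (if x\<^sub>0 \<le> \<tau> then c * ln (\<tau> / x\<^sub>0) else 0)) {e..\<tau>}"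
  proof (cases "x\<^sub>0 \<le> \<tau>")
    case True
    have "((\<lambda>x. c / x) has_integral (c * ln \<tau> - c * ln x\<^sub>0)) {x\<^sub>0..\<tau>}"
    proof (rule fundamental_theorem_of_calculus[OF True])
      fix x assume "x \<in> {x\<^sub>0..\<tau>}"
      then have "x > 0" using x0 by auto
      then show "((\<lambda>x. c * ln x) has_vector_derivative c / x) (at x within {x\<^sub>0..\<tau>})"
        by (auto intro!: derivative_eq_intros
            simp: has_real_derivative_iff_has_vector_derivative[symmetric] field_simps)
    qed
    then have "((\<lambda>x. if x \<in> {x\<^sub>0..\<tau>} then c / x else 0) has_integral (c * ln (\<tau> / x\<^sub>0))) {e..\<tau>}"
      using x0 True e tau by (subst has_integral_restrict) (auto simp: ln_div algebra_simps)
    then have "((\<lambda>x. if x\<^sub>0 \<le> x then c / x else 0) has_integral (c * ln (\<tau> / x\<^sub>0))) {e..\<tau>}"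
      by (rule has_integral_cong[THEN iffD1, rotated]) auto
    then show ?thesis using True by simp
  next
    case False
    then have "((\<lambda>x. if x\<^sub>0 \<le> x then c / x else 0) has_integral 0) {e..\<tau>}"
      by (intro has_integral_is_0) auto
    then show ?thesis using False by simp
  qed
  have "card B - (\<Sum>j\<in>B. p j) / \<tau>
      \<le> card A - (\<Sum>j\<in>A. p j) / \<tau> + (if x\<^sub>0 \<le> \<tau> then c * ln (\<tau> / x\<^sub>0) else 0)"
  proof (rule has_integral_le[OF S[of B] has_integral_add[OF S[of A] L]])
    fix x assume x: "x \<in> {e..\<tau>}"
    then have xp: "0 < x" using e by auto
    have "(\<Sum>j | j \<in> B \<and> p j \<le> x. p j) / x\<^sup>2
        \<le> ((\<Sum>j | j \<in> A \<and> p j \<le> x. p j) + (if x \<le> x\<^sub>0 then 0 else c * x)) / x\<^sup>2"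
      using dom[of x] x xp by (intro divide_right_mono) auto
    also have "\<dots> \<le> (\<Sum>j | j \<in> A \<and> p j \<le> x. p j) / x\<^sup>2 + (if x\<^sub>0 \<le> x then c / x else 0)"
      using xp c by (auto simp: add_divide_distrib power2_eq_square)
    finally show "(\<Sum>j | j \<in> B \<and> p j \<le> x. p j) / x\<^sup>2
      \<le> (\<Sum>j | j \<in> A \<and> p j \<le> x. p j) / x\<^sup>2 + (if x\<^sub>0 \<le> x then c / x else 0)" .
  qed auto
  moreover have "(\<Sum>j\<in>B. p j) / \<tau> \<le> (\<Sum>j\<in>A. p j) / \<tau> + c"
  proof -
    have "{j. j \<in> X \<and> p j \<le> \<tau>} = X" if "X \<subseteq> A \<union> B" for X using that pos by auto
    then have "(\<Sum>j\<in>B. p j) \<le> (\<Sum>j\<in>A. p j) + c * \<tau>"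
      using dom[of \<tau>] tau c by (auto split: if_splits simp: add_increasing2)
    then show ?thesis using tau by (simp add: field_simps)
  qed
  moreover have "(if x\<^sub>0 \<le> \<tau> then c * ln (\<tau> / x\<^sub>0) else 0) \<le> c * ln n"
  proof -
    have "ln (\<tau> / x\<^sub>0) \<le> ln n"
      using x0 tau by (subst ln_le_cancel_iff) (auto simp: field_simps)
    then show ?thesis using c x0 by (auto intro: mult_left_mono)
  qed
  ultimately show ?thesis by (simp add: algebra_simps)
qed

section \<open>Busy periods of an abstract greedy schedule\<close>

text \<open>The interface between algorithm and analysis. \<open>busy\<close> yields lower bounds on
  the number of running machines, \<open>spt\<close> keeps longer jobs from starting while a short
  one waits, and \<open>cap\<close> limits how long a job can block its machine.\<close>

locale greedy_schedule =
  fixes n m :: nat and r p s :: "nat \<Rightarrow> real" and mac :: "nat \<Rightarrow> nat" and G :: real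
  assumes m: "1 \<le> m" and n: "1 \<le> n" and G: "0 < G"
    and p_pos: "j < n \<Longrightarrow> 0 < p j"
    and rs: "j < n \<Longrightarrow> r j \<le> s j"
    and mac: "j < n \<Longrightarrow> mac j < m"
    and disj: "i < n \<Longrightarrow> j < n \<Longrightarrow> i \<noteq> j \<Longrightarrow> mac i = mac j \<Longrightarrow> s i + p i \<le> s j \<or> s j + p j \<le> s i"
    and busy: "i < m \<Longrightarrow> j < n \<Longrightarrow> r j \<le> t \<Longrightarrow> t < s j \<Longrightarrow>
      G * real i * p j \<le> (\<Sum>l | l < n \<and> r l \<le> t. p l) \<Longrightarrow>
      \<exists>k<n. mac k = i \<and> s k \<le> t \<and> t < s k + p k"
    and spt: "i < n \<Longrightarrow> j < n \<Longrightarrow> r i \<le> s j \<Longrightarrow> p i < p j \<Longrightarrow> s i \<le> s j"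
    and cap: "j < n \<Longrightarrow> G * real (mac j) * p j \<le> (\<Sum>l | l < n \<and> r l \<le> s j. p l)"
begin

definition W :: "real \<Rightarrow> real" where "W t = (\<Sum>l | l < n \<and> r l \<le> t. p l)"
definition V :: real where "V = (\<Sum>l<n. p l)"
definition H :: real where "H = (\<Sum>i=1..<m. 1 / real i)"
definition runs_at :: "nat \<Rightarrow> real \<Rightarrow> bool" where
  "runs_at i t \<longleftrightarrow> (\<exists>k<n. mac k = i \<and> s k \<le> t \<and> t < s k + p k)"

lemma sum_p_le:
  assumes "X \<subseteq> Y" "Y \<subseteq> {..<n}" shows "sum p X \<le> sum p Y"
  using assms p_pos by (intro sum_mono2) (auto intro: finite_subset less_imp_le)

lemma W_le: "W t \<le> V" unfolding W_def V_def by (rule sum_p_le) auto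
lemma W_nonneg: "0 \<le> W t" unfolding W_def using p_pos by (intro sum_nonneg) (auto intro: less_imp_le)
lemma V_pos: "0 < V" unfolding V_def using n p_pos by (intro sum_pos) (auto simp: lessThan_empty_iff)
lemma H_nonneg: "0 \<le> H" unfolding H_def by (intro sum_nonneg) auto

lemma busy_W: "i < m \<Longrightarrow> j < n \<Longrightarrow> r j \<le> t \<Longrightarrow> t < s j \<Longrightarrow> G * real i * p j \<le> W t \<Longrightarrow> runs_at i t"
  using busy unfolding W_def runs_at_def by blast

lemma machine_busy_le:
  assumes "\<And>u. b < u \<Longrightarrow> u < t \<Longrightarrow> runs_at i u"
  shows "t - b \<le> (\<Sum>k | k < n \<and> mac k = i \<and> s k < t \<and> b < s k + p k. p k)"
proof (rule interval_cover_le[where s = s])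
  show "{b<..<t} \<subseteq> (\<Union>k\<in>{k. k < n \<and> mac k = i \<and> s k < t \<and> b < s k + p k}. {s k..<s k + p k})"
  proof
    fix u assume u: "u \<in> {b<..<t}"
    then obtain k where "k < n" "mac k = i" "s k \<le> u" "u < s k + p k"
      using assms unfolding runs_at_def by auto
    then show "u \<in> (\<Union>k\<in>{k. k < n \<and> mac k = i \<and> s k < t \<and> b < s k + p k}. {s k..<s k + p k})"
      using u by force
  qed
qed (use p_pos in \<open>auto intro: less_imp_le\<close>)

lemma sum_by_machine_le:
  assumes "I \<subseteq> {..<m}"
  shows "(\<Sum>i\<in>I. \<Sum>k | k < n \<and> mac k = i \<and> P k. p k) \<le> (\<Sum>k | k < n \<and> P k. p k)"
proof -
  have "(\<Sum>i\<in>I. \<Sum>k | k < n \<and> mac k = i \<and> P k. p k) = sum p (\<Union>i\<in>I. {k. k < n \<and> mac k = i \<and> P k})"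
    using assms by (intro sum.UNION_disjoint[symmetric]) (auto intro: finite_subset)
  also have "\<dots> \<le> (\<Sum>k | k < n \<and> P k. p k)"
    by (rule sum_p_le) auto
  finally show ?thesis .
qed

text \<open>Work done and work started in the period differ only by jobs already running at
  \<open>b\<close>, at most one per machine. On machine i \<ge> 1 such a job is bounded through
  \<open>cap\<close>; machine 0 has no such bound, so its whole share t - b is written off.\<close>

lemma all_busy_le:
  assumes "b \<le> t" and "\<And>i u. i < m \<Longrightarrow> b < u \<Longrightarrow> u < t \<Longrightarrow> runs_at i u"
  shows "real m * (t - b) \<le> (\<Sum>k | k < n \<and> b < s k \<and> s k < t. p k) + V / m + V * H / G"
proof -
  have "real m * (t - b) = (\<Sum>i<m. t - b)" by simp
  also have "\<dots> \<le> (\<Sum>i<m. \<Sum>k | k < n \<and> mac k = i \<and> s k < t \<and> b < s k + p k. p k)"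
    using assms by (intro sum_mono machine_busy_le) auto
  also have "\<dots> \<le> (\<Sum>k | k < n \<and> s k < t \<and> b < s k + p k. p k)"
    by (rule sum_by_machine_le) simp
  also have "\<dots> \<le> V" unfolding V_def by (rule sum_p_le) auto
  \<comment> \<open>All m machines run throughout, so m (t - b) is at most the total volume. This
    pays for machine 0.\<close>
  finally have *: "t - b \<le> V / m" using m by (simp add: field_simps)
  have one: "t - b \<le> (\<Sum>k | k < n \<and> mac k = i \<and> b < s k \<and> s k < t. p k) + V / G * (1 / i)"
    if i: "1 \<le> i" "i < m" for i
  proof -
    let ?K = "{k. k < n \<and> mac k = i \<and> s k \<le> b \<and> s k < t \<and> b < s k + p k}"
    have "t - b \<le> sum p {k. k < n \<and> mac k = i \<and> s k < t \<and> b < s k + p k}"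
      using assms i by (intro machine_busy_le) auto
    also have "{k. k < n \<and> mac k = i \<and> s k < t \<and> b < s k + p k}
        = {k. k < n \<and> mac k = i \<and> b < s k \<and> s k < t} \<union> ?K"
      using p_pos by force
    also have "sum p \<dots> = sum p {k. k < n \<and> mac k = i \<and> b < s k \<and> s k < t} + sum p ?K"
      by (rule sum.union_disjoint) auto
    also have "sum p ?K \<le> V / G * (1 / i)"
    proof (cases "?K = {}")
      case False
      then obtain k where k: "k \<in> ?K" by blast
      have "k' = k" if "k' \<in> ?K" for k'
      proof (rule ccontr)
        assume "k' \<noteq> k"
        then have "s k + p k \<le> s k' \<or> s k' + p k' \<le> s k" using disj[of k k'] k that by auto
        then show False using k that by auto
      qed
      then have K: "?K = {k}" using k by blast
      have "G * i * p k \<le> V" using cap[of k] k W_le[of "s k"] unfolding W_def by auto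
      then show ?thesis using G i unfolding K by (simp add: field_simps)
    next
      case True
      show ?thesis unfolding True using V_pos G by auto
    qed
    finally show ?thesis by simp
  qed
  have "real m * (t - b) = (t - b) + (\<Sum>i=1..<m. t - b)"
    using m by (simp add: algebra_simps of_nat_diff)
  also have "(\<Sum>i=1..<m. t - b) \<le> (\<Sum>i=1..<m. (\<Sum>k | k < n \<and> mac k = i \<and> b < s k \<and> s k < t. p k) + V / G * (1 / i))"
    using one by (intro sum_mono) auto
  also have "\<dots> = (\<Sum>i=1..<m. \<Sum>k | k < n \<and> mac k = i \<and> b < s k \<and> s k < t. p k) + V / G * H"
    unfolding H_def by (simp only: sum.distrib sum_distrib_left)
  also have "(\<Sum>i=1..<m. \<Sum>k | k < n \<and> mac k = i \<and> b < s k \<and> s k < t. p k)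
      \<le> (\<Sum>k | k < n \<and> b < s k \<and> s k < t. p k)"
    by (rule sum_by_machine_le) auto
  finally show ?thesis using * by simp
qed

end

section \<open>Comparison with a reference schedule\<close>

text \<open>\<open>C\<close> will be the completion times of an arbitrary preemptive schedule.
  \<open>reference_volume\<close> is the only trace of its machines: work on jobs completed by
  \<open>u\<close> belongs to jobs released by \<open>v\<close> or is processed by m machines
  between \<open>v\<close> and \<open>u\<close>.\<close>

locale greedy_vs_reference = greedy_schedule +
  fixes C :: "nat \<Rightarrow> real"
  assumes C: "j < n \<Longrightarrow> r j + p j \<le> C j"
    and reference_volume: "X \<subseteq> {..<n} \<Longrightarrow>
      (\<Sum>j | j \<in> X \<and> C j \<le> u. p j) \<le> (\<Sum>j | j \<in> X \<and> r j \<le> v. p j) + real m * max 0 (u - v)"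
begin

definition x\<^sub>0 :: real where "x\<^sub>0 = V / (n * G * m)"
text \<open>V / n is the wait until enough work is released; the rest collects the losses of
  \<open>all_busy_le\<close> and the volume of n jobs of size \<open>x\<^sub>0\<close>, shared by m
  machines.\<close>

definition \<Delta> :: real where "\<Delta> = V / n + (V / m + V * H / G + V / (G * m)) / m"

lemma x\<^sub>0_pos: "0 < x\<^sub>0" unfolding x\<^sub>0_def using V_pos n m G by simp
lemma \<Delta>_ge: "V / n \<le> \<Delta>" unfolding \<Delta>_def using V_pos H_nonneg G by simp
lemma \<Delta>_nonneg: "0 \<le> \<Delta>" using order_trans[OF _ \<Delta>_ge] V_pos by simp

lemma wait_le:
  assumes j: "j < n" and small: "p j \<le> x\<^sub>0"
  shows "s j \<le> r j + \<Delta>"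
proof (rule ccontr)
  assume *: "\<not> s j \<le> r j + \<Delta>"
  define b where "b = r j + V / n"
  have bs: "b \<le> s j" using * \<Delta>_ge unfolding b_def by linarith
  have rb: "r j \<le> b" unfolding b_def using V_pos by simp
  have W_ge: "V / n \<le> W u" if u: "b < u" "u < s j" for u
  proof -
    have "u - r j \<le> (\<Sum>k | k < n \<and> mac k = 0 \<and> s k < u \<and> r j < s k + p k. p k)"
      using u j m W_nonneg by (intro machine_busy_le busy_W[of 0 j]) auto
    also have "\<dots> \<le> W u"
      unfolding W_def using rs by (intro sum_p_le) force+
    finally show ?thesis using u unfolding b_def by linarith
  qed
  have "runs_at i u" if i: "i < m" and u: "b < u" "u < s j" for i u
  proof (rule busy_W[OF i j])
    have "G * real i * p j \<le> G * real m * x\<^sub>0"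
      using i G small p_pos[OF j] by (intro mult_mono) auto
    also have "\<dots> = V / n" using G m n unfolding x\<^sub>0_def by (simp add: field_simps)
    also have "\<dots> \<le> W u" using W_ge u by simp
    finally show "G * real i * p j \<le> W u" .
  qed (use u rb in auto)
  then have "real m * (s j - b) \<le> (\<Sum>k | k < n \<and> b < s k \<and> s k < s j. p k) + V / m + V * H / G"
    by (intro all_busy_le bs) auto
  also have "(\<Sum>k | k < n \<and> b < s k \<and> s k < s j. p k) \<le> (\<Sum>k<n. x\<^sub>0)"
  proof -
    have "p k \<le> x\<^sub>0" if "k < n" "b < s k" "s k < s j" for k
      using spt[of j k] that j rb small by force
    then have "(\<Sum>k | k < n \<and> b < s k \<and> s k < s j. p k) \<le> (\<Sum>k | k < n \<and> b < s k \<and> s k < s j. x\<^sub>0)"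
      by (intro sum_mono) auto
    also have "\<dots> \<le> (\<Sum>k<n. x\<^sub>0)" using x\<^sub>0_pos by (intro sum_mono2) auto
    finally show ?thesis .
  qed
  also have "\<dots> = V / (G * m)" unfolding x\<^sub>0_def using n by simp
  finally have "s j - b \<le> (V / m + V * H / G + V / (G * m)) / m"
    using m by (simp add: field_simps)
  then show False using * unfolding b_def \<Delta>_def by linarith
qed

text \<open>For small x every single job is in time by \<open>wait_le\<close>. Otherwise look back
  from \<open>t\<close> to the last moment that is not \<open>good\<close>: there either no job of
  size at most x is pending, or less than G m x has been released at all, which is the source of the
  lag. From then on all machines are busy and start only jobs of size at most x, so the reference
  gains no more than the losses contained in m \<open>\<Delta>\<close>.\<close>

lemma volume_dominance:
  assumes x: "0 < x" "G * m * x \<le> W t"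
  shows "(\<Sum>j | j < n \<and> p j \<le> x \<and> C j \<le> t - \<Delta>. p j)
    \<le> (\<Sum>j | j < n \<and> p j \<le> x \<and> s j \<le> t. p j) + (if x \<le> x\<^sub>0 then 0 else G * m * x)"
proof (cases "x \<le> x\<^sub>0")
  case True
  have "s j \<le> t" if "j < n" "p j \<le> x" "C j \<le> t - \<Delta>" for j
    using wait_le[of j] that True C[of j] p_pos[of j] by linarith
  then have "(\<Sum>j | j < n \<and> p j \<le> x \<and> C j \<le> t - \<Delta>. p j) \<le> (\<Sum>j | j < n \<and> p j \<le> x \<and> s j \<le> t. p j)"
    by (intro sum_p_le) auto
  then show ?thesis using True by simp
next
  case False
  define good where "good u \<longleftrightarrow> (\<exists>j<n. p j \<le> x \<and> r j \<le> u \<and> u < s j) \<and> G * m * x \<le> W u" for u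
  define Bd where "Bd = {u. u \<le> t \<and> \<not> good u}"
  define b where "b = Sup Bd"
  define St where "St v = (\<Sum>j | j < n \<and> p j \<le> x \<and> s j \<le> v. p j)" for v
  \<comment> \<open>A time before all releases is not \<open>good\<close>, so the supremum is taken
    over a nonempty set.\<close>
  have "min t (Min (r ` {..<n}) - 1) \<in> Bd"
  proof -
    have "Min (r ` {..<n}) \<le> r j" if "j < n" for j using that by (intro Min_le) auto
    then have "\<not> r j \<le> min t (Min (r ` {..<n}) - 1)" if "j < n" for j using that by (smt (verit))
    then have "\<not> good (min t (Min (r ` {..<n}) - 1))" unfolding good_def by blast
    then show ?thesis unfolding Bd_def by simp
  qed
  then have Bd: "Bd \<noteq> {}" by blast
  have bdd: "bdd_above Bd" unfolding Bd_def by (intro bdd_aboveI[of _ t]) auto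
  have bt: "b \<le> t" unfolding b_def using Bd by (intro cSup_least) (auto simp: Bd_def)
  have good: "good u" if "b < u" "u < t" for u
  proof (rule ccontr)
    assume "\<not> good u"
    then have "u \<in> Bd" using that unfolding Bd_def by simp
    then have "u \<le> b" unfolding b_def by (rule cSup_upper[OF _ bdd])
    then show False using that by simp
  qed
  have "runs_at i u" if i: "i < m" and u: "b < u" "u < t" for i u
  proof -
    obtain j where j: "j < n" "p j \<le> x" "r j \<le> u" "u < s j" and W: "G * m * x \<le> W u"
      using good[OF u] unfolding good_def by blast
    have "G * real i * p j \<le> G * real m * x"
      using i G j p_pos[OF j(1)] by (intro mult_mono) auto
    then show ?thesis using W by (intro busy_W[OF i j(1,3,4)]) linarith
  qed
  then have "real m * (t - b) \<le> (\<Sum>k | k < n \<and> b < s k \<and> s k < t. p k) + V / m + V * H / G"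
    by (intro all_busy_le bt) auto
  also have "(\<Sum>k | k < n \<and> b < s k \<and> s k < t. p k) \<le> (\<Sum>k | k < n \<and> p k \<le> x \<and> b < s k \<and> s k \<le> t. p k)"
  proof (rule sum_p_le)
    have "p k \<le> x" if k: "k < n" "b < s k" "s k < t" for k
    proof -
      obtain j where j: "j < n" "p j \<le> x" "r j \<le> s k" "s k < s j"
        using good[OF k(2,3)] unfolding good_def by blast
      then show ?thesis using spt[of j k] k by linarith
    qed
    then show "{k. k < n \<and> b < s k \<and> s k < t} \<subseteq> {k. k < n \<and> p k \<le> x \<and> b < s k \<and> s k \<le> t}" by auto
  qed auto
  finally have work: "real m * (t - b) \<le>
    (\<Sum>k | k < n \<and> p k \<le> x \<and> b < s k \<and> s k \<le> t. p k) + V / m + V * H / G" by simp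
  have m\<Delta>: "V / m + V * H / G \<le> m * \<Delta>"
  proof -
    have "m * \<Delta> = m * (V / n) + (V / m + V * H / G + V / (G * m))"
    proof -
      have "m * (v + w / m) = m * v + w" for v w :: real using m by (simp add: distrib_left)
      then show ?thesis unfolding \<Delta>_def .
    qed
    moreover have "0 \<le> m * (V / n)" "0 \<le> V / (G * m)" using V_pos G by auto
    ultimately show ?thesis by linarith
  qed
  \<comment> \<open>The supremum \<open>b\<close> need not lie in \<open>Bd\<close>; a
    \<open>v\<close> in \<open>Bd\<close> within e / m of it is used instead, and m machines process
    at most \<open>e\<close> between the two.\<close>
  have "(\<Sum>j | j < n \<and> p j \<le> x \<and> C j \<le> t - \<Delta>. p j) \<le> St t + G * m * x + e" if e: "0 < e" for e
  proof -
    have "\<exists>v\<in>Bd. b - e / m < v"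
    proof -
      have "b - e / m < Sup Bd" unfolding b_def[symmetric] using e m by simp
      then show ?thesis using less_cSup_iff[OF Bd bdd] by blast
    qed
    then obtain v where v: "v \<in> Bd" "b - e / m < v" by blast
    have vb: "v \<le> b" unfolding b_def using v bdd by (intro cSup_upper)
    have me: "real m * (b - v) \<le> e" using v m by (simp add: field_simps)
    have Rv: "(\<Sum>j | j < n \<and> p j \<le> x \<and> r j \<le> v. p j) \<le> St v + G * m * x"
    proof (cases "G * m * x \<le> W v")
      case True
      have ng: "\<not> good v" using v unfolding Bd_def by simp
      have "s j \<le> v" if "j < n" "p j \<le> x" "r j \<le> v" for j
      proof (rule ccontr)
        assume "\<not> s j \<le> v"
        then have "good v" unfolding good_def using that True by (intro conjI exI[of _ j]) auto
        then show False using ng by simp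
      qed
      then have "(\<Sum>j | j < n \<and> p j \<le> x \<and> r j \<le> v. p j) \<le> St v"
        unfolding St_def by (intro sum_p_le) auto
      moreover have "0 \<le> G * m * x" using x G by simp
      ultimately show ?thesis by linarith
    next
      case False
      have "(\<Sum>j | j < n \<and> p j \<le> x \<and> r j \<le> v. p j) \<le> W v" unfolding W_def by (rule sum_p_le) auto
      moreover have "0 \<le> St v" unfolding St_def using p_pos by (intro sum_nonneg) (auto intro: less_imp_le)
      ultimately show ?thesis using False by linarith
    qed
    have Stt: "St v + (\<Sum>k | k < n \<and> p k \<le> x \<and> b < s k \<and> s k \<le> t. p k) \<le> St t"
    proof -
      have "St v + (\<Sum>k | k < n \<and> p k \<le> x \<and> b < s k \<and> s k \<le> t. p k)
        = sum p ({j. j < n \<and> p j \<le> x \<and> s j \<le> v} \<union> {k. k < n \<and> p k \<le> x \<and> b < s k \<and> s k \<le> t})"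
        unfolding St_def using vb by (intro sum.union_disjoint[symmetric]) auto
      also have "\<dots> \<le> St t"
        unfolding St_def using vb bt by (intro sum_p_le) auto
      finally show ?thesis .
    qed
    have Stp: "0 \<le> (\<Sum>k | k < n \<and> p k \<le> x \<and> b < s k \<and> s k \<le> t. p k)"
      using p_pos by (intro sum_nonneg) (auto intro: less_imp_le)
    have "{j. j < n \<and> p j \<le> x} \<subseteq> {..<n}" by auto
    from reference_volume[OF this, of "t - \<Delta>" v]
    have "(\<Sum>j | j < n \<and> p j \<le> x \<and> C j \<le> t - \<Delta>. p j)
        \<le> (\<Sum>j | j < n \<and> p j \<le> x \<and> r j \<le> v. p j) + real m * max 0 (t - \<Delta> - v)"
      by (simp only: mem_Collect_eq conj_assoc)
    moreover have "real m * max 0 (t - \<Delta> - v) \<le> (\<Sum>k | k < n \<and> p k \<le> x \<and> b < s k \<and> s k \<le> t. p k) + e"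
    proof (cases "t - \<Delta> - v \<le> 0")
      case True
      then show ?thesis using Stp e by (simp add: max_def)
    next
      case False
      have "real m * (t - \<Delta> - v) = real m * (t - b) + real m * (b - v) - m * \<Delta>"
        by (simp add: algebra_simps)
      moreover have "max 0 (t - \<Delta> - v) = t - \<Delta> - v" using False by simp
      ultimately show ?thesis using work me m\<Delta> by linarith
    qed
    ultimately show ?thesis using Rv Stt by linarith
  qed
  then have "(\<Sum>j | j < n \<and> p j \<le> x \<and> C j \<le> t - \<Delta>. p j) \<le> St t + G * m * x"
    by (rule field_le_epsilon)
  then show ?thesis using False unfolding St_def by simp
qed

definition pending :: "real \<Rightarrow> nat set" where "pending t = {j. j < n \<and> r j \<le> t \<and> t < s j}"
definition running :: "real \<Rightarrow> nat set" where "running t = {j. j < n \<and> s j \<le> t \<and> t < s j + p j}"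
text \<open>Jobs alive in the reference schedule when it is shifted by \<open>\<Delta>\<close>;
  integrated over time, their number is the reference flow plus n \<open>\<Delta>\<close>.\<close>

definition delayed :: "real \<Rightarrow> nat set" where "delayed t = {j. j < n \<and> r j \<le> t \<and> t < C j + \<Delta>}"

lemma card_running_ge:
  assumes "\<And>i. i \<in> I \<Longrightarrow> runs_at i t"
  shows "card I \<le> card (running t)"
proof (rule surj_card_le)
  show "I \<subseteq> mac ` running t"
  proof
    fix i assume "i \<in> I"
    then obtain k where "k < n" "mac k = i" "s k \<le> t" "t < s k + p k"
      using assms[of i] unfolding runs_at_def by auto
    then show "i \<in> mac ` running t" unfolding running_def by auto
  qed
qed (simp add: running_def)

lemma card_pending_big_le:
  fixes x :: real
  assumes "X \<subseteq> pending t" "0 < x" "\<And>j. j \<in> X \<Longrightarrow> x \<le> p j"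
  shows "card X * x \<le> W t"
proof -
  have "card X * x = (\<Sum>j\<in>X. x)" by simp
  also have "\<dots> \<le> sum p X" using assms by (intro sum_mono) auto
  also have "\<dots> \<le> W t" unfolding W_def using assms(1) by (intro sum_p_le) (auto simp: pending_def)
  finally show ?thesis .
qed

lemma card_pending_le:
  "card (pending t) \<le> G * (2 + ln n) * card (running t) + card (delayed t)"
proof (cases "pending t = {}")
  case True
  then show ?thesis using G n by simp
next
  case False
  have fin: "finite (pending t)" unfolding pending_def by simp
  obtain j where j: "j \<in> pending t" "\<And>k. k \<in> pending t \<Longrightarrow> p j \<le> p k"
    using False fin by (metis arg_min_if_finite(1) arg_min_least)
  have jn: "j < n" "r j \<le> t" "t < s j" using j unfolding pending_def by auto
  have pj: "0 < p j" using p_pos jn by simp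
  have Wp: "card (pending t) * p j \<le> W t"
    using j pj by (intro card_pending_big_le) auto
  have lnn: "0 \<le> ln (real n)" using n by simp
  show ?thesis
  proof (cases "G * m * p j \<le> W t")
    case False
    \<comment> \<open>Machines 0 to floor(q) admit the shortest pending job; counting machine 0
      these are at least q, while the number of pending jobs is at most G q.\<close>
    define q where "q = W t / (G * p j)"
    have q: "0 \<le> q" "q < m" using False W_nonneg G pj unfolding q_def by (auto simp: field_simps)
    have "real (card (pending t)) \<le> G * q" using Wp G pj unfolding q_def by (simp add: field_simps)
    also have "q \<le> card {..nat \<lfloor>q\<rfloor>}" using q by simp linarith
    also have "card {..nat \<lfloor>q\<rfloor>} \<le> card (running t)"
    proof (rule card_running_ge)
      fix i assume "i \<in> {..nat \<lfloor>q\<rfloor>}"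
      then have i: "real i \<le> q" using q by simp linarith
      show "runs_at i t"
      proof (rule busy_W[OF _ jn])
        show "i < m" using i q by linarith
        show "G * real i * p j \<le> W t" using i G pj unfolding q_def by (simp add: field_simps)
      qed
    qed
    finally have "real (card (pending t)) \<le> G * card (running t)" using G by simp
    also have "\<dots> \<le> G * (2 + ln n) * card (running t)" using G lnn by (intro mult_right_mono) auto
    finally show ?thesis by simp
  next
    case True
    \<comment> \<open>The size up to which the condition of \<open>volume_dominance\<close> holds
      now. More than G m pending jobs above it would exceed the released work.\<close>
    define \<tau> where "\<tau> = W t / (G * m)"
    have \<tau>: "p j \<le> \<tau>" using True G m unfolding \<tau>_def by (simp add: field_simps)
    have \<tau>0: "0 < \<tau>" using \<tau> pj by linarith
    have "card {..<m} \<le> card (running t)"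
    proof (rule card_running_ge)
      fix i assume i: "i \<in> {..<m}"
      have "G * real i * p j \<le> G * m * p j" using i G pj by (intro mult_right_mono) auto
      then show "runs_at i t" using i True by (intro busy_W[OF _ jn]) auto
    qed
    then have mB: "m \<le> card (running t)" by simp
    define big where "big = {k \<in> pending t. \<tau> < p k}"
    define started where "started = {k. k < n \<and> p k \<le> \<tau> \<and> s k \<le> t}"
    define finished where "finished = {k. k < n \<and> p k \<le> \<tau> \<and> C k \<le> t - \<Delta>}"
    define arrived where "arrived = {k. k < n \<and> p k \<le> \<tau> \<and> r k \<le> t}"
    have fins: "finite started" "finite finished" "finite arrived" "finite big" "finite (delayed t)"
      using fin unfolding started_def finished_def arrived_def big_def delayed_def by auto
    have "card big * \<tau> \<le> W t"
      using \<tau>0 by (intro card_pending_big_le) (auto simp: big_def)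
    then have big: "card big \<le> G * m" using \<tau>0 G m unfolding \<tau>_def by (simp add: field_simps)
    have "real (card finished) \<le> card started + G * m * (1 + ln n)"
    proof (rule card_weighted_dominance[OF fins(1,2)])
      show "\<tau> \<le> real n * x\<^sub>0" using W_le[of t] G m n unfolding \<tau>_def x\<^sub>0_def by (simp add: field_simps)
      show "0 < p k \<and> p k \<le> \<tau>" if "k \<in> started \<union> finished" for k
        using that p_pos unfolding started_def finished_def by auto
      fix x assume x: "0 < x" "x \<le> \<tau>"
      have "G * m * x \<le> W t" using x G m unfolding \<tau>_def by (simp add: field_simps)
      note volume_dominance[OF x(1) this]
      moreover have "{k. k < n \<and> p k \<le> x \<and> C k \<le> t - \<Delta>} = {k. k \<in> finished \<and> p k \<le> x}"
        "{k. k < n \<and> p k \<le> x \<and> s k \<le> t} = {k. k \<in> started \<and> p k \<le> x}"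
        using x unfolding finished_def started_def by auto
      ultimately show "(\<Sum>k | k \<in> finished \<and> p k \<le> x. p k)
        \<le> (\<Sum>k | k \<in> started \<and> p k \<le> x. p k) + (if x \<le> x\<^sub>0 then 0 else G * m * x)" by simp
    qed (use x\<^sub>0_pos n G \<tau>0 in auto)
    moreover have "card (pending t) \<le> card big + card (arrived - started)"
    proof -
      have "pending t \<subseteq> big \<union> (arrived - started)"
        unfolding big_def arrived_def started_def pending_def by auto
      then have "card (pending t) \<le> card (big \<union> (arrived - started))"
        using fins by (intro card_mono) auto
      also have "\<dots> \<le> card big + card (arrived - started)" by (rule card_Un_le)
      finally show ?thesis .
    qed
    moreover have "card (arrived - started) + card started = card arrived"
    proof -
      have "started \<subseteq> arrived" using rs unfolding arrived_def started_def by force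
      from card_mono[OF fins(3) this] card_Diff_subset[OF fins(1) this] show ?thesis by simp
    qed
    moreover have "card arrived \<le> card finished + card (delayed t)"
    proof -
      have "arrived \<subseteq> finished \<union> delayed t"
        unfolding arrived_def finished_def delayed_def by auto
      then have "card arrived \<le> card (finished \<union> delayed t)"
        using fins by (intro card_mono) auto
      also have "\<dots> \<le> card finished + card (delayed t)" by (rule card_Un_le)
      finally show ?thesis .
    qed
    ultimately have "card (pending t) \<le> G * m + G * m * (1 + ln n) + card (delayed t)"
      using big by linarith
    also have "\<dots> = G * (2 + ln n) * m + card (delayed t)" by (simp add: algebra_simps)
    also have "G * (2 + ln n) * m \<le> G * (2 + ln n) * card (running t)"
      using mB G lnn by (intro mult_left_mono) auto
    finally show ?thesis by simp
  qed
qed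

text \<open>Integrates \<open>card_pending_le\<close> over time: the three counts become total
  waiting time, total processing time and delayed reference flow.\<close>

lemma waiting_le:
  "(\<Sum>j<n. s j - r j) \<le> G * (2 + ln n) * V + (\<Sum>j<n. C j + \<Delta> - r j)"
proof -
  have I: "integrable lborel (indicat_real {x..<y})" "x \<le> y \<Longrightarrow> integral\<^sup>L lborel (indicat_real {x..<y}) = y - x"
    for x y :: real
    using emeasure_bounded_finite[of "{x..<y}"] by (auto simp: less_top)
  have card_eq: "real (card {j. j < n \<and> a j \<le> t \<and> t < b j}) = (\<Sum>j<n. indicat_real {a j..<b j} t)"
    for a b :: "nat \<Rightarrow> real" and t
    by (simp add: indicator_def sum.If_cases Int_def)
  have J: "integral\<^sup>L lborel (\<lambda>t. \<Sum>j<n. indicat_real {a j..<b j} t) = (\<Sum>j<n. b j - a j)"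
    if "\<And>j. j < n \<Longrightarrow> a j \<le> b j" for a b :: "nat \<Rightarrow> real"
    using that by (subst Bochner_Integration.integral_sum) (auto simp: I)
  have "integral\<^sup>L lborel (\<lambda>t. \<Sum>j<n. indicat_real {r j..<s j} t)
    \<le> integral\<^sup>L lborel (\<lambda>t. G * (2 + ln n) * (\<Sum>j<n. indicat_real {s j..<s j + p j} t)
        + (\<Sum>j<n. indicat_real {r j..<C j + \<Delta>} t))"
  proof (rule integral_mono)
    fix t
    show "(\<Sum>j<n. indicat_real {r j..<s j} t) \<le> G * (2 + ln n) * (\<Sum>j<n. indicat_real {s j..<s j + p j} t)
        + (\<Sum>j<n. indicat_real {r j..<C j + \<Delta>} t)"
      using card_pending_le[of t] unfolding pending_def running_def delayed_def card_eq .
  qed (intro Bochner_Integration.integrable_add integrable_mult_right Bochner_Integration.integrable_sum I)+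
  also have "\<dots> = G * (2 + ln n) * integral\<^sup>L lborel (\<lambda>t. \<Sum>j<n. indicat_real {s j..<s j + p j} t)
        + integral\<^sup>L lborel (\<lambda>t. \<Sum>j<n. indicat_real {r j..<C j + \<Delta>} t)"
    by (subst Bochner_Integration.integral_add)
      (auto intro!: integrable_mult_right Bochner_Integration.integrable_sum I simp del: sum_mult_indicator)
  also have "integral\<^sup>L lborel (\<lambda>t. \<Sum>j<n. indicat_real {s j..<s j + p j} t) = V"
    unfolding V_def using p_pos by (subst J) (auto intro: less_imp_le)
  also have "integral\<^sup>L lborel (\<lambda>t. \<Sum>j<n. indicat_real {r j..<C j + \<Delta>} t) = (\<Sum>j<n. C j + \<Delta> - r j)"
  proof (rule J)
    fix j assume "j < n"
    then show "r j \<le> C j + \<Delta>" using C[of j] p_pos[of j] \<Delta>_nonneg by linarith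
  qed
  also have "integral\<^sup>L lborel (\<lambda>t. \<Sum>j<n. indicat_real {r j..<s j} t) = (\<Sum>j<n. s j - r j)"
    using rs by (subst J) auto
  finally show ?thesis .
qed

theorem total_flow_le:
  "(\<Sum>j<n. s j + p j - r j)
    \<le> (3 + n / m\<^sup>2 + n * (H + 1) / (G * m) + G * (2 + ln n)) * (\<Sum>j<n. C j - r j)"
proof -
  have V_le: "V \<le> (\<Sum>j<n. C j - r j)"
    unfolding V_def using C by (intro sum_mono) (auto simp: algebra_simps)
  have "n * \<Delta> = V + n / m\<^sup>2 * V + n * H / (G * m) * V + n / (G * m * m) * V"
  proof -
    have "N * (V / N + (V / M + V * h / g + V / (g * M)) / M)
        = V + N / M\<^sup>2 * V + N * h / (g * M) * V + N / (g * M * M) * V"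
      if "N \<noteq> 0" for N M g h :: real
    proof -
      have "N * (V / N) = V" using that by simp
      then show ?thesis by (simp add: distrib_left add_divide_distrib power2_eq_square ac_simps)
    qed
    then show ?thesis unfolding \<Delta>_def using n by simp
  qed
  \<comment> \<open>A factor 1 / m is given away so that this term merges with the harmonic one into
    H + 1.\<close>
  also have "n / (G * m * m) * V \<le> n / (G * m) * V"
  proof -
    have "n / (G * m) / m \<le> n / (G * m) / 1" using G m by (intro divide_left_mono) auto
    then show ?thesis using V_pos by (intro mult_right_mono) auto
  qed
  finally have "n * \<Delta> \<le> (1 + n / m\<^sup>2 + n * (H + 1) / (G * m)) * V"
    by (simp add: algebra_simps add_divide_distrib)
  moreover have "(\<Sum>j<n. s j + p j - r j) = (\<Sum>j<n. s j - r j) + V"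
    unfolding V_def by (simp add: sum.distrib[symmetric] algebra_simps)
  moreover have "(\<Sum>j<n. C j + \<Delta> - r j) = (\<Sum>j<n. C j - r j) + n * \<Delta>"
    by (simp add: sum.distrib sum_subtractf)
  ultimately have "(\<Sum>j<n. s j + p j - r j)
    \<le> (2 + n / m\<^sup>2 + n * (H + 1) / (G * m) + G * (2 + ln n)) * V + (\<Sum>j<n. C j - r j)"
    using waiting_le by (simp add: algebra_simps)
  also have "(2 + n / m\<^sup>2 + n * (H + 1) / (G * m) + G * (2 + ln n)) * V
    \<le> (2 + n / m\<^sup>2 + n * (H + 1) / (G * m) + G * (2 + ln n)) * (\<Sum>j<n. C j - r j)"
    using V_le H_nonneg G n by (intro mult_left_mono add_nonneg_nonneg) auto
  finally show ?thesis by (simp add: algebra_simps)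
qed

end

section \<open>Volume bounds for preemptive schedules\<close>

context
  fixes m :: nat and J :: jobs and \<sigma> :: "nat \<Rightarrow> nat" and Q :: "(nat \<times> real \<times> real) set"
  assumes Q: "preemptive_schedule m J \<sigma> Q" and J: "valid_jobs J"
begin

lemmas preemptive = Q[unfolded preemptive_schedule_def]

lemma preemptive_piece:
  assumes "q \<in> Q"
  shows "fst q < length J" "rel J (fst q) \<le> fst (snd q)" "fst (snd q) < snd (snd q)"
    "snd (snd q) \<le> completion Q (fst q)" "\<sigma> (fst q) < m"
proof -
  obtain j a b where q: "q = (j, a, b)" by (cases q)
  have "\<forall>(j, a, b)\<in>Q. j < length J \<and> rel J j \<le> a \<and> a < b"
    using preemptive by (elim conjE)
  from bspec[OF this assms] show "fst q < length J" "rel J (fst q) \<le> fst (snd q)" "fst (snd q) < snd (snd q)"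
    unfolding q by simp_all
  moreover have "\<forall>j<length J. \<sigma> j < m" using preemptive by (elim conjE)
  ultimately show "\<sigma> (fst q) < m" by blast
  have "{b. \<exists>a. (j, a, b) \<in> Q} \<subseteq> (\<lambda>q. snd (snd q)) ` Q" by force
  then have "finite {b. \<exists>a. (j, a, b) \<in> Q}"
    using finite_surj[OF conjunct1[OF preemptive]] by blast
  then show "snd (snd q) \<le> completion Q (fst q)"
    using assms unfolding completion_def q by (auto intro!: Max_ge)
qed

lemma preemptive_pieces_disjoint:
  assumes "q \<in> Q" "q' \<in> Q" "q \<noteq> q'" "\<sigma> (fst q) = \<sigma> (fst q')"
  shows "snd (snd q) \<le> fst (snd q') \<or> snd (snd q') \<le> fst (snd q)"
proof -
  have "\<forall>(i, a, b)\<in>Q. \<forall>(j, c, d)\<in>Q. (i, a, b) \<noteq> (j, c, d) \<and> \<sigma> i = \<sigma> j \<longrightarrow> b \<le> c \<or> d \<le> a"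
    using preemptive by (elim conjE)
  from bspec[OF this assms(1)] show ?thesis
    using assms by (cases q; cases q') auto
qed

lemma preemptive_finite: "finite Q"
  using preemptive by (elim conjE)

lemma preemptive_total:
  "j < length J \<Longrightarrow> (\<Sum>q | q \<in> Q \<and> fst q = j. snd (snd q) - fst (snd q)) = ptime J j"
  using preemptive[THEN conjunct2, THEN conjunct2, THEN conjunct2, THEN conjunct2]
  by (simp only: case_prod_unfold Collect_conj_eq[symmetric])

lemma completion_ge:
  assumes j: "j < length J"
  shows "rel J j + ptime J j \<le> completion Q j"
proof -
  \<comment> \<open>A positive size forces at least one piece, so \<open>completion\<close> is not
    the maximum of an empty set.\<close>
  have "(\<Sum>q | q \<in> Q \<and> fst q = j. snd (snd q) - fst (snd q)) \<noteq> 0"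
    using preemptive_total[OF j] J j unfolding valid_jobs_def by force
  then obtain q where q: "q \<in> Q" "fst q = j" by (metis (mono_tags, lifting) mem_Collect_eq sum.neutral)
  have "(\<Sum>q | q \<in> Q \<and> fst q = j. snd (snd q) - fst (snd q)) \<le> completion Q j - rel J j"
  proof (rule interval_pack_le)
    show "rel J j \<le> completion Q j" using preemptive_piece[OF q(1)] q by simp
  qed (use preemptive_finite in \<open>auto dest: preemptive_piece preemptive_pieces_disjoint intro: less_imp_le\<close>)
  then show ?thesis using preemptive_total[OF j] by simp
qed

text \<open>Every piece is cut at \<open>v\<close>. The part before \<open>v\<close> belongs to jobs
  released by \<open>v\<close> and is bounded by their sizes; the part after \<open>v\<close> ends
  by \<open>u\<close>, and on each machine these parts are disjoint.\<close>

lemma preemptive_volume: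
  assumes X: "X \<subseteq> {..<length J}"
  shows "(\<Sum>j | j \<in> X \<and> completion Q j \<le> u. ptime J j)
    \<le> (\<Sum>j | j \<in> X \<and> rel J j \<le> v. ptime J j) + real m * max 0 (u - v)"
proof -
  define lo hi where "lo = (\<lambda>q :: nat \<times> real \<times> real. fst (snd q))" and "hi = (\<lambda>q :: nat \<times> real \<times> real. snd (snd q))"
  have piece: "fst q < length J" "rel J (fst q) \<le> lo q" "lo q < hi q" "hi q \<le> completion Q (fst q)" "\<sigma> (fst q) < m"
    if "q \<in> Q" for q
    using preemptive_piece[OF that] unfolding lo_def hi_def by auto
  have finX: "finite X" using X finite_subset by blast
  define Y where "Y = {j. j \<in> X \<and> completion Q j \<le> u}"
  define T where "T = {q \<in> Q. fst q \<in> Y}"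
  have fin: "finite Y" "finite T" using finX preemptive_finite unfolding Y_def T_def by auto
  have group: "(\<Sum>j\<in>Y. \<Sum>q | q \<in> Q \<and> fst q = j. f q) = sum f T" for f :: "nat \<times> real \<times> real \<Rightarrow> real"
  proof -
    have "(\<Sum>j\<in>Y. \<Sum>q | q \<in> T \<and> fst q = j. f q) = sum f T"
      using fin by (intro sum.group) (auto simp: T_def)
    moreover have "{q. q \<in> T \<and> fst q = j} = {q. q \<in> Q \<and> fst q = j}" if "j \<in> Y" for j
      using that unfolding T_def by auto
    ultimately show ?thesis by (simp cong: sum.cong)
  qed
  have "(\<Sum>j\<in>Y. ptime J j) = (\<Sum>j\<in>Y. \<Sum>q | q \<in> Q \<and> fst q = j. hi q - lo q)"
    using X unfolding lo_def hi_def Y_def by (intro sum.cong) (auto simp: preemptive_total)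
  \<comment> \<open>The difference of minima is the length before \<open>v\<close>, that of maxima
    the length after it.\<close>
  also have "\<dots> = (\<Sum>j\<in>Y. \<Sum>q | q \<in> Q \<and> fst q = j. (min (hi q) v - min (lo q) v) + (max (hi q) v - max (lo q) v))"
    by (intro sum.cong) (auto simp: min_def max_def)
  also have "\<dots> = (\<Sum>j\<in>Y. \<Sum>q | q \<in> Q \<and> fst q = j. min (hi q) v - min (lo q) v) + (\<Sum>q\<in>T. max (hi q) v - max (lo q) v)"
    by (simp add: sum.distrib group)
  also have "(\<Sum>j\<in>Y. \<Sum>q | q \<in> Q \<and> fst q = j. min (hi q) v - min (lo q) v)
    \<le> (\<Sum>j\<in>Y. if rel J j \<le> v then ptime J j else 0)"
  proof (rule sum_mono)
    fix j assume "j \<in> Y"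
    then have j: "j < length J" using X unfolding Y_def by auto
    show "(\<Sum>q | q \<in> Q \<and> fst q = j. min (hi q) v - min (lo q) v) \<le> (if rel J j \<le> v then ptime J j else 0)"
    proof (cases "rel J j \<le> v")
      case True
      have "(\<Sum>q | q \<in> Q \<and> fst q = j. min (hi q) v - min (lo q) v) \<le> (\<Sum>q | q \<in> Q \<and> fst q = j. hi q - lo q)"
        using piece(3) by (intro sum_mono) (force simp: min_def)
      then show ?thesis using True preemptive_total[OF j] unfolding lo_def hi_def by simp
    next
      case False
      have "(\<Sum>q | q \<in> Q \<and> fst q = j. min (hi q) v - min (lo q) v) \<le> 0"
        using piece(2,3) False by (intro sum_nonpos) (force simp: min_def)
      then show ?thesis using False by simp
    qed
  qed
  also have "\<dots> = (\<Sum>j | j \<in> Y \<and> rel J j \<le> v. ptime J j)"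
    using fin by (simp add: sum.If_cases Int_def)
  also have "\<dots> \<le> (\<Sum>j | j \<in> X \<and> rel J j \<le> v. ptime J j)"
    using finX X J unfolding Y_def by (intro sum_mono2) (auto simp: valid_jobs_def intro: less_imp_le)
  also have "(\<Sum>q\<in>T. max (hi q) v - max (lo q) v)
      = (\<Sum>i<m. \<Sum>q | q \<in> T \<and> \<sigma> (fst q) = i. max (hi q) v - max (lo q) v)"
    using fin piece(5) by (intro sum.group[symmetric]) (auto simp: T_def)
  also have "\<dots> \<le> (\<Sum>i<m. max u v - v)"
  proof (rule sum_mono)
    fix i
    show "(\<Sum>q | q \<in> T \<and> \<sigma> (fst q) = i. max (hi q) v - max (lo q) v) \<le> max u v - v"
    proof (rule interval_pack_le)
      fix q assume q: "q \<in> {q. q \<in> T \<and> \<sigma> (fst q) = i}"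
      then have "q \<in> Q" "completion Q (fst q) \<le> u" unfolding T_def Y_def by auto
      then have "q \<in> Q" "hi q \<le> u" using piece(4)[of q] by auto
      then show "v \<le> max (lo q) v \<and> max (lo q) v \<le> max (hi q) v \<and> max (hi q) v \<le> max u v"
        using piece(3)[of q] by auto
      fix q' assume q': "q' \<in> {q. q \<in> T \<and> \<sigma> (fst q) = i}" "q \<noteq> q'"
      then have "hi q \<le> lo q' \<or> hi q' \<le> lo q"
        using q preemptive_pieces_disjoint[of q q'] unfolding T_def lo_def hi_def by auto
      then show "max (hi q) v \<le> max (lo q') v \<or> max (hi q') v \<le> max (lo q) v" by auto
    qed (use fin in auto)
  qed
  also have "\<dots> = real m * max 0 (u - v)" by (simp add: max_def)
  finally show ?thesis unfolding Y_def by simp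
qed

end

lemma nonpreemptive_preemptive:
  assumes "nonpreemptive_schedule m J S" "valid_jobs J"
  shows "preemptive_schedule m J (machine S) ((\<lambda>j. (j, start S j, start S j + ptime J j)) ` {..<length J})"
proof -
  let ?f = "\<lambda>j. (j, start S j, start S j + ptime J j)"
  have "{q \<in> ?f ` {..<length J}. fst q = j} = {?f j}" if "j < length J" for j using that by auto
  then show ?thesis
    using assms unfolding preemptive_schedule_def nonpreemptive_schedule_def valid_jobs_def by auto
qed

text \<open>The infimum need not be attained, so the bound is required for every preemptive
  schedule. The given non-preemptive schedule only shows that the set is nonempty, without which
  \<open>Inf\<close> would say nothing.\<close>

lemma le_OPT:
  assumes "nonpreemptive_schedule m J S" "valid_jobs J" "0 < \<Gamma>"
    and "\<And>\<sigma> Q. preemptive_schedule m J \<sigma> Q \<Longrightarrow> F \<le> \<Gamma> * preemptive_flow J Q"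
  shows "F \<le> \<Gamma> * OPT m J"
proof -
  have "F / \<Gamma> \<le> OPT m J"
    unfolding OPT_def
  proof (rule cInf_greatest)
    show "{preemptive_flow J Q | \<sigma> Q. preemptive_schedule m J \<sigma> Q} \<noteq> {}"
      using nonpreemptive_preemptive[OF assms(1,2)] by blast
  qed (use assms(3,4) in \<open>auto simp: field_simps\<close>)
  then show ?thesis using assms(3) by (simp add: field_simps)
qed

section \<open>Logarithmic estimates\<close>

lemma sum_inverse_le_ln: "(\<Sum>i=1..<m. 1 / real i) \<le> 1 + ln m" if "1 \<le> m" for m :: nat
proof -
  have *: "(\<Sum>i=1..<Suc k. 1 / real i) \<le> 1 + ln k" if "1 \<le> k" for k :: nat
    using that
  proof (induction k rule: dec_induct)
    case (step k)
    have "ln (real k / real (Suc k)) \<le> real k / real (Suc k) - 1"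
      using step by (intro ln_le_minus_one) simp
    then have "1 / real (Suc k) \<le> ln (Suc k) - ln k" using step by (simp add: ln_div field_simps)
    then show ?case using step by simp
  qed simp
  show ?thesis
  proof (cases "m = 1")
    case False
    then have "(\<Sum>i=1..<m. 1 / real i) \<le> 1 + ln (m - 1)" using *[of "m - 1"] that by simp
    also have "\<dots> \<le> 1 + ln m" using False that by simp
    finally show ?thesis .
  qed simp
qed

lemma ln_le_powr: "ln x \<le> x powr a / a" if "0 < x" "0 < a" for x a :: real
proof -
  have "a * ln x = ln (x powr a)" using that by (simp add: ln_powr)
  also have "\<dots> \<le> x powr a" using that by (intro less_imp_le ln_less_self) simp
  finally show ?thesis using that by (simp add: field_simps)
qed

text \<open>For n \<le> m^4 the logarithm of n is at most 4 ln m. For larger n a small power absorbs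
  it: with y = n^(1/8), m \<le> y^2 gives g y \<le> n / m^2, while 1 + ln n \<le> 9 y. The factor 16
  leaves room in both cases.\<close>

lemma sqrt_ln_le:
  fixes n m :: nat
  assumes m: "1 \<le> m" and mn: "m \<le> n"
  defines "g \<equiv> sqrt (real n / real m)"
  defines "b \<equiv> real n / (real m)\<^sup>2 + g * log 2 m"
  shows "1 + real n / (real m)\<^sup>2 + g * (1 + ln n) \<le> 16 * b"
proof -
  have b: "real n / (real m)\<^sup>2 + g * log 2 m = b" unfolding b_def ..
  have g1: "1 \<le> g" unfolding g_def using m mn by simp
  have log0: "0 \<le> log 2 m" using m by simp
  have glog: "0 \<le> g * log 2 m" using g1 log0 by simp
  have nm: "0 \<le> real n / (real m)\<^sup>2" by simp
  have ln0: "0 \<le> ln (real n)" using m mn by simp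
  have lnlog: "ln (real m) \<le> log 2 m"
  proof -
    have "ln 2 \<le> (1 :: real)" using ln_le_minus_one[of 2] by simp
    then have "ln (real m) * ln 2 \<le> ln (real m) * 1" using m by (intro mult_left_mono) auto
    then show ?thesis using m by (simp add: log_def field_simps)
  qed
  show ?thesis
  proof (cases "real n \<le> real m ^ 4")
    case True
    show ?thesis
    proof (cases "m = 1")
      case True
      \<comment> \<open>Here log 2 m = 0 contributes nothing, but n / m^2 = 1.\<close>
      moreover have "n = 1" using True \<open>real n \<le> real m ^ 4\<close> mn by simp
      ultimately show ?thesis unfolding b_def g_def by simp
    next
      case False
      then have "2 \<le> real m" using m by linarith
      then have log1: "1 \<le> log 2 m" by (simp add: le_log_iff)
      have "ln (real n) \<le> ln (real m ^ 4)" using True m mn by (subst ln_le_cancel_iff) auto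
      also have "\<dots> = 4 * ln m" using m by (simp add: ln_realpow)
      finally have "1 + ln n \<le> 5 * log 2 m" using lnlog log1 by linarith
      then have "g * (1 + ln n) \<le> 5 * (g * log 2 m)" using g1 by simp
      moreover have "1 \<le> g * log 2 m" using mult_mono[OF g1 log1] g1 by simp
      moreover have "1 + x + w \<le> 16 * (x + z)" if "w \<le> 5 * z" "1 \<le> z" "0 \<le> x" for w x z :: real
        using that by argo
      ultimately show ?thesis using nm unfolding b_def by blast
    qed
  next
    case False
    define y where "y = real n powr (1/8)"
    have n1: "1 \<le> real n" using m mn by linarith
    have y8: "y ^ 8 = real n" unfolding y_def using n1 by (simp add: powr_realpow[symmetric] powr_powr)
    have y1: "1 \<le> y" unfolding y_def using n1 by (simp add: ge_one_powr_ge_zero)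
    have "real m ^ 4 \<le> (y\<^sup>2) ^ 4" using False y8 by (simp add: power_mult[symmetric])
    then have my: "real m \<le> y\<^sup>2" using y1 by (subst (asm) power_mono_iff) auto
    have "ln n \<le> 8 * y" using ln_le_powr[of "real n" "1/8"] n1 unfolding y_def by simp
    then have ln9: "1 + ln n \<le> 9 * y" using y1 by linarith
    have "g * y \<le> real n / (real m)\<^sup>2"
    proof (rule power2_le_imp_le)
      have "(g * y)\<^sup>2 = real n / real m * y\<^sup>2" unfolding g_def by (simp add: power_mult_distrib)
      also have "\<dots> \<le> real n / real m * (y ^ 8 / real m ^ 3)"
      proof (rule mult_left_mono)
        have "real m ^ 3 * y\<^sup>2 \<le> (y\<^sup>2) ^ 3 * y\<^sup>2" using my by (intro mult_right_mono power_mono) auto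
        also have "\<dots> = y ^ 8" by (simp add: power_mult[symmetric] power_add[symmetric])
        finally show "y\<^sup>2 \<le> y ^ 8 / real m ^ 3" using m by (simp add: field_simps)
      qed simp
      also have "\<dots> = (real n / (real m)\<^sup>2)\<^sup>2"
        unfolding y8 by (simp add: power_divide power2_eq_square numeral_eq_Suc)
      finally show "(g * y)\<^sup>2 \<le> (real n / (real m)\<^sup>2)\<^sup>2" .
    qed simp
    moreover have "g * (1 + ln n) \<le> 9 * (g * y)" using ln9 g1 by simp
    moreover have "1 \<le> g * y" using mult_mono[OF g1 y1] g1 by simp
    moreover have "1 + x + z \<le> 16 * (x + w)" if "v \<le> x" "z \<le> 9 * v" "1 \<le> v" "0 \<le> w" for v w x z :: real
      using that by argo
    ultimately show ?thesis using glog unfolding b_def by blast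
  qed
qed

section \<open>The algorithm as a sequence of assignments\<close>

text \<open>\<open>now\<close> is the start of the latest assignment; assignments are made in
  nondecreasing order of start, so it acts as the clock. Values of \<open>mach\<close> and
  \<open>begins\<close> outside \<open>assigned\<close> are mere defaults.\<close>

record sched =
  assigned :: "nat set"
  mach :: "nat \<Rightarrow> nat"
  begins :: "nat \<Rightarrow> real"
  free :: "nat \<Rightarrow> real"
  now :: real

definition work :: "jobs \<Rightarrow> real \<Rightarrow> real" where
  "work J t = (\<Sum>l | l < length J \<and> rel J l \<le> t. ptime J l)"

text \<open>The admission rule squared and cleared of fractions, so that no square root has to be
  computed; \<open>admits_iff\<close> recovers the original form.\<close>

definition admits :: "nat \<Rightarrow> jobs \<Rightarrow> nat \<Rightarrow> real \<Rightarrow> real \<Rightarrow> bool" where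
  "admits m J i p w \<longleftrightarrow> real (length J) * (real i * p)\<^sup>2 \<le> real m * w\<^sup>2"

text \<open>A candidate is a triple of a machine, a job and a job at whose release the machine is ready to
  admit the second component, packed into one number.\<close>

definition cand_mach :: "nat \<Rightarrow> nat \<Rightarrow> nat" where "cand_mach n x = x div n div n"
definition cand_job :: "nat \<Rightarrow> nat \<Rightarrow> nat" where "cand_job n x = x div n mod n"
definition cand_rel :: "nat \<Rightarrow> nat \<Rightarrow> nat" where "cand_rel n x = x mod n"

definition feasible :: "nat \<Rightarrow> jobs \<Rightarrow> sched \<Rightarrow> nat \<Rightarrow> bool" where
  "feasible m J st x \<longleftrightarrow> cand_job (length J) x \<notin> assigned st \<and>
     admits m J (cand_mach (length J) x) (ptime J (cand_job (length J) x))
       (work J (rel J (cand_rel (length J) x)))"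

definition cand_time :: "jobs \<Rightarrow> sched \<Rightarrow> nat \<Rightarrow> real" where
  "cand_time J st x = max (max (free st (cand_mach (length J) x)) (rel J (cand_job (length J) x)))
     (rel J (cand_rel (length J) x))"

definition better :: "jobs \<Rightarrow> sched \<Rightarrow> nat \<Rightarrow> nat \<Rightarrow> bool" where
  "better J st x y \<longleftrightarrow> cand_time J st x < cand_time J st y \<or>
     cand_time J st x = cand_time J st y \<and>
     ptime J (cand_job (length J) x) < ptime J (cand_job (length J) y)"

text \<open>Replacing only on strict improvement keeps the smallest number among equally good
  candidates.\<close>

primrec scan :: "nat \<Rightarrow> jobs \<Rightarrow> sched \<Rightarrow> nat \<Rightarrow> nat option" where
  "scan m J st 0 = None"
| "scan m J st (Suc x) =
    (if feasible m J st x \<and> (\<forall>y. scan m J st x = Some y \<longrightarrow> better J st x y) then Some x else scan m J st x)"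

definition assign :: "jobs \<Rightarrow> nat \<Rightarrow> sched \<Rightarrow> sched" where
  "assign J x st = (let j = cand_job (length J) x; i = cand_mach (length J) x; t = cand_time J st x in
     \<lparr>assigned = insert j (assigned st), mach = (mach st)(j := i), begins = (begins st)(j := t),
      free = (free st)(i := t + ptime J j), now = t\<rparr>)"

definition advance :: "nat \<Rightarrow> jobs \<Rightarrow> sched \<Rightarrow> sched" where
  "advance m J st =
    (case scan m J st (m * length J * length J) of None \<Rightarrow> st | Some x \<Rightarrow> assign J x st)"

definition initial :: sched where
  "initial = \<lparr>assigned = {}, mach = (\<lambda>_. 0), begins = (\<lambda>_. 0), free = (\<lambda>_. 0), now = 0\<rparr>"

definition after :: "nat \<Rightarrow> jobs \<Rightarrow> nat \<Rightarrow> sched" where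
  "after m J q = (advance m J ^^ q) initial"

definition greedy :: algorithm where
  "greedy m J = (if length J \<le> m then map (\<lambda>j. (j, rel J j)) [0..<length J]
     else map (\<lambda>j. (mach (after m J (length J)) j, begins (after m J (length J)) j)) [0..<length J])"

lemma after_Suc: "after m J (Suc q) = advance m J (after m J q)"
  unfolding after_def by simp

text \<open>The result of the scan, including its tie rule, described without the order of
  evaluation. In this form it transfers between instances that agree up to some time.\<close>

definition best :: "nat \<Rightarrow> jobs \<Rightarrow> sched \<Rightarrow> nat \<Rightarrow> nat \<Rightarrow> bool" where
  "best m J st N x \<longleftrightarrow> x < N \<and> feasible m J st x \<and>
     (\<forall>y<N. feasible m J st y \<longrightarrow> \<not> better J st y x \<and> (y < x \<longrightarrow> better J st x y))"

lemma scan_None: "scan m J st N = None \<longleftrightarrow> (\<forall>x<N. \<not> feasible m J st x)"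
  by (induction N) (auto simp: less_Suc_eq)

lemma better_trans: "better J st x y \<Longrightarrow> \<not> better J st z y \<Longrightarrow> better J st x z"
  unfolding better_def by auto

lemma better_asym: "better J st x y \<Longrightarrow> \<not> better J st y x"
  unfolding better_def by auto

lemma scan_Some: "scan m J st N = Some x \<Longrightarrow> best m J st N x"
proof (induction N arbitrary: x)
  case (Suc N)
  show ?case
  proof (cases "feasible m J st N \<and> (\<forall>y. scan m J st N = Some y \<longrightarrow> better J st N y)")
    case True
    then have x: "x = N" using Suc.prems by simp
    have "better J st N y" if "y < N" "feasible m J st y" for y
    proof (cases "scan m J st N")
      case None
      then show ?thesis using that scan_None by blast
    next
      case (Some z)
      then show ?thesis using True Suc.IH[OF Some] that unfolding best_def by (meson better_trans)
    qed
    then show ?thesis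
      using True x unfolding best_def by (auto simp: less_Suc_eq dest: better_asym)
  next
    case False
    then have "scan m J st N = Some x" using Suc.prems by (auto split: if_splits)
    then show ?thesis using Suc.IH[of x] False unfolding best_def by (auto simp: less_Suc_eq)
  qed
qed simp

lemma best_unique: "best m J st N x \<Longrightarrow> best m J st N y \<Longrightarrow> x = y"
  unfolding best_def by (metis nat_neq_iff)

lemma advance_best:
  assumes "best m J st (m * length J * length J) x"
  shows "advance m J st = assign J x st"
proof -
  obtain y where "scan m J st (m * length J * length J) = Some y"
    using scan_None[of m J st "m * length J * length J"] assms unfolding best_def by (cases "scan m J st (m * length J * length J)") auto
  then show ?thesis using scan_Some best_unique assms unfolding advance_def by fastforce
qed

lemma cand_decode:
  assumes "j < n" "k < n"
  shows "cand_mach n ((i * n + j) * n + k) = i" "cand_job n ((i * n + j) * n + k) = j"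
    "cand_rel n ((i * n + j) * n + k) = k"
  using assms unfolding cand_mach_def cand_job_def cand_rel_def by auto

lemma cand_bounds:
  assumes "x < m * n * n"
  shows "cand_mach n x < m" "cand_job n x < n" "cand_rel n x < n"
  using assms unfolding cand_mach_def cand_job_def cand_rel_def
  by (auto simp: div_mult2_eq[symmetric] less_mult_imp_div_less mult.assoc intro!: mod_less_divisor Nat.gr0I)

lemma cand_less:
  fixes i j k m n :: nat
  assumes "i < m" "j < n" "k < n"
  shows "(i * n + j) * n + k < m * n * n"
proof -
  have a: "a * n + b < c * n" if "a < c" "b < n" for a b c :: nat
  proof -
    have "a * n + b < Suc a * n" using that by simp
    also have "\<dots> \<le> c * n" using that by (intro mult_le_mono1) simp
    finally show ?thesis .
  qed
  show ?thesis using a[OF a[OF assms(1,2)] assms(3)] .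
qed

section \<open>Invariants\<close>

context
  fixes m :: nat and J :: jobs
  assumes J: "valid_jobs J" and m: "1 \<le> m"
begin

lemma rel_nonneg: "j < length J \<Longrightarrow> 0 \<le> rel J j"
  and ptime_pos: "j < length J \<Longrightarrow> 0 < ptime J j"
  using J unfolding valid_jobs_def by auto

lemma work_nonneg: "0 \<le> work J t"
  unfolding work_def using ptime_pos by (intro sum_nonneg) (auto intro: less_imp_le)

lemma work_mono: "t \<le> u \<Longrightarrow> work J t \<le> work J u"
  unfolding work_def using ptime_pos by (intro sum_mono2) (auto intro: less_imp_le)

lemma admits_mono:
  assumes "admits m J i p w" "0 \<le> p'" "p' \<le> p" "0 \<le> w" "w \<le> w'"
  shows "admits m J i p' w'"
proof -
  have "real (length J) * (real i * p')\<^sup>2 \<le> real (length J) * (real i * p)\<^sup>2"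
    using assms by (intro mult_left_mono power_mono) auto
  also have "\<dots> \<le> real m * w\<^sup>2" using assms unfolding admits_def by simp
  also have "\<dots> \<le> real m * w'\<^sup>2" using assms by (intro mult_left_mono power_mono) auto
  finally show ?thesis unfolding admits_def .
qed

lemma admits_iff:
  assumes "0 \<le> p" "0 \<le> w"
  shows "admits m J i p w \<longleftrightarrow> sqrt (real (length J) / real m) * real i * p \<le> w"
proof -
  have "admits m J i p w \<longleftrightarrow> (sqrt (real (length J) / real m) * real i * p)\<^sup>2 \<le> w\<^sup>2"
    using m unfolding admits_def by (simp add: power_mult_distrib field_simps)
  also have "\<dots> \<longleftrightarrow> sqrt (real (length J) / real m) * real i * p \<le> w"
    using assms by (subst power_mono_iff) auto
  finally show ?thesis .
qed

text \<open>The fifth conjunct is the locale assumption \<open>busy\<close> restricted to times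
  before the clock, the sixth is \<open>spt\<close>, and the last one keeps future starts from
  falling before \<open>now\<close>. In the third, \<open>free st i \<le> 0\<close> covers machines
  without jobs.\<close>

definition ok :: "sched \<Rightarrow> bool" where
  "ok st \<longleftrightarrow> assigned st \<subseteq> {..<length J} \<and>
    (\<forall>j\<in>assigned st. mach st j < m \<and> rel J j \<le> begins st j \<and> begins st j \<le> now st \<and>
       begins st j + ptime J j \<le> free st (mach st j) \<and>
       admits m J (mach st j) (ptime J j) (work J (begins st j))) \<and>
    (\<forall>i<m. free st i \<le> 0 \<or> (\<exists>j\<in>assigned st. mach st j = i \<and> free st i = begins st j + ptime J j)) \<and>
    (\<forall>i\<in>assigned st. \<forall>j\<in>assigned st. i \<noteq> j \<and> mach st i = mach st j \<longrightarrow>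
       begins st i + ptime J i \<le> begins st j \<or> begins st j + ptime J j \<le> begins st i) \<and>
    (\<forall>t. \<forall>i<m. \<forall>j<length J. rel J j \<le> t \<and> admits m J i (ptime J j) (work J t) \<and>
       (if j \<in> assigned st then t < begins st j else t < now st) \<longrightarrow>
       (\<exists>k\<in>assigned st. mach st k = i \<and> begins st k \<le> t \<and> t < begins st k + ptime J k)) \<and>
    (\<forall>j\<in>assigned st. \<forall>i<length J. rel J i \<le> begins st j \<and> ptime J i < ptime J j \<longrightarrow>
       i \<in> assigned st \<and> begins st i \<le> begins st j) \<and>
    (\<forall>x<m * length J * length J. feasible m J st x \<longrightarrow> now st \<le> cand_time J st x)"

lemma okD1: "ok st \<Longrightarrow> (assigned st \<subseteq> {..<length J})"
  unfolding ok_def by (elim conjE)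

lemma okD2: "ok st \<Longrightarrow> ((\<forall>j\<in>assigned st. mach st j < m \<and> rel J j \<le> begins st j \<and> begins st j \<le> now st \<and>
       begins st j + ptime J j \<le> free st (mach st j) \<and>
       admits m J (mach st j) (ptime J j) (work J (begins st j))))"
  unfolding ok_def by (elim conjE)

lemma okD3: "ok st \<Longrightarrow> ((\<forall>i<m. free st i \<le> 0 \<or> (\<exists>j\<in>assigned st. mach st j = i \<and> free st i = begins st j + ptime J j)))"
  unfolding ok_def by (elim conjE)

lemma okD4: "ok st \<Longrightarrow> ((\<forall>i\<in>assigned st. \<forall>j\<in>assigned st. i \<noteq> j \<and> mach st i = mach st j \<longrightarrow>
       begins st i + ptime J i \<le> begins st j \<or> begins st j + ptime J j \<le> begins st i))"
  unfolding ok_def by (elim conjE)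

lemma okD5: "ok st \<Longrightarrow> ((\<forall>t. \<forall>i<m. \<forall>j<length J. rel J j \<le> t \<and> admits m J i (ptime J j) (work J t) \<and>
       (if j \<in> assigned st then t < begins st j else t < now st) \<longrightarrow>
       (\<exists>k\<in>assigned st. mach st k = i \<and> begins st k \<le> t \<and> t < begins st k + ptime J k)))"
  unfolding ok_def by (elim conjE)

lemma okD6: "ok st \<Longrightarrow> ((\<forall>j\<in>assigned st. \<forall>i<length J. rel J i \<le> begins st j \<and> ptime J i < ptime J j \<longrightarrow>
       i \<in> assigned st \<and> begins st i \<le> begins st j))"
  unfolding ok_def by (elim conjE)

lemma okD7: "ok st \<Longrightarrow> ((\<forall>x<m * length J * length J. feasible m J st x \<longrightarrow> now st \<le> cand_time J st x))"
  unfolding ok_def by (elim conjE)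

lemmas okD = okD1 okD2 okD3 okD4 okD5 okD6 okD7

lemma ok_initial: "ok initial"
proof -
  have "0 \<le> cand_time J initial x" if "x < m * length J * length J" for x
    using rel_nonneg cand_bounds[OF that] unfolding cand_time_def by (simp add: le_max_iff_disj)
  moreover have "\<not> t < 0" if "j < length J" "rel J j \<le> t" for j t
    using rel_nonneg[OF that(1)] that by simp
  ultimately show ?thesis unfolding ok_def by (auto simp: initial_def)
qed

text \<open>Machine 0 has threshold 0, so it admits any job, here with the job's own release as
  third component. Hence the scan cannot fail while a job is unassigned.\<close>

lemma feasible_exists:
  assumes "j < length J" "j \<notin> assigned st"
  shows "\<exists>x<m * length J * length J. feasible m J st x"
proof (intro exI conjI)
  let ?x = "(0 * length J + j) * length J + j"
  show "?x < m * length J * length J" using m assms by (intro cand_less) auto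
  show "feasible m J st ?x"
    unfolding feasible_def cand_decode[OF assms(1,1)] using assms by (simp add: admits_def)
qed

lemma advance_cases:
  assumes "j < length J" "j \<notin> assigned st"
  obtains x where "best m J st (m * length J * length J) x" "advance m J st = assign J x st"
proof -
  obtain x where "scan m J st (m * length J * length J) = Some x"
    using feasible_exists[OF assms] scan_None[of m J st] by (cases "scan m J st (m * length J * length J)") auto
  then show ?thesis using that scan_Some advance_best by blast
qed

lemma ok_assign:
  assumes ok: "ok st" and best: "best m J st (m * length J * length J) x"
  shows "ok (assign J x st)"
proof -
  define n i j k t where "n = length J" and "i = cand_mach n x" and "j = cand_job n x" and "k = cand_rel n x"
    and "t = cand_time J st x"
  note d = n_def i_def j_def k_def t_def
  let ?st = "assign J x st"
  have st: "assigned ?st = insert j (assigned st)" "mach ?st = (mach st)(j := i)"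
    "begins ?st = (begins st)(j := t)" "free ?st = (free st)(i := t + ptime J j)" "now ?st = t"
    unfolding assign_def d by (simp_all add: Let_def)
  have x: "x < m * n * n" "feasible m J st x" using best unfolding best_def n_def by auto
  have bnd: "i < m" "j < n" "k < n" using cand_bounds[OF x(1)] unfolding d by auto
  have j: "j \<notin> assigned st" and adm: "admits m J i (ptime J j) (work J (rel J k))"
    using x(2) unfolding feasible_def d by auto
  have t: "t = max (max (free st i) (rel J j)) (rel J k)" unfolding d cand_time_def by simp
  then have tge: "free st i \<le> t" "rel J j \<le> t" "rel J k \<le> t" by auto
  have pj: "0 < ptime J j" using ptime_pos bnd unfolding n_def by auto
  note A0 = okD1[OF ok, folded n_def]
  note A1 = okD2[OF ok, folded n_def]
  note A2 = okD3[OF ok, folded n_def]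
  note A3 = okD4[OF ok, folded n_def]
  note A4 = okD5[OF ok, folded n_def]
  note A5 = okD6[OF ok, folded n_def]
  note A6 = okD7[OF ok, folded n_def]
  have now_t: "now st \<le> t" using A6 x unfolding t_def by blast
  have old: "\<And>l. l \<in> assigned st \<Longrightarrow> l < n \<and> mach st l < m \<and> rel J l \<le> begins st l \<and> begins st l \<le> now st \<and>
       begins st l + ptime J l \<le> free st (mach st l) \<and> admits m J (mach st l) (ptime J l) (work J (begins st l)) \<and> l \<noteq> j"
    using A0 A1 j by auto
  have other: "t \<le> max (max (free st i') (rel J j')) (rel J k') \<and> \<not> (max (max (free st i') (rel J j')) (rel J k') = t \<and> ptime J j' < ptime J j)"
    if "i' < m" "j' < n" "k' < n" "j' \<notin> assigned st" "admits m J i' (ptime J j') (work J (rel J k'))" for i' j' k'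
  proof -
    let ?y = "(i' * n + j') * n + k'"
    have "feasible m J st ?y"
      unfolding feasible_def n_def[symmetric] cand_decode[OF that(2,3)] using that by simp
    then have "\<not> better J st ?y x" using best cand_less[OF that(1-3)] unfolding best_def n_def by blast
    moreover have "cand_time J st ?y = max (max (free st i') (rel J j')) (rel J k')"
      unfolding cand_time_def n_def[symmetric] cand_decode[OF that(2,3)] ..
    ultimately show ?thesis
      unfolding better_def n_def[symmetric] cand_decode[OF that(2,3)] t_def[symmetric] j_def[symmetric]
      by (auto simp del: max_less_iff_conj)
  qed
  have 1: "\<forall>l\<in>assigned ?st. mach ?st l < m \<and> rel J l \<le> begins ?st l \<and> begins ?st l \<le> now ?st \<and>
       begins ?st l + ptime J l \<le> free ?st (mach ?st l) \<and>
       admits m J (mach ?st l) (ptime J l) (work J (begins ?st l))"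
  proof
    fix l assume "l \<in> assigned ?st"
    then consider "l = j" | "l \<in> assigned st" unfolding st by auto
    then show "mach ?st l < m \<and> rel J l \<le> begins ?st l \<and> begins ?st l \<le> now ?st \<and>
       begins ?st l + ptime J l \<le> free ?st (mach ?st l) \<and>
       admits m J (mach ?st l) (ptime J l) (work J (begins ?st l))"
    proof cases
      case 1
      have "admits m J i (ptime J j) (work J t)"
        using adm pj work_nonneg tge work_mono by (intro admits_mono[OF adm]) auto
      then show ?thesis using 1 bnd tge unfolding st by simp
    next
      case 2
      then show ?thesis using old[OF 2] now_t tge pj unfolding st by auto
    qed
  qed
  have 2: "\<forall>i'<m. free ?st i' \<le> 0 \<or> (\<exists>l\<in>assigned ?st. mach ?st l = i' \<and> free ?st i' = begins ?st l + ptime J l)"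
  proof (intro allI impI)
    fix i' assume i': "i' < m"
    show "free ?st i' \<le> 0 \<or> (\<exists>l\<in>assigned ?st. mach ?st l = i' \<and> free ?st i' = begins ?st l + ptime J l)"
    proof (cases "i' = i")
      case True
      then show ?thesis unfolding st by auto
    next
      case False
      have "free st i' \<le> 0 \<or> (\<exists>l\<in>assigned st. mach st l = i' \<and> free st i' = begins st l + ptime J l)"
        using A2 i' by blast
      then show ?thesis unfolding st using False j by auto
    qed
  qed
  have 3: "\<forall>a\<in>assigned ?st. \<forall>b\<in>assigned ?st. a \<noteq> b \<and> mach ?st a = mach ?st b \<longrightarrow>
       begins ?st a + ptime J a \<le> begins ?st b \<or> begins ?st b + ptime J b \<le> begins ?st a"
  proof -
    have "begins st a + ptime J a \<le> t" if "a \<in> assigned st" "mach st a = i" for a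
      using old[OF that(1)] that tge by auto
    moreover have "\<forall>a\<in>assigned st. \<forall>b\<in>assigned st. a \<noteq> b \<and> mach st a = mach st b \<longrightarrow>
       begins st a + ptime J a \<le> begins st b \<or> begins st b + ptime J b \<le> begins st a"
      by (rule A3)
    ultimately show ?thesis using j unfolding st by auto
  qed
  have 4: "\<exists>l\<in>assigned ?st. mach ?st l = i' \<and> begins ?st l \<le> u \<and> u < begins ?st l + ptime J l"
    if u: "i' < m" "j' < n" "rel J j' \<le> u" "admits m J i' (ptime J j') (work J u)"
      "if j' \<in> assigned ?st then u < begins ?st j' else u < now ?st" for u i' j'
  proof -
    have "\<exists>l\<in>assigned st. mach st l = i' \<and> begins st l \<le> u \<and> u < begins st l + ptime J l"
    proof (cases "if j' \<in> assigned st then u < begins st j' else u < now st")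
      case True
      then show ?thesis using A4 u by blast
    next
      case False
      then have j': "j' \<notin> assigned st" "now st \<le> u" "u < t"
        using u(5) j unfolding st by (auto split: if_splits)
      define R where "R = {l. l < n \<and> rel J l \<le> u}"
      have R: "finite R" "R \<noteq> {}" using u unfolding R_def by auto
      \<comment> \<open>The latest release up to \<open>u\<close>: the work is the same at both
        times, so the triple (i', j', k') is feasible, and a machine i' free at \<open>u\<close>
        would allow a start before \<open>t\<close>.\<close>
      define k' where "k' = arg_min_on (\<lambda>l. - rel J l) R"
      have k': "k' \<in> R" "\<And>l. l \<in> R \<Longrightarrow> rel J l \<le> rel J k'"
        using arg_min_if_finite(1)[OF R, of "\<lambda>l. - rel J l"] arg_min_least[OF R, of _ "\<lambda>l. - rel J l"]
        unfolding k'_def by auto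
      have "{l. l < n \<and> rel J l \<le> rel J k'} = {l. l < n \<and> rel J l \<le> u}"
        using k' unfolding R_def by force
      then have "work J (rel J k') = work J u" unfolding work_def n_def by simp
      then have "t \<le> max (max (free st i') (rel J j')) (rel J k')"
        using other[of i' j' k'] u j' k' unfolding R_def by auto
      then have fr: "u < free st i'" using u j' k' unfolding R_def by auto
      \<comment> \<open>This rules out the initial value 0 of \<open>free\<close>; what remains is
        the end of a job on i' that began by \<open>now st\<close> and hence is running at
        \<open>u\<close>.\<close>
      moreover have "0 \<le> u" using rel_nonneg[of j'] u unfolding n_def by auto
      ultimately obtain l where l: "l \<in> assigned st" "mach st l = i'" "free st i' = begins st l + ptime J l"
        using A2 u(1) by force
      then show ?thesis using old[OF l(1)] fr j' by force
    qed
    then show ?thesis using j unfolding st by auto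
  qed
  have 5: "\<forall>l\<in>assigned ?st. \<forall>i'<n. rel J i' \<le> begins ?st l \<and> ptime J i' < ptime J l \<longrightarrow>
       i' \<in> assigned ?st \<and> begins ?st i' \<le> begins ?st l"
  proof (intro ballI allI impI)
    fix l i' assume l: "l \<in> assigned ?st" and i': "i' < n" "rel J i' \<le> begins ?st l \<and> ptime J i' < ptime J l"
    show "i' \<in> assigned ?st \<and> begins ?st i' \<le> begins ?st l"
    proof (cases "l = j")
      case False
      then have "i' \<in> assigned st \<and> begins st i' \<le> begins st l"
        using l i' A5 unfolding st by auto
      then show ?thesis using False j unfolding st by auto
    next
      case True
      then have i'2: "rel J i' \<le> t" "ptime J i' < ptime J j" using i' unfolding st by auto
      have "i' \<in> assigned st"
      proof (rule ccontr)
        assume na: "i' \<notin> assigned st"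
        have "admits m J i (ptime J i') (work J (rel J k))"
          using i' ptime_pos[of i'] i'2 work_nonneg unfolding n_def by (intro admits_mono[OF adm]) auto
        note other[OF bnd(1) i'(1) bnd(3) na this]
        moreover have "max (max (free st i) (rel J i')) (rel J k) \<le> t" using i'2 tge by simp
        ultimately show False using i'2 by (meson order_antisym)
      qed
      then show ?thesis using old[of i'] now_t True unfolding st by auto
    qed
  qed
  have 6: "\<forall>y<m * n * n. feasible m J ?st y \<longrightarrow> now ?st \<le> cand_time J ?st y"
  proof (intro allI impI)
    fix y assume y: "y < m * n * n" "feasible m J ?st y"
    then have "feasible m J st y" unfolding feasible_def st by auto
    then have "\<not> better J st y x" using y best unfolding best_def n_def by blast
    then have "t \<le> cand_time J st y" unfolding better_def t_def by auto
    also have "\<dots> \<le> cand_time J ?st y"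
      unfolding cand_time_def st using tge pj by (auto simp: le_max_iff_disj)
    finally show "now ?st \<le> cand_time J ?st y" unfolding st .
  qed
  have 0: "assigned ?st \<subseteq> {..<n}" using A0 bnd unfolding st by auto
  show ?thesis unfolding ok_def n_def[symmetric] by (intro conjI 0 1 2 3 5 6) (use 4 in blast)
qed

lemma after_invariant:
  assumes "q \<le> length J"
  shows "ok (after m J q) \<and> card (assigned (after m J q)) = q"
  using assms
proof (induction q)
  case 0
  then show ?case using ok_initial by (simp add: after_def initial_def)
next
  case (Suc q)
  then have IH: "ok (after m J q)" "card (assigned (after m J q)) = q" by auto
  have sub: "assigned (after m J q) \<subseteq> {..<length J}" using okD1[OF IH(1)] .
  then have "assigned (after m J q) \<noteq> {..<length J}" using IH Suc.prems by auto
  then obtain j where j: "j < length J" "j \<notin> assigned (after m J q)" using sub by blast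
  obtain x where x: "best m J (after m J q) (m * length J * length J) x"
    "advance m J (after m J q) = assign J x (after m J q)" using advance_cases[OF j] .
  have "cand_job (length J) x \<notin> assigned (after m J q)"
    using x unfolding best_def feasible_def by blast
  moreover have "finite (assigned (after m J q))" using sub finite_subset by blast
  ultimately have "card (assigned (assign J x (after m J q))) = Suc q"
    using IH by (simp add: assign_def Let_def)
  then show ?case using ok_assign[OF IH(1) x(1)] x(2) by (simp add: after_Suc)
qed

lemma after_assigned: "assigned (after m J (length J)) = {..<length J}"
proof (rule card_subset_eq)
  have inv: "ok (after m J (length J))" "card (assigned (after m J (length J))) = length J"
    using after_invariant[of "length J"] by simp_all
  then show "assigned (after m J (length J)) \<subseteq> {..<length J}" using okD1 by blast
  show "card (assigned (after m J (length J))) = card {..<length J}" using inv(2) by simp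
qed simp

lemma greedy_start_machine:
  assumes "length J > m" "j < length J"
  shows "start (greedy m J) j = begins (after m J (length J)) j"
    "machine (greedy m J) j = mach (after m J (length J)) j"
  using assms unfolding greedy_def start_def machine_def by auto

lemma greedy_idle:
  assumes "length J \<le> m" "j < length J"
  shows "start (greedy m J) j = rel J j" "machine (greedy m J) j = j"
  using assms unfolding greedy_def start_def machine_def by auto

lemma greedy_nonpreemptive: "nonpreemptive_schedule m J (greedy m J)"
proof (cases "length J \<le> m")
  case True
  then show ?thesis
    unfolding nonpreemptive_schedule_def using greedy_idle[OF True] by (auto simp: greedy_def)
next
  case False
  then have F: "length J > m" by simp
  have "ok (after m J (length J))" using after_invariant[of "length J"] by simp
  note A = okD[OF this, unfolded after_assigned]
  show ?thesis
    unfolding nonpreemptive_schedule_def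
  proof (intro conjI allI impI)
    show "length (greedy m J) = length J" by (simp add: greedy_def)
  next
    fix j assume j: "j < length J"
    then show "machine (greedy m J) j < m" "rel J j \<le> start (greedy m J) j"
      using A(2) unfolding greedy_start_machine[OF F j] by auto
  next
    fix i j assume ij: "i < length J" "j < length J" "i \<noteq> j \<and> machine (greedy m J) i = machine (greedy m J) j"
    then show "start (greedy m J) i + ptime J i \<le> start (greedy m J) j \<or>
      start (greedy m J) j + ptime J j \<le> start (greedy m J) i"
      using A(4) unfolding greedy_start_machine[OF F ij(1)] greedy_start_machine[OF F ij(2)] by auto
  qed
qed

lemma greedy_flow_le:
  assumes mn: "m < length J" and Q: "preemptive_schedule m J \<sigma> Q"
  defines "g \<equiv> sqrt (real (length J) / real m)"
  shows "flow J (greedy m J) \<le> (6 * (1 + real (length J) / (real m)\<^sup>2 + g * (1 + ln (length J)))) * preemptive_flow J Q"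
proof -
  define n st where "n = length J" and "st = after m J n"
  have "0 < real (length J)" "0 < real m" using mn m by auto
  then have g: "0 < g" unfolding g_def by simp
  have "ok st" using after_invariant[of "length J"] unfolding st_def n_def by simp
  note A = okD[OF this, unfolded st_def n_def after_assigned, folded n_def, folded st_def]
  have adm: "admits m J i (ptime J j) (work J t) \<longleftrightarrow> g * real i * ptime J j \<le> work J t" if "j < n" for i j t
    using that ptime_pos work_nonneg unfolding g_def n_def by (intro admits_iff) (auto intro: less_imp_le)
  interpret greedy_vs_reference n m "rel J" "ptime J" "begins st" "mach st" g "completion Q"
  proof
    show "1 \<le> m" "1 \<le> n" "0 < g" using m mn g unfolding n_def by auto
  next
    fix j assume j: "j < n"
    show "0 < ptime J j" using ptime_pos j unfolding n_def by simp
    have "mach st j < m \<and> rel J j \<le> begins st j \<and> admits m J (mach st j) (ptime J j) (work J (begins st j))"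
      using A(2) j by auto
    then have "rel J j \<le> begins st j" "mach st j < m" "g * real (mach st j) * ptime J j \<le> work J (begins st j)"
      unfolding adm[OF j] by auto
    then show "rel J j \<le> begins st j" "mach st j < m"
      "g * real (mach st j) * ptime J j \<le> (\<Sum>l | l < n \<and> rel J l \<le> begins st j. ptime J l)"
      unfolding work_def n_def by auto
    show "rel J j + ptime J j \<le> completion Q j"
      using completion_ge[OF Q J] j unfolding n_def by blast
  next
    fix i j assume ij: "i < n" "j < n"
    show "i \<noteq> j \<Longrightarrow> mach st i = mach st j \<Longrightarrow> begins st i + ptime J i \<le> begins st j \<or> begins st j + ptime J j \<le> begins st i"
      using A(4) ij by auto
    show "rel J i \<le> begins st j \<Longrightarrow> ptime J i < ptime J j \<Longrightarrow> begins st i \<le> begins st j"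
      using A(6) ij by auto
  next
    fix i j t assume *: "i < m" "j < n" "rel J j \<le> t" "t < begins st j"
      "g * real i * ptime J j \<le> (\<Sum>l | l < n \<and> rel J l \<le> t. ptime J l)"
    have "g * real i * ptime J j \<le> work J t" using *(5) unfolding work_def n_def .
    then have "admits m J i (ptime J j) (work J t)" unfolding adm[OF *(2)] .
    then show "\<exists>k<n. mach st k = i \<and> begins st k \<le> t \<and> t < begins st k + ptime J k"
      using A(5)[rule_format, of i j t] * by auto
  next
    fix X u v assume "X \<subseteq> {..<n}"
    then show "(\<Sum>j | j \<in> X \<and> completion Q j \<le> u. ptime J j)
      \<le> (\<Sum>j | j \<in> X \<and> rel J j \<le> v. ptime J j) + real m * max 0 (u - v)"
      using preemptive_volume[OF Q J] unfolding n_def by blast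
  qed
  have ln0: "0 \<le> ln (real n)" using n by simp
  have mln: "ln (real m) \<le> ln (real n)" using m mn unfolding n_def by (subst ln_le_cancel_iff) auto
  have H: "H \<le> 1 + ln n" using sum_inverse_le_ln[OF m] mln unfolding H_def by linarith
  \<comment> \<open>The balance that dictates g = sqrt (n / m): the factor of the blocking term
    equals the factor of the counting term.\<close>
  have gg: "n / (g * m) = g"
  proof -
    have "g * g = n / m" unfolding g_def n_def by simp
    then show ?thesis using g m by (simp add: field_simps)
  qed
  have "n * (H + 1) / (g * m) = n / (g * m) * (H + 1)" by simp
  also have "\<dots> = g * (H + 1)" unfolding gg ..
  also have "\<dots> \<le> g * (2 + ln n)" using H g by (intro mult_left_mono) auto
  finally have 1: "n * (H + 1) / (g * m) \<le> g * (2 + ln n)" .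
  have 2: "g * (2 + ln n) \<le> 2 * (g * (1 + ln n))" using g ln0 by (simp add: algebra_simps)
  have 3: "0 \<le> g * (1 + ln n)" using g ln0 by simp
  have 4: "0 \<le> real n / (real m)\<^sup>2" by simp
  have pf: "0 \<le> preemptive_flow J Q"
    unfolding preemptive_flow_def
  proof (rule sum_nonneg)
    fix j assume "j \<in> {..<length J}"
    then show "0 \<le> completion Q j - rel J j" using C[of j] p_pos[of j] unfolding n_def by auto
  qed
  have "flow J (greedy m J) = (\<Sum>j<n. begins st j + ptime J j - rel J j)"
    unfolding flow_def n_def st_def using greedy_start_machine[OF mn] by (intro sum.cong) auto
  also have "\<dots> \<le> (3 + n / m\<^sup>2 + n * (H + 1) / (g * m) + g * (2 + ln n)) * preemptive_flow J Q"
    using total_flow_le unfolding preemptive_flow_def n_def .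
  also have "\<dots> \<le> (6 * (1 + real n / (real m)\<^sup>2 + g * (1 + ln n))) * preemptive_flow J Q"
  proof (rule mult_right_mono[OF _ pf])
    have "3 + x + a + b \<le> 6 * (1 + x + c)" if "a \<le> b" "b \<le> 2 * c" "0 \<le> c" "0 \<le> x" for a b c x :: real
      using that by argo
    from this[OF 1 2 3 4] show "3 + n / m\<^sup>2 + n * (H + 1) / (g * m) + g * (2 + ln n) \<le> 6 * (1 + real n / (real m)\<^sup>2 + g * (1 + ln n))"
      by simp
  qed
  finally show ?thesis unfolding n_def .
qed

end

section \<open>Online property\<close>

lemma same_until_sym: "same_until t J J' \<Longrightarrow> same_until t J' J"
  unfolding same_until_def by metis

lemma same_until_job:
  assumes "same_until t J J'" "j < length J" "rel J j \<le> t"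
  shows "rel J' j = rel J j" "ptime J' j = ptime J j"
  using assms unfolding same_until_def rel_def ptime_def by metis+

lemma same_until_work:
  assumes "same_until t J J'" "u \<le> t"
  shows "work J' u = work J u"
proof -
  have "l < length J' \<and> rel J' l \<le> u \<longleftrightarrow> l < length J \<and> rel J l \<le> u" for l
  proof -
    have len: "length J' = length J" using assms(1) unfolding same_until_def by simp
    show ?thesis
    proof
      assume l: "l < length J' \<and> rel J' l \<le> u"
      then have "rel J l = rel J' l"
        using same_until_job(1)[OF same_until_sym[OF assms(1)], of l] assms(2) by linarith
      then show "l < length J \<and> rel J l \<le> u" using l len by simp
    next
      assume l: "l < length J \<and> rel J l \<le> u"
      then have "rel J' l = rel J l"
        using same_until_job(1)[OF assms(1), of l] assms(2) by linarith
      then show "l < length J' \<and> rel J' l \<le> u" using l len by simp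
    qed
  qed
  then show ?thesis
    unfolding work_def using same_until_job[OF assms(1)] assms(2) by (intro sum.cong) auto
qed

text \<open>A candidate time is at least both releases it refers to. If it is at most
  \<open>t\<close>, everything that enters it is already visible at \<open>t\<close>.\<close>

lemma same_until_cand:
  assumes s: "same_until t J J'" and x: "x < m * length J * length J" and t: "cand_time J st x \<le> t"
  shows "cand_time J' st x = cand_time J st x" "feasible m J' st x \<longleftrightarrow> feasible m J st x"
    "ptime J' (cand_job (length J) x) = ptime J (cand_job (length J) x)"
proof -
  have len: "length J' = length J" using s unfolding same_until_def by simp
  note b = cand_bounds[OF x]
  have r: "rel J (cand_job (length J) x) \<le> t" "rel J (cand_rel (length J) x) \<le> t"
    using t unfolding cand_time_def by auto
  note j = same_until_job[OF s b(2) r(1)] and k = same_until_job[OF s b(3) r(2)]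
  show "cand_time J' st x = cand_time J st x" "feasible m J' st x \<longleftrightarrow> feasible m J st x"
    "ptime J' (cand_job (length J) x) = ptime J (cand_job (length J) x)"
    unfolding cand_time_def feasible_def len j k admits_def same_until_work[OF s r(2)] by simp_all
qed

text \<open>Candidates later than \<open>t\<close> may differ between the instances, but in both of
  them they lose against \<open>x\<close>.\<close>

lemma same_until_best:
  assumes s: "same_until t J J'" and x: "best m J st (m * length J * length J) x" and t: "cand_time J st x \<le> t"
  shows "best m J' st (m * length J' * length J') x"
proof -
  have len: "length J' = length J" using s unfolding same_until_def by simp
  have xN: "x < m * length J * length J" using x unfolding best_def by simp
  note sx = same_until_cand[OF s xN t]
  have "\<not> better J' st y x \<and> (y < x \<longrightarrow> better J' st x y)"
    if y: "y < m * length J * length J" "feasible m J' st y" for y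
  proof (cases "cand_time J' st y \<le> t")
    case True
    note sy = same_until_cand[OF same_until_sym[OF s], unfolded len, OF y(1) True]
    have "feasible m J st y" using sy(2) y by simp
    then have "\<not> better J st y x \<and> (y < x \<longrightarrow> better J st x y)" using x y unfolding best_def by blast
    then show ?thesis using sx sy unfolding better_def len by simp
  next
    case False
    then show ?thesis using sx t unfolding better_def by simp
  qed
  then show ?thesis using x sx(2) unfolding best_def len by blast
qed

text \<open>The runs stay in the same state until a round in which both clocks pass
  \<open>t\<close>. After that, starts up to \<open>t\<close> are frozen: new starts lie beyond
  \<open>t\<close> and concern jobs that were unassigned.\<close>

lemma same_until_after:
  assumes s: "same_until t J J'" and J: "valid_jobs J" "valid_jobs J'" and m: "1 \<le> m" and q: "q \<le> length J"
  shows "after m J q = after m J' q \<or>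
    t < now (after m J q) \<and> t < now (after m J' q) \<and>
    (\<forall>j\<in>assigned (after m J q). begins (after m J q) j \<le> t \<longrightarrow>
       j \<in> assigned (after m J' q) \<and> mach (after m J' q) j = mach (after m J q) j \<and>
       begins (after m J' q) j = begins (after m J q) j)"
  using q
proof (induction q)
  case 0
  then show ?case by (simp add: after_def)
next
  case (Suc q)
  have len: "length J' = length J" using s unfolding same_until_def by simp
  have step: "\<exists>x. best m L (after m L q) (m * length L * length L) x \<and> after m L (Suc q) = assign L x (after m L q) \<and>
      now (after m L q) \<le> cand_time L (after m L q) x \<and> cand_job (length L) x \<notin> assigned (after m L q)"
    if L: "valid_jobs L" "length L = length J" for L
  proof -
    have inv: "ok m L (after m L q)" "card (assigned (after m L q)) = q"
      using after_invariant[OF L(1) m, of q] Suc.prems L(2) by simp_all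
    have "assigned (after m L q) \<subseteq> {..<length L}" using okD1[OF L(1) m inv(1)] .
    moreover have "assigned (after m L q) \<noteq> {..<length L}"
    proof
      assume "assigned (after m L q) = {..<length L}"
      then show False using inv(2) Suc.prems L(2) by simp
    qed
    ultimately obtain j where "j < length L" "j \<notin> assigned (after m L q)" by blast
    then obtain x where x: "best m L (after m L q) (m * length L * length L) x"
      "advance m L (after m L q) = assign L x (after m L q)" using advance_cases[OF L(1) m] by blast
    moreover have "now (after m L q) \<le> cand_time L (after m L q) x"
      using okD7[OF L(1) m inv(1)] x(1) unfolding best_def by blast
    moreover have "cand_job (length L) x \<notin> assigned (after m L q)"
      using x(1) unfolding best_def feasible_def by blast
    ultimately show ?thesis unfolding after_Suc by blast
  qed
  obtain x where x: "best m J (after m J q) (m * length J * length J) x" "after m J (Suc q) = assign J x (after m J q)"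
    "now (after m J q) \<le> cand_time J (after m J q) x" "cand_job (length J) x \<notin> assigned (after m J q)"
    using step[OF J(1)] by blast
  obtain x' where x': "best m J' (after m J' q) (m * length J' * length J') x'" "after m J' (Suc q) = assign J' x' (after m J' q)"
    "now (after m J' q) \<le> cand_time J' (after m J' q) x'" "cand_job (length J') x' \<notin> assigned (after m J' q)"
    using step[OF J(2) len] by blast
  have late: ?case if t: "t < cand_time J (after m J q) x" "t < cand_time J' (after m J' q) x'"
    and old: "\<forall>j\<in>assigned (after m J q). begins (after m J q) j \<le> t \<longrightarrow>
       j \<in> assigned (after m J' q) \<and> mach (after m J' q) j = mach (after m J q) j \<and>
       begins (after m J' q) j = begins (after m J q) j"
    using t old x(4) x'(4) unfolding x(2) x'(2) assign_def by (auto simp: Let_def)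
  from Suc.IH Suc.prems consider "after m J q = after m J' q" |
    "t < now (after m J q) \<and> t < now (after m J' q) \<and>
    (\<forall>j\<in>assigned (after m J q). begins (after m J q) j \<le> t \<longrightarrow>
       j \<in> assigned (after m J' q) \<and> mach (after m J' q) j = mach (after m J q) j \<and>
       begins (after m J' q) j = begins (after m J q) j)" by fastforce
  then show ?case
  proof cases
    case 1
    \<comment> \<open>From equal states, a choice with time at most \<open>t\<close> in one run is
      forced on the other run as well; otherwise both clocks pass \<open>t\<close> in this
      round.\<close>
    consider "cand_time J (after m J q) x \<le> t" | "cand_time J' (after m J' q) x' \<le> t" |
      "t < cand_time J (after m J q) x" "t < cand_time J' (after m J' q) x'" by linarith
    then show ?thesis
    proof cases
      case a: 1
      have "best m J' (after m J' q) (m * length J' * length J') x"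
        using same_until_best[OF s x(1) a] 1 by simp
      then have "x' = x" using x'(1) best_unique by blast
      moreover have "x < m * length J * length J" using x(1) unfolding best_def by simp
      ultimately have "assign J' x' (after m J' q) = assign J x (after m J q)"
        using same_until_cand[OF s _ a] 1 unfolding assign_def len by simp
      then show ?thesis unfolding x x' by simp
    next
      case a: 2
      have "best m J (after m J q) (m * length J * length J) x'"
        using same_until_best[OF same_until_sym[OF s] x'(1) a] 1 by simp
      then have "x' = x" using x(1) best_unique by blast
      moreover have "x' < m * length J' * length J'" using x'(1) unfolding best_def by simp
      ultimately have "assign J' x' (after m J' q) = assign J x (after m J q)"
        using same_until_cand[OF same_until_sym[OF s] _ a] 1 len unfolding assign_def by simp
      then show ?thesis unfolding x x' by simp
    next
      case 3
      then show ?thesis using 1 by (intro late) auto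
    qed
  next
    case 2
    then show ?thesis using x(3) x'(3) by (intro late) auto
  qed
qed

lemma greedy_online: "online_nonpreemptive greedy"
  unfolding online_nonpreemptive_def
proof (intro conjI allI impI)
  fix m :: nat and J assume "1 \<le> m" "valid_jobs J"
  then show "nonpreemptive_schedule m J (greedy m J)" using greedy_nonpreemptive by blast
next
  fix m :: nat and J J' t j
  assume m: "1 \<le> m" and J: "valid_jobs J \<and> valid_jobs J' \<and> same_until t J J'"
    and j: "j < length J" and st: "start (greedy m J) j \<le> t"
  have len: "length J' = length J" using J unfolding same_until_def by simp
  show "greedy m J' ! j = greedy m J ! j"
  proof (cases "length J \<le> m")
    case True
    then have "rel J j \<le> t" using st greedy_idle[OF _ m True j] J by simp
    then show ?thesis using same_until_job[of t J J' j] J j True len unfolding greedy_def by simp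
  next
    case False
    let ?n = "length J"
    have n: "begins (after m J ?n) j \<le> t" using st greedy_start_machine[of J m j] J m False j by simp
    have "j \<in> assigned (after m J ?n)" using after_assigned[of J m] J m j by simp
    then have "mach (after m J' ?n) j = mach (after m J ?n) j \<and> begins (after m J' ?n) j = begins (after m J ?n) j"
      using same_until_after[of t J J' m ?n] J m n by fastforce
    then show ?thesis using False j len unfolding greedy_def by simp
  qed
qed

section \<open>Competitive ratio\<close>

definition ratio :: "nat \<Rightarrow> nat \<Rightarrow> real" where
  "ratio n m = (if n \<le> m then 1
     else 6 * (1 + real n / (real m)\<^sup>2 + sqrt (real n / real m) * (1 + ln n)))"

lemma greedy_competitive:
  assumes "1 \<le> n" "1 \<le> m"
  shows "competitive greedy n m (ratio n m)"
  unfolding competitive_def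
proof (intro allI impI)
  fix J assume J: "length J = n \<and> valid_jobs J"
  then have v: "valid_jobs J" by simp
  note np = greedy_nonpreemptive[OF v assms(2)]
  show "flow J (greedy m J) \<le> ratio n m * OPT m J"
  proof (rule le_OPT[OF np v])
    have "0 \<le> sqrt (real n / real m) * (1 + ln n)" using assms by simp
    then show "0 < ratio n m" unfolding ratio_def by (simp add: add_pos_nonneg)
    fix \<sigma> Q assume Q: "preemptive_schedule m J \<sigma> Q"
    show "flow J (greedy m J) \<le> ratio n m * preemptive_flow J Q"
    proof (cases "n \<le> m")
      case True
      \<comment> \<open>Each job starts at its release, and no schedule completes it before release
        plus size.\<close>
      have "flow J (greedy m J) \<le> preemptive_flow J Q"
        unfolding flow_def preemptive_flow_def
      proof (rule sum_mono)
        fix j assume "j \<in> {..<length J}"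
        then show "start (greedy m J) j + ptime J j - rel J j \<le> completion Q j - rel J j"
          using completion_ge[OF Q v, of j] greedy_idle[OF v assms(2), of j] J True by auto
      qed
      then show ?thesis using True unfolding ratio_def by simp
    next
      case False
      then show ?thesis using greedy_flow_le[OF v assms(2) _ Q] J unfolding ratio_def by simp
    qed
  qed
qed

lemma ratio_bigo:
  "(\<lambda>(n, m). ratio n m) \<in> O[principal {(n, m). 1 \<le> n \<and> 1 \<le> m}](
     \<lambda>(n, m). max 1 (real n / (real m)\<^sup>2 + sqrt (real n / real m) * log 2 (real m)))"
\<comment> \<open>96 = 6 * 16, the factor in \<open>ratio\<close> times the constant of
  \<open>sqrt_ln_le\<close>.\<close>
proof (rule bigoI[where c = 96])
  have "norm (ratio n m) \<le> 96 * norm (max 1 (real n / (real m)\<^sup>2 + sqrt (real n / real m) * log 2 (real m)))"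
    if nm: "1 \<le> n" "1 \<le> m" for n m
  proof (cases "n \<le> m")
    case True
    then show ?thesis unfolding ratio_def by (simp add: max_def)
  next
    case False
    have "0 \<le> sqrt (real n / real m) * (1 + ln n)" using nm by simp
    then have "norm (ratio n m) = 6 * (1 + real n / (real m)\<^sup>2 + sqrt (real n / real m) * (1 + ln n))"
      using False unfolding ratio_def by simp
    also have "\<dots> \<le> 6 * (16 * (real n / (real m)\<^sup>2 + sqrt (real n / real m) * log 2 m))"
      using sqrt_ln_le[of m n] nm False by (intro mult_left_mono) auto
    also have "\<dots> \<le> 96 * norm (max 1 (real n / (real m)\<^sup>2 + sqrt (real n / real m) * log 2 (real m)))"
    proof -
      have "6 * (16 * y) \<le> 96 * norm (max 1 y)" for y :: real by (simp add: max_def)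
      then show ?thesis .
    qed
    finally show ?thesis .
  qed
  then show "\<forall>\<^sub>F x in principal {(n, m). 1 \<le> n \<and> 1 \<le> m}.
      norm (case x of (n, m) \<Rightarrow> ratio n m) \<le> 96 * norm (case x of (n, m) \<Rightarrow>
        max 1 (real n / (real m)\<^sup>2 + sqrt (real n / real m) * log 2 (real m)))"
    by (auto simp: eventually_principal)
qed

section \<open>Cost of expressions and time-bounded Hoare triples\<close>

text \<open>An exponent: if cells are bounded by 2^B, values are bounded by 2^(B * esize). The 1
  added for a cell access is not due to its value; it makes 2 * esize - 1 a bound on the number of
  nodes, as \<open>cost_bound\<close> needs.\<close>

fun esize :: "expr \<Rightarrow> nat" where
  "esize (Num k) = 1"
| "esize (Cell e) = esize e + 1"
| "esize (Plus e f) = esize e + esize f"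
| "esize (Minus e f) = esize e + esize f"
| "esize (Times e f) = esize e + esize f"
| "esize (Quot e f) = esize e + esize f"

fun small_consts :: "expr \<Rightarrow> bool" where
  "small_consts (Num k) \<longleftrightarrow> \<bar>k\<bar> \<le> 32"
| "small_consts (Cell e) \<longleftrightarrow> small_consts e"
| "small_consts (Plus e f) \<longleftrightarrow> small_consts e \<and> small_consts f"
| "small_consts (Minus e f) \<longleftrightarrow> small_consts e \<and> small_consts f"
| "small_consts (Times e f) \<longleftrightarrow> small_consts e \<and> small_consts f"
| "small_consts (Quot e f) \<longleftrightarrow> small_consts e \<and> small_consts f"

definition simple :: "expr \<Rightarrow> bool" where
  "simple e \<longleftrightarrow> esize e \<le> 100 \<and> small_consts e"

text \<open>5 \<le> B makes 2^B cover the constants up to 32 as well. Only contents are bounded; an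
  address is charged through the expression that computes it.\<close>

definition bounded_mem :: "nat \<Rightarrow> mem \<Rightarrow> bool" where
  "bounded_mem B M \<longleftrightarrow> 5 \<le> B \<and> (\<forall>a. \<bar>M a\<bar> \<le> 2 ^ B)"

lemma esize_pos: "0 < esize e"
  by (induction e) auto

lemma abs_div_le: "\<bar>a div b\<bar> \<le> \<bar>a\<bar>" for a b :: int
proof (cases "b = 0")
  case False
  show ?thesis
  proof (cases "a = 0")
    case a: False
    consider "0 < a" "0 < b" | "a < 0" "0 < b" | "0 < a" "b < 0" | "a < 0" "b < 0" using a False by linarith
    then show ?thesis
    proof cases
      case 1
      then show ?thesis using pos_imp_zdiv_nonneg_iff[of b a] zdiv_mono2[of a 1 b] by simp
    next
      case 2
      have "a \<le> a div b" using 2 zdiv_mono2_neg[of a 1 b] by simp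
      moreover have "a div b < 0" using 2 by (simp add: div_neg_pos_less0)
      ultimately show ?thesis using 2 by linarith
    next
      case 3
      have "a div b = (- a) div (- b)" by simp
      moreover have "- a \<le> (- a) div (- b)"
        using 3 zdiv_mono2_neg[of "- a" 1 "- b"] by simp
      moreover have "(- a) div (- b) < 0" using 3 by (intro div_neg_pos_less0) auto
      ultimately show ?thesis using 3 by linarith
    next
      case 4
      have "a div b = (- a) div (- b)" by simp
      moreover have "(- a) div (- b) \<le> - a" using 4 zdiv_mono2[of "- a" 1 "- b"] by simp
      moreover have "0 \<le> (- a) div (- b)" using 4 by (simp only: pos_imp_zdiv_nonneg_iff)
      ultimately show ?thesis using 4 by linarith
    qed
  qed simp
qed simp

lemma val_bound:
  assumes "bounded_mem B M" "small_consts e"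
  shows "\<bar>val e M\<bar> \<le> 2 ^ (B * esize e)"
  using assms(2)
proof (induction e)
  have B: "5 \<le> B" using assms unfolding bounded_mem_def by simp
  have two: "2 \<le> (2 :: int) ^ (B * esize e)" for e
    using B esize_pos[of e] power_increasing[of 1 "B * esize e" "2 :: int"] by simp
  \<comment> \<open>Lets sums and differences obey the same exponent law as products.\<close>
  have sum: "a + b \<le> a * b" if "2 \<le> a" "2 \<le> b" for a b :: int
    using mult_mono[of 1 "a - 1" 1 "b - 1"] that by (simp add: algebra_simps)
  {
    case (Num k)
    have "(32 :: int) = 2 ^ 5" by simp
    also have "\<dots> \<le> 2 ^ B" using B by (intro power_increasing) auto
    finally show ?case using Num by simp
  next
    case (Cell e)
    have "\<bar>M (val e M)\<bar> \<le> 2 ^ B" using assms unfolding bounded_mem_def by simp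
    also have "\<dots> \<le> 2 ^ (B * (esize e + 1))" by (intro power_increasing) auto
    finally show ?case by simp
  next
    case (Plus e f)
    then have "\<bar>val e M + val f M\<bar> \<le> 2 ^ (B * esize e) + 2 ^ (B * esize f)" by simp
    also have "\<dots> \<le> 2 ^ (B * esize e) * 2 ^ (B * esize f)" by (intro sum two)
    finally show ?case by (simp add: power_add distrib_left)
  next
    case (Minus e f)
    then have "\<bar>val e M - val f M\<bar> \<le> 2 ^ (B * esize e) + 2 ^ (B * esize f)" by simp
    also have "\<dots> \<le> 2 ^ (B * esize e) * 2 ^ (B * esize f)" by (intro sum two)
    finally show ?case by (simp add: power_add distrib_left)
  next
    case (Times e f)
    then have "\<bar>val e M * val f M\<bar> \<le> 2 ^ (B * esize e) * 2 ^ (B * esize f)"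
      by (simp add: abs_mult mult_mono)
    then show ?case by (simp add: power_add distrib_left)
  next
    case (Quot e f)
    have "\<bar>val e M div val f M\<bar> \<le> \<bar>val e M\<bar>" by (rule abs_div_le)
    also have "\<dots> \<le> 2 ^ (B * esize e)" using Quot by simp
    also have "\<dots> \<le> 2 ^ (B * esize (Quot e f))" by (intro power_increasing) auto
    finally show ?case by simp
  }
qed

lemma bits_le:
  assumes "\<bar>k\<bar> \<le> 2 ^ b"
  shows "bits k \<le> b + 2"
proof -
  have "(2 :: int) ^ b < 2 ^ (b + 1)" by simp
  then have "\<bar>k\<bar> < 2 ^ (b + 1)" using assms by (rule le_less_trans[rotated])
  then have "nat \<bar>k\<bar> < 2 ^ (b + 1)" by (simp only: nat_less_iff abs_ge_zero) simp
  then have "floorlog 2 (nat \<bar>k\<bar>) \<le> b + 1" by (intro floorlog_leI) auto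
  then show ?thesis unfolding bits_def by simp
qed

lemma cost_bound:
  assumes "bounded_mem B M" "small_consts e" "esize e \<le> s"
  shows "cost e M \<le> (2 * esize e - 1) * (B * s + 2)"
  using assms(2,3)
proof (induction e)
  have bv: "bits (val e M) \<le> B * s + 2" if "small_consts e" "esize e \<le> s" for e
  proof -
    have "\<bar>val e M\<bar> \<le> 2 ^ (B * esize e)" using val_bound assms that by blast
    also have "\<dots> \<le> 2 ^ (B * s)" using that by (intro power_increasing) auto
    finally show ?thesis by (rule bits_le)
  qed
  have bin: "c + d + b \<le> (2 * (k + l) - 1) * u"
    if "c \<le> (2 * k - 1) * u" "d \<le> (2 * l - 1) * u" "b \<le> u" "0 < k" "0 < l" for c d b k l u :: nat
  proof -
    have "c + d + b \<le> (2 * k - 1) * u + (2 * l - 1) * u + 1 * u" using that by (intro add_mono) auto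
    also have "\<dots> = ((2 * k - 1) + (2 * l - 1) + 1) * u" by (simp only: add_mult_distrib)
    also have "(2 * k - 1) + (2 * l - 1) + 1 = 2 * (k + l) - 1" using that by simp
    finally show ?thesis .
  qed
  {
    case (Num k)
    then show ?case using bv[of "Num k"] by simp
  next
    case (Cell e)
    then show ?case using bv[of "Cell e"] bin[of "cost e M" "esize e" "B * s + 2" 0 1 "bits (M (val e M))"] esize_pos[of e] by simp
  next
    case (Plus e f)
    then have p: "small_consts e" "esize e \<le> s" "small_consts f" "esize f \<le> s" by auto
    from bin[OF Plus.IH(1)[OF p(1,2)] Plus.IH(2)[OF p(3,4)] bv[OF Plus.prems] esize_pos esize_pos]
    show ?case by (simp only: cost.simps esize.simps)
  next
    case (Minus e f)
    then have p: "small_consts e" "esize e \<le> s" "small_consts f" "esize f \<le> s" by auto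
    from bin[OF Minus.IH(1)[OF p(1,2)] Minus.IH(2)[OF p(3,4)] bv[OF Minus.prems] esize_pos esize_pos]
    show ?case by (simp only: cost.simps esize.simps)
  next
    case (Times e f)
    then have p: "small_consts e" "esize e \<le> s" "small_consts f" "esize f \<le> s" by auto
    from bin[OF Times.IH(1)[OF p(1,2)] Times.IH(2)[OF p(3,4)] bv[OF Times.prems] esize_pos esize_pos]
    show ?case by (simp only: cost.simps esize.simps)
  next
    case (Quot e f)
    then have p: "small_consts e" "esize e \<le> s" "small_consts f" "esize f \<le> s" by auto
    from bin[OF Quot.IH(1)[OF p(1,2)] Quot.IH(2)[OF p(3,4)] bv[OF Quot.prems] esize_pos esize_pos]
    show ?case by (simp only: cost.simps esize.simps)
  }
qed

text \<open>Time is counted in units that pay for one store or one test.\<close>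

definition unit_time :: "nat \<Rightarrow> nat" where "unit_time B = 50000 * B"

text \<open>At most 199 = 2 * 100 - 1 nodes of at most 100 B + 2 bits each. Twice this plus 1 stays
  below \<open>unit_time B\<close> because 5 \<le> B.\<close>

lemma cost_simple:
  assumes "bounded_mem B M" "simple e"
  shows "cost e M \<le> 19900 * B + 398"
proof -
  have "cost e M \<le> (2 * esize e - 1) * (B * 100 + 2)"
    using assms unfolding simple_def by (intro cost_bound) auto
  also have "\<dots> \<le> 199 * (B * 100 + 2)"
    using assms unfolding simple_def by (intro mult_right_mono) auto
  finally show ?thesis by simp
qed

text \<open>Total correctness with a time bound. Boundedness of the memory is carried along because
  the price of the next step depends on it.\<close>

definition triple :: "nat \<Rightarrow> (mem \<Rightarrow> bool) \<Rightarrow> prog \<Rightarrow> nat \<Rightarrow> (mem \<Rightarrow> bool) \<Rightarrow> bool" where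
  "triple B pre P k post \<longleftrightarrow> (\<forall>M. bounded_mem B M \<and> pre M \<longrightarrow>
     (\<exists>t M'. run P M t M' \<and> t \<le> k * unit_time B \<and> bounded_mem B M' \<and> post M'))"

lemma tripleD:
  assumes "triple B pre P k post" "bounded_mem B M" "pre M"
  obtains t M' where "run P M t M'" "t \<le> k * unit_time B" "bounded_mem B M'" "post M'"
  using assms unfolding triple_def by blast

lemma triple_weaken:
  assumes "triple B pre P k post" "\<And>M. pre' M \<Longrightarrow> pre M" "k \<le> k'" "\<And>M. post M \<Longrightarrow> post' M"
  shows "triple B pre' P k' post'"
  unfolding triple_def
proof (intro allI impI)
  fix M assume "bounded_mem B M \<and> pre' M"
  then obtain t M' where "run P M t M'" "t \<le> k * unit_time B" "bounded_mem B M'" "post M'"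
    using assms tripleD by metis
  moreover have "k * unit_time B \<le> k' * unit_time B" using assms(3) by simp
  ultimately show "\<exists>t M'. run P M t M' \<and> t \<le> k' * unit_time B \<and> bounded_mem B M' \<and> post' M'"
    using assms(4) le_trans by blast
qed

lemma triple_Seq:
  assumes "triple B pre P k mid" "triple B mid Q l post"
  shows "triple B pre (Seq P Q) (k + l) post"
  unfolding triple_def
proof (intro allI impI)
  fix M assume "bounded_mem B M \<and> pre M"
  then obtain t M' where 1: "run P M t M'" "t \<le> k * unit_time B" "bounded_mem B M'" "mid M'"
    using assms(1) tripleD by metis
  then obtain u M'' where 2: "run Q M' u M''" "u \<le> l * unit_time B" "bounded_mem B M''" "post M''"
    using assms(2) tripleD by metis
  have "run (Seq P Q) M (t + u) M''" using 1(1) 2(1) by (rule run.Seq)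
  moreover have "t + u \<le> (k + l) * unit_time B" using 1(2) 2(2) by (simp add: algebra_simps)
  ultimately show "\<exists>t M'. run (Seq P Q) M t M' \<and> t \<le> (k + l) * unit_time B \<and> bounded_mem B M' \<and> post M'"
    using 2 by blast
qed

lemma triple_If:
  assumes "simple e" "triple B (\<lambda>M. pre M \<and> 0 < val e M) P k post" "triple B (\<lambda>M. pre M \<and> \<not> 0 < val e M) Q k post"
  shows "triple B pre (IfPos e P Q) (Suc k) post"
  unfolding triple_def
proof (intro allI impI)
  fix M assume M: "bounded_mem B M \<and> pre M"
  then have B: "5 \<le> B" unfolding bounded_mem_def by simp
  have "1 + cost e M \<le> unit_time B"
    using cost_simple[of B M e] assms(1) M B unfolding unit_time_def by linarith
  then have tm: "1 + cost e M + t \<le> Suc k * unit_time B" if "t \<le> k * unit_time B" for t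
    using that by simp
  show "\<exists>t M'. run (IfPos e P Q) M t M' \<and> t \<le> Suc k * unit_time B \<and> bounded_mem B M' \<and> post M'"
  proof (cases "0 < val e M")
    case True
    then obtain t M' where "run P M t M'" "t \<le> k * unit_time B" "bounded_mem B M'" "post M'"
      using assms(2) M tripleD by metis
    then show ?thesis using run.IfTrue[OF True] tm by blast
  next
    case False
    then obtain t M' where "run Q M t M'" "t \<le> k * unit_time B" "bounded_mem B M'" "post M'"
      using assms(3) M tripleD by metis
    then show ?thesis using run.IfFalse[OF False] tm by blast
  qed
qed

fun straight :: "prog \<Rightarrow> bool" where
  "straight Skip \<longleftrightarrow> True"
| "straight (Store a e) \<longleftrightarrow> simple a \<and> simple e"
| "straight (Seq P Q) \<longleftrightarrow> straight P \<and> straight Q"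
| "straight (IfPos e P Q) \<longleftrightarrow> simple e \<and> straight P \<and> straight Q"
| "straight (WhilePos e P) \<longleftrightarrow> False"

text \<open>Loop-free programs are evaluated by simplification; the clause for loops is a
  placeholder, excluded by \<open>straight\<close>.\<close>

fun exec :: "prog \<Rightarrow> mem \<Rightarrow> mem" where
  "exec Skip M = M"
| "exec (Store a e) M = M(val a M := val e M)"
| "exec (Seq P Q) M = exec Q (exec P M)"
| "exec (IfPos e P Q) M = (if 0 < val e M then exec P M else exec Q M)"
| "exec (WhilePos e P) M = M"

fun exec_bounded :: "nat \<Rightarrow> prog \<Rightarrow> mem \<Rightarrow> bool" where
  "exec_bounded B Skip M \<longleftrightarrow> True"
| "exec_bounded B (Store a e) M \<longleftrightarrow> \<bar>val e M\<bar> \<le> 2 ^ B"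
| "exec_bounded B (Seq P Q) M \<longleftrightarrow> exec_bounded B P M \<and> exec_bounded B Q (exec P M)"
| "exec_bounded B (IfPos e P Q) M \<longleftrightarrow> (if 0 < val e M then exec_bounded B P M else exec_bounded B Q M)"
| "exec_bounded B (WhilePos e P) M \<longleftrightarrow> True"

fun steps :: "prog \<Rightarrow> nat" where
  "steps Skip = 1"
| "steps (Store a e) = 1"
| "steps (Seq P Q) = steps P + steps Q"
| "steps (IfPos e P Q) = Suc (steps P + steps Q)"
| "steps (WhilePos e P) = 0"

lemma straight_run:
  assumes "straight P" "bounded_mem B M" "exec_bounded B P M"
  shows "\<exists>t. run P M t (exec P M) \<and> t \<le> steps P * unit_time B \<and> bounded_mem B (exec P M)"
  using assms
proof (induction P arbitrary: M)
  case Skip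
  then have "1 \<le> unit_time B" unfolding unit_time_def bounded_mem_def by simp
  then show ?case using Skip run.Skip by fastforce
next
  case (Store a e)
  have B: "5 \<le> B" using Store unfolding bounded_mem_def by simp
  have "1 + cost a M + cost e M \<le> unit_time B"
    using cost_simple[of B M a] cost_simple[of B M e] Store B unfolding unit_time_def by simp
  then have "1 + cost a M + cost e M \<le> steps (Store a e) * unit_time B" by simp
  moreover have "bounded_mem B (exec (Store a e) M)" using Store unfolding bounded_mem_def by simp
  moreover have "run (Store a e) M (1 + cost a M + cost e M) (exec (Store a e) M)"
    using run.Store[of a e M] by simp
  ultimately show ?case by blast
next
  case (Seq P Q)
  have "straight P" "straight Q" "exec_bounded B P M" "exec_bounded B Q (exec P M)" using Seq.prems by auto
  from Seq.IH(1)[OF this(1) Seq.prems(2) this(3)] obtain t where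
    1: "run P M t (exec P M)" "t \<le> steps P * unit_time B" "bounded_mem B (exec P M)" by blast
  from Seq.IH(2)[OF \<open>straight Q\<close> this(3) \<open>exec_bounded B Q (exec P M)\<close>] obtain u where
    2: "run Q (exec P M) u (exec Q (exec P M))" "u \<le> steps Q * unit_time B" "bounded_mem B (exec Q (exec P M))" by blast
  have "run (Seq P Q) M (t + u) (exec (Seq P Q) M)" using run.Seq[OF 1(1) 2(1)] by simp
  moreover have "t + u \<le> steps (Seq P Q) * unit_time B" using 1(2) 2(2) by (simp add: algebra_simps)
  ultimately show ?case using 2(3) by auto
next
  case (IfPos e P Q)
  have B: "5 \<le> B" using IfPos unfolding bounded_mem_def by simp
  have c: "1 + cost e M \<le> unit_time B"
    using cost_simple[of B M e] IfPos B unfolding unit_time_def by simp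
  show ?case
  proof (cases "0 < val e M")
    case True
    with IfPos.prems have "straight P" "exec_bounded B P M" by auto
    from IfPos.IH(1)[OF this(1) IfPos.prems(2) this(2)] obtain t where
      1: "run P M t (exec P M)" "t \<le> steps P * unit_time B" "bounded_mem B (exec P M)" by blast
    have "1 + cost e M + t \<le> steps (IfPos e P Q) * unit_time B"
      using c 1(2) by (simp add: algebra_simps)
    then show ?thesis using run.IfTrue[OF True 1(1)] 1(3) True by auto
  next
    case False
    with IfPos.prems have "straight Q" "exec_bounded B Q M" by auto
    from IfPos.IH(2)[OF this(1) IfPos.prems(2) this(2)] obtain t where
      1: "run Q M t (exec Q M)" "t \<le> steps Q * unit_time B" "bounded_mem B (exec Q M)" by blast
    have "1 + cost e M + t \<le> steps (IfPos e P Q) * unit_time B"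
      using c 1(2) by (simp add: algebra_simps)
    then show ?thesis using run.IfFalse[OF False 1(1)] 1(3) False by auto
  qed
next
  case (WhilePos e P)
  then show ?case by simp
qed

lemma triple_straight:
  assumes "straight P" "\<And>M. bounded_mem B M \<Longrightarrow> pre M \<Longrightarrow> exec_bounded B P M \<and> post (exec P M)"
  shows "triple B pre P (steps P) post"
  using assms straight_run unfolding triple_def by blast

definition For :: "int \<Rightarrow> int \<Rightarrow> prog \<Rightarrow> prog" where
  "For c l P = Seq (Store (Num c) (Num 0)) (WhilePos (Minus (Cell (Num l)) (Cell (Num c)))
     (Seq P (Store (Num c) (Plus (Cell (Num c)) (Num 1)))))"

text \<open>Each round pays for a test, the body and the increment; the other 2 units are the
  initial store and the final test. \<open>frame\<close> makes the invariant independent of the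
  counter, whose value is tracked separately.\<close>

lemma triple_For:
  assumes body: "\<And>q. q < N \<Longrightarrow> triple B (\<lambda>M. I q M \<and> M c = int q) P k (\<lambda>M. I (Suc q) M \<and> M c = int q)"
    and lim: "\<And>q M. I q M \<Longrightarrow> M l = int N"
    and frame: "\<And>q M v. I q M \<Longrightarrow> I q (M(c := v))"
    and N: "int N \<le> 2 ^ B" and cl: "\<bar>c\<bar> \<le> 32" "\<bar>l\<bar> \<le> 32"
  shows "triple B (I 0) (For c l P) (2 + N * (k + 2)) (I N)"
proof -
  let ?e = "Minus (Cell (Num l)) (Cell (Num c))"
  let ?inc = "Store (Num c) (Plus (Cell (Num c)) (Num 1))"
  let ?W = "WhilePos ?e (Seq P ?inc)"
  have se: "simple ?e" using cl unfolding simple_def by simp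
  have loop: "\<exists>t M'. run ?W M t M' \<and> t \<le> (1 + (N - q) * (k + 2)) * unit_time B \<and> bounded_mem B M' \<and> I N M'"
    if "q \<le> N" "bounded_mem B M" "I q M" "M c = int q" for q M
    using that
  proof (induction q arbitrary: M rule: inc_induct)
    case base
    have B: "5 \<le> B" using base unfolding bounded_mem_def by simp
    have "1 + cost ?e M \<le> unit_time B"
      using cost_simple[OF base(1) se] B unfolding unit_time_def by linarith
    moreover have "\<not> 0 < val ?e M" using base lim by simp
    ultimately show ?case using run.WhileFalse[of ?e M] base by fastforce
  next
    case (step q)
    have B: "5 \<le> B" using step unfolding bounded_mem_def by simp
    have c: "1 + cost ?e M \<le> unit_time B"
      using cost_simple[OF step(4) se] B unfolding unit_time_def by linarith
    have pos: "0 < val ?e M" using step lim[OF step(5)] by simp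
    obtain t M' where 1: "run P M t M'" "t \<le> k * unit_time B" "bounded_mem B M'" "I (Suc q) M'" "M' c = int q"
      using tripleD[OF body[OF step(2)] step(4)] step(5,6) by (metis (no_types, lifting))
    have si: "straight ?inc" using cl by (simp add: simple_def)
    have "int q + 1 \<le> int N" using step by simp
    from this N have "int q + 1 \<le> 2 ^ B" by (rule order_trans)
    then have "exec_bounded B ?inc M'" using 1(5) by simp
    from straight_run[OF si 1(3) this] obtain u where
      2: "run ?inc M' u (M'(c := int q + 1))" "u \<le> unit_time B" "bounded_mem B (M'(c := int q + 1))"
      using 1(5) by auto
    have "I (Suc q) (M'(c := int q + 1))" using frame 1(4) by blast
    moreover have "(M'(c := int q + 1)) c = int (Suc q)" by simp
    ultimately obtain w M'' where
      3: "run ?W (M'(c := int q + 1)) w M''" "w \<le> (1 + (N - Suc q) * (k + 2)) * unit_time B" "bounded_mem B M''" "I N M''"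
      using step.IH[OF 2(3)] by blast
    have "run ?W M (1 + cost ?e M + (t + u) + w) M''"
      using run.WhileTrue[OF pos run.Seq[OF 1(1) 2(1)] 3(1)] .
    moreover have "1 + cost ?e M + (t + u) + w \<le> (1 + (N - q) * (k + 2)) * unit_time B"
    proof -
      have Nq: "N - q = Suc (N - Suc q)" using step by simp
      have "1 + cost ?e M + (t + u) + w \<le> unit_time B + (k * unit_time B + unit_time B) + (1 + (N - Suc q) * (k + 2)) * unit_time B"
        using c 1(2) 2(2) 3(2) by (intro add_mono) auto
      also have "\<dots> = (1 + (N - q) * (k + 2)) * unit_time B" unfolding Nq by (simp add: algebra_simps)
      finally show ?thesis .
    qed
    ultimately show ?case using 3 by blast
  qed
  have "triple B (\<lambda>M. I 0 M \<and> M c = 0) ?W (1 + N * (k + 2)) (I N)"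
    unfolding triple_def using loop[of 0] by auto
  moreover have "triple B (I 0) (Store (Num c) (Num 0)) (steps (Store (Num c) (Num 0))) (\<lambda>M. I 0 M \<and> M c = 0)"
    using cl frame by (intro triple_straight) (auto simp: simple_def)
  ultimately show ?thesis
    unfolding For_def using triple_Seq by fastforce
qed

text \<open>
  Cell \<open>-c\<close> serves as variable \<open>c\<close>: 1 is \<open>n\<close>, 2 is \<open>m\<close>, 3 the common denominator of all times, 4 and 5
  are loop counters, 6, 7 and 8 the components of the current candidate, 10 the number of candidates,
  11 tells whether a candidate has been found, 12 is the time of the current one, and 13, 14, 15 are
  time, machine and job of the best one.  The interleaved arrays below are release (0), processing
  (1) and starting time (2), machine (3), released work (4) and status (5) of every job, and the
  time when a machine becomes free (6).
\<close>

definition V :: "int \<Rightarrow> int" where "V c = - c"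
definition A :: "int \<Rightarrow> int \<Rightarrow> int" where "A f j = - 16 - f - 8 * j"

lemma V_eq [simp]: "V c = V d \<longleftrightarrow> c = d"
  unfolding V_def by simp

text \<open>Variables occupy cells -1 to -15; arrays lie from -16 downwards with stride 8, so
  residues modulo 8 separate them. Nonnegative cells remain reserved for input and output.\<close>

lemma A_eq [simp]: "0 \<le> f \<Longrightarrow> f < 8 \<Longrightarrow> 0 \<le> g \<Longrightarrow> g < 8 \<Longrightarrow> A f j = A g k \<longleftrightarrow> f = g \<and> j = k"
  unfolding A_def by presburger

lemma A_neq_V [simp]: "0 \<le> f \<Longrightarrow> 0 \<le> j \<Longrightarrow> c < 16 \<Longrightarrow> A f j \<noteq> V c" "0 \<le> f \<Longrightarrow> 0 \<le> j \<Longrightarrow> c < 16 \<Longrightarrow> V c \<noteq> A f j"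
  unfolding A_def V_def by auto

lemma V_neq_input [simp]: "0 < c \<Longrightarrow> 0 \<le> a \<Longrightarrow> V c \<noteq> a" "0 < c \<Longrightarrow> 0 \<le> a \<Longrightarrow> a \<noteq> V c"
  unfolding V_def by auto

lemma A_neq_input [simp]: "0 \<le> f \<Longrightarrow> 0 \<le> j \<Longrightarrow> 0 \<le> a \<Longrightarrow> A f j \<noteq> a" "0 \<le> f \<Longrightarrow> 0 \<le> j \<Longrightarrow> 0 \<le> a \<Longrightarrow> a \<noteq> A f j"
  unfolding A_def by auto

definition va :: "int \<Rightarrow> expr" where "va c = Cell (Num (V c))"
definition ad :: "int \<Rightarrow> int \<Rightarrow> expr" where "ad f c = Minus (Num (- 16 - f)) (Times (Num 8) (va c))"
definition aa :: "int \<Rightarrow> int \<Rightarrow> expr" where "aa f c = Cell (ad f c)"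
definition inp :: "int \<Rightarrow> int \<Rightarrow> expr" where "inp d c = Cell (Plus (Num d) (Times (Num 4) (va c)))"
definition setv :: "int \<Rightarrow> expr \<Rightarrow> prog" where "setv c e = Store (Num (V c)) e"
definition seta :: "int \<Rightarrow> int \<Rightarrow> expr \<Rightarrow> prog" where "seta f c e = Store (ad f c) e"

lemma val_access [simp]:
  "val (va c) M = M (V c)" "val (ad f c) M = A f (M (V c))" "val (aa f c) M = M (A f (M (V c)))"
  "val (inp d c) M = M (d + 4 * M (V c))"
  unfolding va_def ad_def aa_def inp_def A_def by simp_all

lemma exec_set [simp]:
  "exec (setv c e) M = M(V c := val e M)" "exec (seta f c e) M = M(A f (M (V c)) := val e M)"
  "exec_bounded B (setv c e) M \<longleftrightarrow> \<bar>val e M\<bar> \<le> 2 ^ B" "exec_bounded B (seta f c e) M \<longleftrightarrow> \<bar>val e M\<bar> \<le> 2 ^ B"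
  "steps (setv c e) = 1" "steps (seta f c e) = 1"
  unfolding setv_def seta_def by simp_all

lemma triple_For_V:
  assumes "\<And>q. q < N \<Longrightarrow> triple B (\<lambda>M. I q M \<and> M (V c) = int q) Q k (\<lambda>M. I (Suc q) M \<and> M (V c) = int q)"
    and "\<And>q M. I q M \<Longrightarrow> M (V l) = int N"
    and "\<And>q M v. I q M \<Longrightarrow> I q (M(V c := v))"
    and "int N \<le> 2 ^ B" "\<bar>c\<bar> \<le> 32" "\<bar>l\<bar> \<le> 32"
  shows "triple B (I 0) (For (V c) (V l) Q) (2 + N * (k + 2)) (I N)"
  by (rule triple_For[OF assms(1-4)]) (use assms(5,6) in \<open>simp_all add: V_def\<close>)

lemma triple_For_straight:
  assumes "\<And>q M. q < N \<Longrightarrow> I q M \<Longrightarrow> M (V c) = int q \<Longrightarrow> bounded_mem B M \<Longrightarrow>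
      exec_bounded B Q M \<and> I (Suc q) (exec Q M) \<and> exec Q M (V c) = int q"
    and "straight Q" "steps Q + 2 = k"
    and "\<And>q M. I q M \<Longrightarrow> M (V l) = int N"
    and "\<And>q M v. I q M \<Longrightarrow> I q (M(V c := v))"
    and "int N \<le> 2 ^ B" "\<bar>c\<bar> \<le> 32" "\<bar>l\<bar> \<le> 32"
  shows "triple B (I 0) (For (V c) (V l) Q) (2 + N * k) (I N)"
  unfolding assms(3)[symmetric]
  using assms(1,2) by (intro triple_For_V[OF triple_straight] assms(4-8)) auto

lemma abs_V [simp]: "\<bar>V c\<bar> = \<bar>c\<bar>"
  unfolding V_def by simp

lemmas straight_defs = setv_def seta_def inp_def aa_def ad_def va_def simple_def

section \<open>The program\<close>

definition p_den :: prog where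
  "p_den = For (V 4) (V 1) (setv 3 (Times (va 3) (Times (inp 3 4) (inp 5 4))))"
definition p_scale :: prog where
  "p_scale = For (V 4) (V 1) (Seq (seta 0 4 (Times (inp 2 4) (Quot (va 3) (inp 3 4))))
     (seta 1 4 (Times (inp 4 4) (Quot (va 3) (inp 5 4)))))"
definition p_idle :: prog where
  "p_idle = For (V 4) (V 1) (Seq (seta 2 4 (aa 0 4)) (seta 3 4 (va 4)))"
text \<open>Adding 1 turns the strict test of \<open>IfPos\<close> into \<le> on integers;
  \<open>e_admit\<close> uses the same device.\<close>

definition p_work :: prog where
  "p_work = For (V 4) (V 1) (For (V 5) (V 1)
     (IfPos (Minus (Plus (aa 0 4) (Num 1)) (aa 0 5)) (seta 4 4 (Plus (aa 4 4) (aa 1 5))) Skip))"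
definition p_out :: prog where
  "p_out = For (V 4) (V 1) (Seq (Store (Times (Num 3) (va 4)) (aa 3 4))
     (Seq (Store (Plus (Times (Num 3) (va 4)) (Num 1)) (aa 2 4))
          (Store (Plus (Times (Num 3) (va 4)) (Num 2)) (va 3))))"
definition p_init :: prog where
  "p_init = Seq (setv 1 (Cell (Num 0))) (Seq (setv 2 (Cell (Num 1))) (setv 3 (Num 1)))"

text \<open>Decodes the candidate in variable 5. Remainders are formed by subtraction, as
  expressions offer only the quotient.\<close>

definition p_pick :: prog where
  "p_pick = Seq (setv 6 (Quot (Quot (va 5) (va 1)) (va 1)))
     (Seq (setv 7 (Minus (Quot (va 5) (va 1)) (Times (va 6) (va 1))))
          (setv 8 (Minus (va 5) (Times (Quot (va 5) (va 1)) (va 1)))))"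
definition p_time :: prog where
  "p_time = Seq (setv 12 (aa 6 6))
     (Seq (IfPos (Minus (aa 0 7) (va 12)) (setv 12 (aa 0 7)) Skip)
          (IfPos (Minus (aa 0 8) (va 12)) (setv 12 (aa 0 8)) Skip))"
definition p_update :: prog where
  "p_update = Seq (setv 11 (Num 1)) (Seq (setv 13 (va 12)) (Seq (setv 14 (va 6)) (setv 15 (va 7))))"
text \<open>Equality of times is reached by excluding both strict orders. The outermost test accepts
  any candidate while none has been found.\<close>

definition p_compare :: prog where
  "p_compare = IfPos (Minus (Num 1) (va 11)) p_update
     (IfPos (Minus (va 13) (va 12)) p_update
     (IfPos (Minus (va 12) (va 13)) Skip
     (IfPos (Minus (aa 1 15) (aa 1 7)) p_update Skip)))"
definition e_admit :: expr where
  "e_admit = Minus (Plus (Times (va 2) (Times (aa 4 8) (aa 4 8))) (Num 1))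
     (Times (va 1) (Times (Times (va 6) (aa 1 7)) (Times (va 6) (aa 1 7))))"
definition p_body :: prog where
  "p_body = Seq p_pick (IfPos (Minus (Num 1) (aa 5 7)) (IfPos e_admit (Seq p_time p_compare) Skip) Skip)"
definition p_assign :: prog where
  "p_assign = Seq (seta 2 15 (va 13)) (Seq (seta 3 15 (va 14))
     (Seq (seta 5 15 (Num 1)) (seta 6 14 (Plus (va 13) (aa 1 15)))))"
definition p_main :: prog where
  "p_main = Seq (setv 10 (Times (va 2) (Times (va 1) (va 1))))
     (For (V 4) (V 1) (Seq (setv 11 (Num 0)) (Seq (For (V 5) (V 10) p_body) p_assign)))"
definition p_greedy :: prog where
  "p_greedy = Seq p_init (Seq p_den (Seq p_scale
     (Seq (IfPos (Minus (va 1) (va 2)) (Seq p_work p_main) p_idle) p_out)))"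

lemma exec_pick:
  assumes "M (V 1) = int n" "M (V 5) = int x"
  shows "exec p_pick M = M(V 6 := int (cand_mach n x), V 7 := int (cand_job n x), V 8 := int (cand_rel n x))"
proof -
  have "int (x div n) - int (x div n div n) * int n = int (x div n mod n)"
    by (simp only: zdiv_int zmod_int minus_div_mult_eq_mod)
  moreover have "int x - int (x div n) * int n = int (x mod n)"
    by (simp only: zdiv_int zmod_int minus_div_mult_eq_mod)
  ultimately show ?thesis
    using assms unfolding p_pick_def cand_mach_def cand_job_def cand_rel_def by (simp flip: zdiv_int)
qed

lemma exec_time:
  assumes "0 \<le> M (V 6)" "0 \<le> M (V 7)" "0 \<le> M (V 8)"
  shows "exec p_time M = M(V 12 := max (max (M (A 6 (M (V 6)))) (M (A 0 (M (V 7))))) (M (A 0 (M (V 8)))))"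
  using assms unfolding p_time_def by (auto simp: max_def)

lemma exec_update:
  "exec p_update M = M(V 11 := 1, V 13 := M (V 12), V 14 := M (V 6), V 15 := M (V 7))"
  unfolding p_update_def by simp

lemma exec_compare:
  "exec p_compare M = (if M (V 11) \<le> 0 \<or> M (V 12) < M (V 13) \<or>
     M (V 12) = M (V 13) \<and> M (A 1 (M (V 7))) < M (A 1 (M (V 15))) then exec p_update M else M)"
  unfolding p_compare_def by auto

lemma exec_bounded_update:
  assumes "bounded_mem B M"
  shows "exec_bounded B p_update M"
  using assms unfolding p_update_def bounded_mem_def by simp

lemma exec_bounded_compare:
  assumes "bounded_mem B M"
  shows "exec_bounded B p_compare M"
  using exec_bounded_update[OF assms] unfolding p_compare_def by simp

lemma exec_bounded_time:
  assumes "bounded_mem B M" "0 \<le> M (V 6)" "0 \<le> M (V 7)" "0 \<le> M (V 8)"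
  shows "exec_bounded B p_time M"
  using assms unfolding p_time_def bounded_mem_def by simp

section \<open>The input\<close>

definition RN :: "(rat \<times> rat) list \<Rightarrow> nat \<Rightarrow> int" where "RN K j = fst (quotient_of (fst (K ! j)))"
definition RD :: "(rat \<times> rat) list \<Rightarrow> nat \<Rightarrow> int" where "RD K j = snd (quotient_of (fst (K ! j)))"
definition PN :: "(rat \<times> rat) list \<Rightarrow> nat \<Rightarrow> int" where "PN K j = fst (quotient_of (snd (K ! j)))"
definition PD :: "(rat \<times> rat) list \<Rightarrow> nat \<Rightarrow> int" where "PD K j = snd (quotient_of (snd (K ! j)))"
definition DD :: "(rat \<times> rat) list \<Rightarrow> nat \<Rightarrow> int" where "DD K q = (\<Prod>j<q. RD K j * PD K j)"
definition R :: "(rat \<times> rat) list \<Rightarrow> nat \<Rightarrow> int" where "R K j = RN K j * (DD K (length K) div RD K j)"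
definition P :: "(rat \<times> rat) list \<Rightarrow> nat \<Rightarrow> int" where "P K j = PN K j * (DD K (length K) div PD K j)"
definition WK :: "(rat \<times> rat) list \<Rightarrow> nat \<Rightarrow> int" where
  "WK K k = (\<Sum>l | l < length K \<and> R K l \<le> R K k. P K l)"

lemma nth_concat_blocks:
  assumes "\<And>x. length (f x) = b" "c < b" "j < length xs"
  shows "concat (map f xs) ! (b * j + c) = f (xs ! j) ! c"
  using assms(3)
proof (induction xs arbitrary: j)
  case (Cons x xs)
  show ?case
  proof (cases j)
    case 0
    then show ?thesis using assms by (simp add: nth_append)
  next
    case (Suc i)
    then show ?thesis using Cons assms by (simp add: nth_append)
  qed
qed simp

lemma length_concat_blocks:
  assumes "\<And>x. length (f x) = b"
  shows "length (concat (map f xs)) = b * length xs"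
  using assms by (induction xs) auto

lemma load_negative: "a < 0 \<Longrightarrow> load xs a = 0"
  unfolding load_def by simp

lemma load_encode:
  "load (encode m K) 0 = int (length K)" "load (encode m K) 1 = int m"
  "j < length K \<Longrightarrow> load (encode m K) (2 + 4 * int j) = RN K j"
  "j < length K \<Longrightarrow> load (encode m K) (3 + 4 * int j) = RD K j"
  "j < length K \<Longrightarrow> load (encode m K) (4 + 4 * int j) = PN K j"
  "j < length K \<Longrightarrow> load (encode m K) (5 + 4 * int j) = PD K j"
proof -
  let ?f = "\<lambda>(r, p). encode_rat r @ encode_rat p"
  have f: "length (?f x) = 4" for x by (cases x) (simp add: encode_rat_def)
  have len: "length (encode m K) = 2 + 4 * length K"
    unfolding encode_def by (simp add: length_concat_blocks[of ?f 4, OF f])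
  show "load (encode m K) 0 = int (length K)" "load (encode m K) 1 = int m"
    by (simp_all add: load_def encode_def)
  have *: "load (encode m K) (int (Suc (Suc (4 * j + c)))) = ?f (K ! j) ! c" if "j < length K" "c < 4" for j c
  proof -
    have "load (encode m K) (int (Suc (Suc (4 * j + c)))) = encode m K ! Suc (Suc (4 * j + c))"
      using that unfolding load_def len by (simp del: of_nat_Suc)
    also have "\<dots> = concat (map ?f K) ! (4 * j + c)" unfolding encode_def by simp
    finally show ?thesis using nth_concat_blocks[of ?f 4, OF f] that by simp
  qed
  assume j: "j < length K"
  show "load (encode m K) (2 + 4 * int j) = RN K j"
    using *[OF j, of 0] unfolding RN_def by (simp add: encode_rat_def case_prod_unfold algebra_simps)
  show "load (encode m K) (3 + 4 * int j) = RD K j"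
    using *[OF j, of 1] unfolding RD_def by (simp add: encode_rat_def case_prod_unfold algebra_simps)
  show "load (encode m K) (4 + 4 * int j) = PN K j"
    using *[OF j, of 2] unfolding PN_def by (simp add: encode_rat_def case_prod_unfold algebra_simps numeral_2_eq_2)
  show "load (encode m K) (5 + 4 * int j) = PD K j"
    using *[OF j, of 3] unfolding PD_def by (simp add: encode_rat_def case_prod_unfold algebra_simps numeral_3_eq_3)
qed

lemma input_size_encode:
  "input_size (encode m K) = bits (int (length K)) + bits (int m) +
     (\<Sum>j<length K. bits (RN K j) + bits (RD K j) + bits (PN K j) + bits (PD K j))"
proof -
  let ?g = "\<lambda>x. bits (fst (quotient_of (fst x))) + bits (snd (quotient_of (fst x)))
      + bits (fst (quotient_of (snd x))) + bits (snd (quotient_of (snd x)))"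
  have "sum_list (map bits (concat (map (\<lambda>(r, p). encode_rat r @ encode_rat p) K))) = sum_list (map ?g K)"
    by (induction K) (auto simp: encode_rat_def)
  also have "\<dots> = (\<Sum>j<length K. ?g (K ! j))"
    by (simp add: sum_list_sum_nth atLeast0LessThan)
  finally show ?thesis
    unfolding input_size_def encode_def RN_def RD_def PN_def PD_def by simp
qed

lemma bits_pos: "1 \<le> bits k" unfolding bits_def by simp

lemma abs_le_bits: "\<bar>k\<bar> \<le> 2 ^ bits k"
proof -
  have "nat \<bar>k\<bar> < 2 ^ floorlog 2 (nat \<bar>k\<bar>)" by (rule floorlog_leD) auto
  then have "\<bar>k\<bar> < 2 ^ floorlog 2 (nat \<bar>k\<bar>)" by (simp add: nat_less_iff)
  also have "\<dots> \<le> 2 ^ bits k" unfolding bits_def by (intro power_increasing) auto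
  finally show ?thesis by simp
qed

lemma load_le: "\<bar>load xs a\<bar> \<le> 2 ^ input_size xs"
proof (cases "0 \<le> a \<and> a < int (length xs)")
  case True
  then have "bits (xs ! nat a) \<le> input_size xs"
    unfolding input_size_def by (intro member_le_sum_list) auto
  then have "(2 :: int) ^ bits (xs ! nat a) \<le> 2 ^ input_size xs" by (intro power_increasing) auto
  with abs_le_bits[of "xs ! nat a"] have "\<bar>xs ! nat a\<bar> \<le> 2 ^ input_size xs" by (rule order_trans)
  then show ?thesis using True unfolding load_def by simp
qed (auto simp: load_def)

context
  fixes m :: nat and K :: "(rat \<times> rat) list"
  assumes m: "1 \<le> m" and valid: "valid_jobs (real_jobs K)"
begin

abbreviation (input) n where "n \<equiv> length K"
abbreviation (input) J where "J \<equiv> real_jobs K"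
definition L :: nat where "L = input_size (encode m K)"
text \<open>A numerator and the common denominator are at most 2^L each, so a scaled time is at most
  \<open>U\<close>. The third L allows multiples of \<open>U\<close> up to n + 2, and 2^(3 L) also
  covers the m n^2 \<le> n^3 candidates.\<close>

definition B :: nat where "B = 3 * L"
definition U :: int where "U = 2 ^ (2 * L)"
definition D :: int where "D = DD K (length K)"

lemma len_J: "length J = n" unfolding real_jobs_def by simp

lemma L_ge: "4 * n + 2 \<le> L"
proof -
  have "(\<Sum>j<n. 4) \<le> (\<Sum>j<n. bits (RN K j) + bits (RD K j) + bits (PN K j) + bits (PD K j))"
    using bits_pos by (intro sum_mono) (metis add_mono one_add_one numeral_Bit0 add.assoc)
  then show ?thesis using bits_pos[of "int n"] bits_pos[of "int m"] unfolding L_def input_size_encode by simp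
qed

lemma n_le: "int n + 2 \<le> 2 ^ L"
proof -
  have "n + 2 \<le> L" using L_ge by simp
  also have "L < 2 ^ L" by (rule less_exp)
  finally have "int (n + 2) < int (2 ^ L)" by (simp only: of_nat_less_iff)
  then show ?thesis by simp
qed

lemma B_ge: "5 \<le> B" using L_ge unfolding B_def by simp

lemma U_le: "(int n + 2) * U \<le> 2 ^ B"
proof -
  have "(int n + 2) * U \<le> 2 ^ L * U" using n_le unfolding U_def by (intro mult_right_mono) auto
  then show ?thesis unfolding U_def B_def by (simp add: power_add[symmetric])
qed

lemma le_U_le: "x \<le> (int q + 1) * U \<Longrightarrow> q \<le> n + 1 \<Longrightarrow> x \<le> 2 ^ B"
proof -
  assume x: "x \<le> (int q + 1) * U" and q: "q \<le> n + 1"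
  have "(int q + 1) * U \<le> (int n + 2) * U" using q unfolding U_def by (intro mult_right_mono) auto
  then show ?thesis using x U_le by linarith
qed

lemma n_le_B: "int n \<le> 2 ^ B"
proof -
  have "(2 :: int) ^ L \<le> 2 ^ B" unfolding B_def by (intro power_increasing) auto
  then show ?thesis using n_le by linarith
qed

lemma n_le_B_nat: "n \<le> 2 ^ B"
  using n_le_B by simp

lemma den_pos: "0 < RD K j" "0 < PD K j"
  unfolding RD_def PD_def using quotient_of_denom_pos' by auto

lemma DD_pos: "0 < DD K q"
  unfolding DD_def using den_pos by (intro prod_pos) auto

lemma DD_le: "q \<le> n \<Longrightarrow> DD K q \<le> 2 ^ L"
proof -
  assume q: "q \<le> n"
  have "DD K q \<le> (\<Prod>j<q. 2 ^ (bits (RD K j) + bits (PD K j)))"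
    unfolding DD_def
  proof (rule prod_mono)
    fix j
    have "RD K j * PD K j \<le> 2 ^ bits (RD K j) * 2 ^ bits (PD K j)"
      using abs_le_bits[of "RD K j"] abs_le_bits[of "PD K j"] den_pos[of j] by (intro mult_mono) auto
    then show "0 \<le> RD K j * PD K j \<and> RD K j * PD K j \<le> 2 ^ (bits (RD K j) + bits (PD K j))"
      using den_pos[of j] by (simp add: power_add)
  qed
  also have "\<dots> = 2 ^ (\<Sum>j<q. bits (RD K j) + bits (PD K j))" by (simp add: power_sum)
  also have "\<dots> \<le> 2 ^ L"
  proof (rule power_increasing)
    have "(\<Sum>j<q. bits (RD K j) + bits (PD K j)) \<le> (\<Sum>j<n. bits (RN K j) + bits (RD K j) + bits (PN K j) + bits (PD K j))"
      using q by (intro sum_le_included[where i = id]) auto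
    then show "(\<Sum>j<q. bits (RD K j) + bits (PD K j)) \<le> L" unfolding L_def input_size_encode by simp
  qed simp
  finally show ?thesis .
qed

lemma D_pos: "0 < D" unfolding D_def by (rule DD_pos)
lemma D_le: "D \<le> 2 ^ L" unfolding D_def by (rule DD_le) simp

lemma den_dvd: "j < n \<Longrightarrow> RD K j dvd D" "j < n \<Longrightarrow> PD K j dvd D"
proof -
  assume "j < n"
  then have "RD K j * PD K j dvd D" unfolding D_def DD_def by (intro dvd_prodI) auto
  then show "RD K j dvd D" "PD K j dvd D" by (auto dest: dvd_mult_left dvd_mult_right)
qed

lemma scaled:
  assumes "d dvd D" "0 < d" "q = of_int x / of_int d"
  shows "real_of_int (x * (D div d)) = D * real_of_rat q"
proof -
  have "real_of_int (D div d) = real_of_int D / real_of_int d" using assms by (simp add: real_of_int_div)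
  then show ?thesis using assms by (simp add: of_rat_divide)
qed

lemma R_eq: "j < n \<Longrightarrow> real_of_int (R K j) = D * rel J j"
proof -
  assume j: "j < n"
  have "fst (K ! j) = of_int (RN K j) / of_int (RD K j)"
    unfolding RN_def RD_def by (rule quotient_of_div) simp
  from scaled[OF den_dvd(1)[OF j] den_pos(1) this] show ?thesis
    using j unfolding R_def D_def[symmetric] rel_def real_jobs_def by (simp add: case_prod_unfold)
qed

lemma P_eq: "j < n \<Longrightarrow> real_of_int (P K j) = D * ptime J j"
proof -
  assume j: "j < n"
  have "snd (K ! j) = of_int (PN K j) / of_int (PD K j)"
    unfolding PN_def PD_def by (rule quotient_of_div) simp
  from scaled[OF den_dvd(2)[OF j] den_pos(2) this] show ?thesis
    using j unfolding P_def D_def[symmetric] ptime_def real_jobs_def by (simp add: case_prod_unfold)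
qed

lemma R_nonneg: "j < n \<Longrightarrow> 0 \<le> R K j" and P_pos: "j < n \<Longrightarrow> 0 < P K j"
proof -
  assume j: "j < n"
  then have "0 \<le> rel J j" "0 < ptime J j" using valid len_J unfolding valid_jobs_def by auto
  then have "0 \<le> real_of_int (R K j)" "0 < real_of_int (P K j)"
    unfolding R_eq[OF j] P_eq[OF j] using D_pos by auto
  then show "0 \<le> R K j" "0 < P K j" by simp_all
qed

lemma scaled_le: "\<bar>x\<bar> \<le> 2 ^ L \<Longrightarrow> 0 < d \<Longrightarrow> \<bar>x * (D div d)\<bar> \<le> U"
proof -
  assume x: "\<bar>x\<bar> \<le> 2 ^ L" "0 < d"
  have "\<bar>D div d\<bar> \<le> \<bar>D\<bar>" by (rule abs_div_le)
  also have "\<dots> \<le> 2 ^ L" using D_pos D_le by simp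
  finally have "\<bar>x * (D div d)\<bar> \<le> 2 ^ L * 2 ^ L" unfolding abs_mult using x by (intro mult_mono) auto
  then show ?thesis unfolding U_def by (simp add: power_add[symmetric] mult_2)
qed

lemma R_le: "j < n \<Longrightarrow> R K j \<le> U" and P_le: "j < n \<Longrightarrow> P K j \<le> U"
proof -
  assume j: "j < n"
  have "\<bar>RN K j\<bar> \<le> 2 ^ L" "\<bar>PN K j\<bar> \<le> 2 ^ L"
    using load_le[of "encode m K" "2 + 4 * int j"] load_le[of "encode m K" "4 + 4 * int j"]
    unfolding L_def by (simp_all add: load_encode j)
  then have "\<bar>R K j\<bar> \<le> U" "\<bar>P K j\<bar> \<le> U"
    unfolding R_def P_def D_def[symmetric] using scaled_le den_pos by auto
  then show "R K j \<le> U" "P K j \<le> U" by simp_all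
qed

lemma L_le_B: "(2 :: int) ^ L \<le> 2 ^ B"
  unfolding B_def by (intro power_increasing) auto

section \<open>Preparation\<close>

definition input_ok :: "mem \<Rightarrow> bool" where
  "input_ok M \<longleftrightarrow> (\<forall>a\<ge>0. M a = load (encode m K) a) \<and> M (V 1) = int n \<and> M (V 2) = int m"
text \<open>The program never clears the arrays for released work (4), status (5) and free times
  (6); it relies on memory outside the input being 0.\<close>

definition blank :: "mem \<Rightarrow> bool" where
  "blank M \<longleftrightarrow> (\<forall>f\<in>{4, 5, 6}. \<forall>j. M (A f (int j)) = 0)"
definition I_den :: "nat \<Rightarrow> mem \<Rightarrow> bool" where
  "I_den q M \<longleftrightarrow> input_ok M \<and> blank M \<and> M (V 3) = DD K q"
definition I_scale :: "nat \<Rightarrow> mem \<Rightarrow> bool" where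
  "I_scale q M \<longleftrightarrow> input_ok M \<and> blank M \<and> M (V 3) = D \<and>
     (\<forall>j<q. M (A 0 (int j)) = R K j \<and> M (A 1 (int j)) = P K j)"

lemma input_okD:
  assumes "input_ok M" "j < n"
  shows "M (2 + 4 * int j) = RN K j" "M (3 + 4 * int j) = RD K j"
    "M (4 + 4 * int j) = PN K j" "M (5 + 4 * int j) = PD K j"
  using assms load_encode(3-6)[OF assms(2), of m] unfolding input_ok_def by auto

lemma input_ok_n: "input_ok M \<Longrightarrow> M (V 1) = int n"
  unfolding input_ok_def by simp

lemma input_ok_upd [simp]:
  "input_ok M \<Longrightarrow> 2 < c \<Longrightarrow> c < 16 \<Longrightarrow> input_ok (M(V c := v))"
  "input_ok M \<Longrightarrow> 0 \<le> f \<Longrightarrow> f < 8 \<Longrightarrow> 0 \<le> j \<Longrightarrow> input_ok (M(A f j := v))"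
  unfolding input_ok_def by simp_all

lemma blank_upd [simp]:
  "blank M \<Longrightarrow> c < 16 \<Longrightarrow> blank (M(V c := v))"
  "blank M \<Longrightarrow> 0 \<le> f \<Longrightarrow> f < 4 \<Longrightarrow> blank (M(A f j := v))"
  unfolding blank_def by auto

lemma triple_init: "triple B (\<lambda>M. M = load (encode m K)) p_init 3 (I_den 0)"
proof -
  have "blank (load (encode m K))" unfolding blank_def by (auto simp: load_negative A_def)
  moreover have "\<bar>int m\<bar> \<le> 2 ^ B"
    using load_le[of "encode m K" 1] L_le_B unfolding L_def load_encode by linarith
  moreover have "\<bar>int n\<bar> \<le> 2 ^ B" using n_le_B by simp
  moreover have "(1 :: int) \<le> 2 ^ B" by simp
  ultimately have "exec_bounded B p_init (load (encode m K)) \<and> I_den 0 (exec p_init (load (encode m K)))"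
    unfolding p_init_def I_den_def input_ok_def
    by (simp add: load_encode(1,2) DD_def del: abs_of_nat of_nat_le_numeral_power_cancel_iff)
  then have "triple B (\<lambda>M. M = load (encode m K)) p_init (steps p_init) (I_den 0)"
    by (intro triple_straight) (auto simp: p_init_def straight_defs)
  then show ?thesis unfolding p_init_def by (simp add: numeral_3_eq_3)
qed

lemma triple_den: "triple B (I_den 0) p_den (2 + n * 3) (I_den n)"
  unfolding p_den_def
proof (rule triple_For_straight)
  fix q M assume q: "q < n" and M: "I_den q M" "M (V 4) = int q"
  have "DD K (Suc q) \<le> 2 ^ B" using DD_le[of "Suc q"] q L_le_B by linarith
  then have b: "\<bar>DD K q * (RD K q * PD K q)\<bar> \<le> 2 ^ B"
    using DD_pos[of "Suc q"] unfolding DD_def by simp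
  have "input_ok M" using M unfolding I_den_def by simp
  note i = input_okD[OF this q]
  let ?Q = "setv 3 (Times (va 3) (Times (inp 3 4) (inp 5 4)))"
  show "exec_bounded B ?Q M \<and> I_den (Suc q) (exec ?Q M) \<and> exec ?Q M (V 4) = int q"
    using M b i unfolding I_den_def by (simp add: DD_def)
next
  fix q M v assume "I_den q M"
  then show "I_den q (M(V 4 := v))" unfolding I_den_def by simp
qed (simp_all add: straight_defs I_den_def input_ok_n n_le_B_nat)

lemma triple_scale: "triple B (I_scale 0) p_scale (2 + n * 4) (I_scale n)"
  unfolding p_scale_def
proof (rule triple_For_straight)
  fix q M assume q: "q < n" and M: "I_scale q M" "M (V 4) = int q"
  have "R K q \<le> 2 ^ B" "P K q \<le> 2 ^ B"
    using le_U_le[of "R K q" 0] le_U_le[of "P K q" 0] R_le[OF q] P_le[OF q] by simp_all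
  then have b: "\<bar>R K q\<bar> \<le> 2 ^ B" "\<bar>P K q\<bar> \<le> 2 ^ B" using R_nonneg[OF q] P_pos[OF q] by simp_all
  have "input_ok M" using M unfolding I_scale_def by simp
  note i = input_okD[OF this q]
  let ?Q = "Seq (seta 0 4 (Times (inp 2 4) (Quot (va 3) (inp 3 4))))
     (seta 1 4 (Times (inp 4 4) (Quot (va 3) (inp 5 4))))"
  show "exec_bounded B ?Q M \<and> I_scale (Suc q) (exec ?Q M) \<and> exec ?Q M (V 4) = int q"
    using M b i unfolding I_scale_def R_def P_def D_def[symmetric] by (auto simp: less_Suc_eq)
next
  fix q M v assume "I_scale q M"
  then show "I_scale q (M(V 4 := v))" unfolding I_scale_def by simp
qed (simp_all add: straight_defs I_scale_def input_ok_n n_le_B_nat)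

section \<open>Output\<close>

text \<open>Silent about the input cells, because the output is going to overwrite them.\<close>

definition solved :: "schedule \<Rightarrow> mem \<Rightarrow> bool" where
  "solved S M \<longleftrightarrow> M (V 1) = int n \<and> M (V 3) = D \<and> (\<forall>j<n. M (A 3 (int j)) = int (machine S j) \<and>
     real_of_int (M (A 2 (int j))) = D * start S j)"
definition I_out :: "schedule \<Rightarrow> nat \<Rightarrow> mem \<Rightarrow> bool" where
  "I_out S q M \<longleftrightarrow> solved S M \<and> (\<forall>j<q. M (3 * int j) = M (A 3 (int j)) \<and>
     M (3 * int j + 1) = M (A 2 (int j)) \<and> M (3 * int j + 2) = D)"

lemma triple_out: "triple B (solved S) p_out (2 + n * 5) (I_out S n)"
proof -
  have "triple B (I_out S 0) p_out (2 + n * 5) (I_out S n)"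
    unfolding p_out_def
  proof (rule triple_For_straight)
    fix q M assume q: "q < n" and M: "I_out S q M" "M (V 4) = int q" and b: "bounded_mem B M"
    let ?Q = "Seq (Store (Times (Num 3) (va 4)) (aa 3 4))
       (Seq (Store (Plus (Times (Num 3) (va 4)) (Num 1)) (aa 2 4))
          (Store (Plus (Times (Num 3) (va 4)) (Num 2)) (va 3)))"
    have b': "\<bar>M a\<bar> \<le> 2 ^ B" for a using b unfolding bounded_mem_def by simp
    show "exec_bounded B ?Q M \<and> I_out S (Suc q) (exec ?Q M) \<and> exec ?Q M (V 4) = int q"
      using M b' b'[of "V 3"] unfolding I_out_def solved_def by (auto simp: less_Suc_eq)
next
  fix q M v assume "I_out S q M"
  then show "I_out S q (M(V 4 := v))" unfolding I_out_def solved_def by simp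
  qed (simp_all add: straight_defs I_out_def solved_def n_le_B_nat)
  then show ?thesis unfolding I_out_def by simp
qed

lemma I_out_outputs: "length S = n \<Longrightarrow> I_out S n M \<Longrightarrow> outputs M S"
  unfolding outputs_def I_out_def solved_def using D_pos by auto

lemma triple_idle:
  assumes nm: "n \<le> m"
  shows "triple B (I_scale n) p_idle (2 + n * 4) (solved (greedy m J))"
proof -
  define I where "I q M \<longleftrightarrow> I_scale n M \<and> (\<forall>j<q. M (A 3 (int j)) = int j \<and> M (A 2 (int j)) = R K j)" for q M
  have "triple B (I 0) p_idle (2 + n * 4) (I n)"
    unfolding p_idle_def
  proof (rule triple_For_straight)
    fix q M assume q: "q < n" and M: "I q M" "M (V 4) = int q" and b: "bounded_mem B M"
    have b': "\<bar>M a\<bar> \<le> 2 ^ B" for a using b unfolding bounded_mem_def by simp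
    have "\<bar>int q\<bar> \<le> 2 ^ B" using b'[of "V 4"] M by simp
    moreover have "\<bar>R K q\<bar> \<le> 2 ^ B" using b'[of "A 0 (int q)"] M q unfolding I_def I_scale_def by simp
    ultimately show "exec_bounded B (Seq (seta 2 4 (aa 0 4)) (seta 3 4 (va 4))) M \<and>
        I (Suc q) (exec (Seq (seta 2 4 (aa 0 4)) (seta 3 4 (va 4))) M) \<and>
        exec (Seq (seta 2 4 (aa 0 4)) (seta 3 4 (va 4))) M (V 4) = int q"
      using M b' q unfolding I_def I_scale_def by (auto simp: less_Suc_eq)
next
  fix q M v assume "I q M"
  then show "I q (M(V 4 := v))" unfolding I_def I_scale_def by simp
  qed (simp_all add: straight_defs I_def I_scale_def input_ok_n n_le_B_nat)
  moreover have "solved (greedy m J) M" if "I n M" for M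
    using that greedy_idle[OF valid m] nm R_eq unfolding I_def I_scale_def solved_def input_ok_def
    by (simp add: len_J)
  ultimately show ?thesis using triple_weaken[of B "I 0"] unfolding I_def by fastforce
qed

section \<open>Released work\<close>

definition WKp :: "nat \<Rightarrow> nat \<Rightarrow> int" where
  "WKp k q = (\<Sum>l<q. if R K l \<le> R K k then P K l else 0)"

lemma WKp_n: "WKp k n = WK K k"
  unfolding WKp_def WK_def by (simp add: sum.If_cases Int_def)

lemma WKp_bounds: "q \<le> n \<Longrightarrow> 0 \<le> WKp k q" "q \<le> n \<Longrightarrow> WKp k q \<le> int q * U"
proof -
  assume q: "q \<le> n"
  show "0 \<le> WKp k q" unfolding WKp_def
    using q P_pos by (intro sum_nonneg) (auto intro: less_imp_le)
  have "WKp k q \<le> (\<Sum>l<q. U)" unfolding WKp_def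
    using q P_le by (intro sum_mono) (auto simp: U_def)
  then show "WKp k q \<le> int q * U" by simp
qed

lemma WK_eq: "k < n \<Longrightarrow> real_of_int (WK K k) = D * work J (rel J k)"
proof -
  assume k: "k < n"
  have "R K l \<le> R K k \<longleftrightarrow> rel J l \<le> rel J k" if "l < n" for l
  proof -
    have "R K l \<le> R K k \<longleftrightarrow> D * rel J l \<le> D * rel J k"
      using R_eq[OF k] R_eq[OF that] by (metis of_int_le_iff)
    then show ?thesis using D_pos by simp
  qed
  then have "{l. l < n \<and> R K l \<le> R K k} = {l. l < n \<and> rel J l \<le> rel J k}" by auto
  then show ?thesis
    unfolding WK_def work_def len_J by (simp add: P_eq sum_distrib_left)
qed

definition scaled_ok :: "mem \<Rightarrow> bool" where
  "scaled_ok M \<longleftrightarrow> input_ok M \<and> M (V 3) = D \<and> (\<forall>j<n. M (A 0 (int j)) = R K j \<and> M (A 1 (int j)) = P K j)"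

lemma scaled_ok_upd [simp]:
  "scaled_ok M \<Longrightarrow> 3 < c \<Longrightarrow> c < 16 \<Longrightarrow> scaled_ok (M(V c := v))"
  "scaled_ok M \<Longrightarrow> 1 < f \<Longrightarrow> f < 8 \<Longrightarrow> 0 \<le> j \<Longrightarrow> scaled_ok (M(A f j := v))"
  unfolding scaled_ok_def by simp_all

lemma scaled_okD:
  assumes "scaled_ok M"
  shows "M (V 1) = int n" "M (V 2) = int m" "M (V 3) = D"
    "j < n \<Longrightarrow> M (A 0 (int j)) = R K j" "j < n \<Longrightarrow> M (A 1 (int j)) = P K j"
  using assms unfolding scaled_ok_def input_ok_def by auto

text \<open>State of two nested loops: rows before q are complete, row q has absorbed the first l
  jobs, later rows are blank. Hence (q, n) passes into (q + 1, 0).\<close>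

definition I_work :: "nat \<Rightarrow> nat \<Rightarrow> mem \<Rightarrow> bool" where
  "I_work q l M \<longleftrightarrow> scaled_ok M \<and> (\<forall>j. M (A 5 (int j)) = 0 \<and> M (A 6 (int j)) = 0) \<and>
     (\<forall>k<q. M (A 4 (int k)) = WK K k) \<and> M (A 4 (int q)) = WKp q l \<and> (\<forall>k>q. M (A 4 (int k)) = 0)"

lemma I_work_upd [simp]: "I_work q l M \<Longrightarrow> 3 < c \<Longrightarrow> c < 16 \<Longrightarrow> I_work q l (M(V c := v))"
  unfolding I_work_def by simp

lemma triple_work_inner:
  assumes q: "q < n"
  shows "triple B (\<lambda>M. I_work q 0 M \<and> M (V 4) = int q) (For (V 5) (V 1)
     (IfPos (Minus (Plus (aa 0 4) (Num 1)) (aa 0 5)) (seta 4 4 (Plus (aa 4 4) (aa 1 5))) Skip))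
     (2 + n * 5) (\<lambda>M. I_work q n M \<and> M (V 4) = int q)"
proof (rule triple_For_straight[where I = "\<lambda>l M. I_work q l M \<and> M (V 4) = int q"])
  fix l M assume l: "l < n" and M: "I_work q l M \<and> M (V 4) = int q" "M (V 5) = int l"
  let ?Q = "IfPos (Minus (Plus (aa 0 4) (Num 1)) (aa 0 5)) (seta 4 4 (Plus (aa 4 4) (aa 1 5))) Skip"
  have s: "scaled_ok M" using M unfolding I_work_def by simp
  note s = scaled_okD(4,5)[OF s]
  have S: "WKp q (Suc l) = WKp q l + (if R K l \<le> R K q then P K l else 0)" unfolding WKp_def by simp
  have "WKp q (Suc l) \<le> 2 ^ B"
  proof (rule le_U_le[of _ l])
    show "WKp q (Suc l) \<le> (int l + 1) * U" using WKp_bounds(2)[of "Suc l" q] l by (simp add: add.commute)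
  qed (use l in simp)
  then have b: "\<bar>WKp q (Suc l)\<bar> \<le> 2 ^ B" using WKp_bounds(1)[of "Suc l" q] l by simp
  have e: "exec ?Q M = (if R K l \<le> R K q then M(A 4 (int q) := WKp q (Suc l)) else M)"
    using M s(1)[OF l] s(1)[OF q] s(2)[OF l] S unfolding I_work_def by auto
  have eb: "exec_bounded B ?Q M"
    using M s(1)[OF l] s(1)[OF q] s(2)[OF l] S b unfolding I_work_def by (auto split: if_splits)
  have "I_work q (Suc l) (exec ?Q M)"
    using M S unfolding e I_work_def by auto
  moreover have "exec ?Q M (V 4) = int q \<and> exec ?Q M (V 5) = int l" using M unfolding e by simp
  ultimately show "exec_bounded B ?Q M \<and> (I_work q (Suc l) (exec ?Q M) \<and> exec ?Q M (V 4) = int q) \<and> exec ?Q M (V 5) = int l"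
    using eb by simp
next
  fix l M v assume "I_work q l M \<and> M (V 4) = int q"
  then show "I_work q l (M(V 5 := v)) \<and> (M(V 5 := v)) (V 4) = int q" by simp
next
  fix l M assume "I_work q l M \<and> M (V 4) = int q"
  then show "M (V 1) = int n" using scaled_okD(1) unfolding I_work_def by blast
qed (simp_all add: straight_defs n_le_B_nat)

lemma triple_work: "triple B (I_scale n) p_work (2 + n * (4 + n * 5)) (I_work n 0)"
proof -
  have "triple B (I_work 0 0) p_work (2 + n * ((2 + n * 5) + 2)) (I_work n 0)"
    unfolding p_work_def
  proof (rule triple_For_V[where I = "\<lambda>q. I_work q 0"])
    fix q assume q: "q < n"
    show "triple B (\<lambda>M. I_work q 0 M \<and> M (V 4) = int q) (For (V 5) (V 1)
       (IfPos (Minus (Plus (aa 0 4) (Num 1)) (aa 0 5)) (seta 4 4 (Plus (aa 4 4) (aa 1 5))) Skip))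
       (2 + n * 5) (\<lambda>M. I_work (Suc q) 0 M \<and> M (V 4) = int q)"
    proof (rule triple_weaken[OF triple_work_inner[OF q]])
      fix M assume "I_work q n M \<and> M (V 4) = int q"
      then show "I_work (Suc q) 0 M \<and> M (V 4) = int q"
        unfolding I_work_def WKp_n by (auto simp: less_Suc_eq WKp_def)
    qed auto
  next
    fix q M v assume "I_work q 0 M"
    then show "I_work q 0 (M(V 4 := v))" by simp
  next
    fix q M assume "I_work q 0 M"
    then show "M (V 1) = int n" using scaled_okD(1) unfolding I_work_def by blast
  qed (use n_le_B in simp_all)
  then show ?thesis
  proof (rule triple_weaken)
    fix M assume "I_scale n M"
    then have b: "M (A f (int j)) = 0" if "f \<in> {4, 5, 6}" for f j
      using that unfolding I_scale_def blank_def by blast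
    show "I_work 0 0 M"
      using \<open>I_scale n M\<close> b[of 4 0] b unfolding I_scale_def I_work_def scaled_ok_def WKp_def by simp
  qed (simp_all add: algebra_simps)
qed

section \<open>Main loop\<close>

text \<open>The bound (q + 1) U keeps numbers short: a chosen time is a maximum of a free time and
  releases, the latter being at most \<open>U\<close>, and each round adds one size of at most
  \<open>U\<close>.\<close>

definition sim :: "sched \<Rightarrow> nat \<Rightarrow> mem \<Rightarrow> bool" where
  "sim st q M \<longleftrightarrow> scaled_ok M \<and> M (V 10) = int (m * n * n) \<and> (\<forall>k<n. M (A 4 (int k)) = WK K k) \<and>
     (\<forall>j<n. M (A 5 (int j)) = (if j \<in> assigned st then 1 else 0)) \<and>
     (\<forall>j\<in>assigned st. M (A 3 (int j)) = int (mach st j) \<and> real_of_int (M (A 2 (int j))) = D * begins st j) \<and>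
     (\<forall>i<m. real_of_int (M (A 6 (int i))) = D * free st i \<and> 0 \<le> M (A 6 (int i)) \<and> M (A 6 (int i)) \<le> (int q + 1) * U)"

text \<open>For \<open>None\<close> only the flag is fixed; variables 13 to 15 may still hold values
  of an earlier round.\<close>

definition found :: "sched \<Rightarrow> nat \<Rightarrow> nat option \<Rightarrow> mem \<Rightarrow> bool" where
  "found st q r M \<longleftrightarrow> (case r of None \<Rightarrow> M (V 11) = 0 | Some y \<Rightarrow> M (V 11) = 1 \<and> y < m * n * n \<and>
     real_of_int (M (V 13)) = D * cand_time J st y \<and> 0 \<le> M (V 13) \<and> M (V 13) \<le> (int q + 1) * U \<and>
     M (V 14) = int (cand_mach n y) \<and> M (V 15) = int (cand_job n y))"

lemma sim_upd [simp]: "sim st q M \<Longrightarrow> 3 < c \<Longrightarrow> c < 16 \<Longrightarrow> c \<noteq> 10 \<Longrightarrow> sim st q (M(V c := v))"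
  unfolding sim_def by simp

lemma found_upd [simp]: "found st q r M \<Longrightarrow> c \<notin> {11, 13, 14, 15} \<Longrightarrow> found st q r (M(V c := v))"
  unfolding found_def by (auto split: option.splits)

lemma scan_step:
  assumes mn: "m < n" and x: "x < m * n * n" and sim: "sim st q M" and fd: "found st q (scan m J st x) M"
    and M5: "M (V 5) = int x" and b: "bounded_mem B M"
  shows "exec_bounded B p_body M \<and> sim st q (exec p_body M) \<and> found st q (scan m J st (Suc x)) (exec p_body M) \<and>
    exec p_body M (V 5) = int x \<and> exec p_body M (V 4) = M (V 4)"
proof -
  define i j k where "i = cand_mach n x" and "j = cand_job n x" and "k = cand_rel n x"
  have bnd: "i < m" "j < n" "k < n" using cand_bounds[OF x] unfolding i_def j_def k_def by auto
  have sc: "scaled_ok M" using sim unfolding sim_def by simp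
  note s = scaled_okD[OF sc]
  define M1 where "M1 = M(V 6 := int i, V 7 := int j, V 8 := int k)"
  have e1: "exec p_pick M = M1" using exec_pick[OF s(1) M5] unfolding M1_def i_def j_def k_def by simp
  have ibs: "\<bar>int i\<bar> \<le> 2 ^ B" "\<bar>int j\<bar> \<le> 2 ^ B" "\<bar>int k\<bar> \<le> 2 ^ B"
    using bnd mn n_le_B by linarith+
  have b1: "bounded_mem B M1" using b ibs unfolding bounded_mem_def M1_def by simp
  have eb1: "exec_bounded B p_pick M"
  proof -
    have "exec p_pick M (V 6) = int i" "exec p_pick M (V 7) = int j" "exec p_pick M (V 8) = int k"
      unfolding e1 M1_def by simp_all
    then show ?thesis using ibs unfolding p_pick_def by simp
  qed
  have sim1: "sim st q M1" and fd1: "found st q (scan m J st x) M1" and M15: "M1 (V 5) = int x"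
    and M14: "M1 (V 4) = M (V 4)"
    using sim fd M5 unfolding M1_def by simp_all
  have v1: "M1 (V 6) = int i" "M1 (V 7) = int j" "M1 (V 8) = int k" unfolding M1_def by simp_all
  have sc1: "scaled_ok M1" using sim1 unfolding sim_def by simp
  note s1 = scaled_okD[OF sc1]
  have a5: "M1 (A 5 (int j)) = (if j \<in> assigned st then 1 else 0)" and a4: "M1 (A 4 (int k)) = WK K k"
    and a6: "real_of_int (M1 (A 6 (int i))) = D * free st i" "0 \<le> M1 (A 6 (int i))" "M1 (A 6 (int i)) \<le> (int q + 1) * U"
    using sim1 bnd unfolding sim_def by auto
  \<comment> \<open>Squaring leaves the factor D^2 on both sides, so the test on scaled integers
    decides admission of the real data.\<close>
  have adm: "0 < val e_admit M1 \<longleftrightarrow> admits m J i (ptime J j) (work J (rel J k))"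
  proof -
    have "0 < val e_admit M1 \<longleftrightarrow> int n * (int i * P K j)\<^sup>2 \<le> int m * (WK K k)\<^sup>2"
      unfolding e_admit_def using v1 s1 a4 bnd by (auto simp: power2_eq_square)
    also have "\<dots> \<longleftrightarrow> real_of_int (int n * (int i * P K j)\<^sup>2) \<le> real_of_int (int m * (WK K k)\<^sup>2)"
      by (simp only: of_int_le_iff)
    also have "\<dots> \<longleftrightarrow> (real_of_int D)\<^sup>2 * (real n * (real i * ptime J j)\<^sup>2) \<le> (real_of_int D)\<^sup>2 * (real m * (work J (rel J k))\<^sup>2)"
      using P_eq[OF bnd(2)] WK_eq[OF bnd(3)] by (simp add: power_mult_distrib algebra_simps)
    also have "\<dots> \<longleftrightarrow> admits m J i (ptime J j) (work J (rel J k))"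
      using D_pos unfolding admits_def len_J by (subst mult_le_cancel_left_pos) auto
    finally show ?thesis .
  qed
  have feas: "feasible m J st x \<longleftrightarrow> j \<notin> assigned st \<and> 0 < val e_admit M1"
    unfolding feasible_def len_J adm i_def j_def k_def by simp
  have body: "exec p_body M = (if feasible m J st x then exec p_compare (exec p_time M1) else M1)"
    "exec_bounded B p_body M \<longleftrightarrow> (feasible m J st x \<longrightarrow> exec_bounded B p_time M1 \<and> exec_bounded B p_compare (exec p_time M1))"
    unfolding p_body_def using eb1 v1 a5 feas by (auto simp: e1)
  show ?thesis
  proof (cases "feasible m J st x")
    case False
    then show ?thesis using body sim1 fd1 M15 M14 by simp
  next
    case True
    define t where "t = max (max (M1 (A 6 (int i))) (R K j)) (R K k)"
    define M2 where "M2 = M1(V 12 := t)"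
    have e2: "exec p_time M1 = M2"
      using exec_time[of M1] v1 s1 bnd unfolding M2_def t_def by simp
    have b2: "bounded_mem B M2"
    proof -
      have "\<bar>M1 (A 6 (int i))\<bar> \<le> 2 ^ B" "\<bar>R K j\<bar> \<le> 2 ^ B" "\<bar>R K k\<bar> \<le> 2 ^ B"
        using b1 s1(4)[OF bnd(2)] s1(4)[OF bnd(3)] unfolding bounded_mem_def by metis+
      then have "\<bar>t\<bar> \<le> 2 ^ B" unfolding t_def by (auto simp: max_def)
      then show ?thesis using b1 unfolding bounded_mem_def M2_def by simp
    qed
    have eb2: "exec_bounded B p_time M1 \<and> exec_bounded B p_compare M2"
      using exec_bounded_time[OF b1] exec_bounded_compare[OF b2] v1 by simp
    have ct: "real_of_int t = D * cand_time J st x"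
    proof -
      have mx: "D * max a c = max (D * a) (D * c)" for a c :: real
        using D_pos by (simp add: max_mult_distrib_left)
      show ?thesis
        unfolding t_def cand_time_def len_J i_def[symmetric] j_def[symmetric] k_def[symmetric] mx
        using a6(1) R_eq[OF bnd(2)] R_eq[OF bnd(3)] by (simp add: of_int_max)
    qed
    have t0: "0 \<le> t" using R_nonneg[OF bnd(2)] unfolding t_def by (simp add: le_max_iff_disj)
    have tU: "t \<le> (int q + 1) * U"
    proof -
      have "1 * U \<le> (int q + 1) * U" unfolding U_def by (intro mult_right_mono) auto
      then show ?thesis using a6(3) R_le[OF bnd(2)] R_le[OF bnd(3)] unfolding t_def by simp
    qed
    have sim2: "sim st q M2" and fd2: "found st q (scan m J st x) M2" and M25: "M2 (V 5) = int x"
      and M24: "M2 (V 4) = M (V 4)"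
      using sim1 fd1 M15 M14 unfolding M2_def by simp_all
    have v2: "M2 (V 6) = int i" "M2 (V 7) = int j" "M2 (V 12) = t" using v1 unfolding M2_def by simp_all
    have sc2: "scaled_ok M2" using sim2 unfolding sim_def by simp
    have cmp: "M2 (V 11) \<le> 0 \<or> M2 (V 12) < M2 (V 13) \<or>
       M2 (V 12) = M2 (V 13) \<and> M2 (A 1 (M2 (V 7))) < M2 (A 1 (M2 (V 15))) \<longleftrightarrow>
       (\<forall>y. scan m J st x = Some y \<longrightarrow> better J st x y)"
    proof (cases "scan m J st x")
      case None
      then show ?thesis using fd2 unfolding found_def by simp
    next
      case (Some y)
      then have y: "M2 (V 11) = 1" "y < m * n * n" "real_of_int (M2 (V 13)) = D * cand_time J st y"
        "M2 (V 15) = int (cand_job n y)"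
        using fd2 unfolding found_def by auto
      define j' where "j' = cand_job n y"
      have j': "j' < n" using cand_bounds[OF y(2)] unfolding j'_def by simp
      have "t < M2 (V 13) \<longleftrightarrow> real_of_int t < real_of_int (M2 (V 13))" by simp
      then have 1: "t < M2 (V 13) \<longleftrightarrow> cand_time J st x < cand_time J st y"
        unfolding ct y(3) using D_pos by simp
      have "t = M2 (V 13) \<longleftrightarrow> real_of_int t = real_of_int (M2 (V 13))" by simp
      then have 2: "t = M2 (V 13) \<longleftrightarrow> cand_time J st x = cand_time J st y"
        unfolding ct y(3) using D_pos by simp
      have "P K j < P K j' \<longleftrightarrow> real_of_int (P K j) < real_of_int (P K j')" by simp
      then have 3: "P K j < P K j' \<longleftrightarrow> ptime J j < ptime J j'"
        unfolding P_eq[OF bnd(2)] P_eq[OF j'] using D_pos by simp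
      have 4: "M2 (A 1 (M2 (V 7))) = P K j" "M2 (A 1 (M2 (V 15))) = P K j'"
        using scaled_okD(5)[OF sc2] bnd(2) j' v2 y(4) unfolding j'_def by simp_all
      have "better J st x y \<longleftrightarrow> cand_time J st x < cand_time J st y \<or>
          cand_time J st x = cand_time J st y \<and> ptime J j < ptime J j'"
        unfolding better_def len_J j_def j'_def ..
      then show ?thesis unfolding 4 v2(3) 1 2 3 y(1) Some by simp
    qed
    show ?thesis
    proof (cases "\<forall>y. scan m J st x = Some y \<longrightarrow> better J st x y")
      case bt: True
      then have "exec p_body M = M2(V 11 := 1, V 13 := t, V 14 := int i, V 15 := int j)"
        using body(1) True cmp unfolding e2 exec_compare exec_update v2 by simp
      moreover have "scan m J st (Suc x) = Some x" using bt True by simp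
      ultimately show ?thesis
        using sim2 M25 M24 t0 tU ct x eb2 body(2) unfolding e2 found_def i_def j_def by simp
    next
      case bt: False
      have "exec p_body M = exec p_compare M2" using body(1) True e2 by simp
      also have "\<dots> = M2" unfolding exec_compare cmp using bt by (rule if_not_P)
      finally have "exec p_body M = M2" .
      moreover have "scan m J st (Suc x) = scan m J st x" using bt by auto
      ultimately show ?thesis using sim2 fd2 M25 M24 eb2 body(2) unfolding e2 by simp
    qed
  qed
qed

lemma after_scan:
  assumes "q < n"
  obtains x where "scan m J (after m J q) (m * n * n) = Some x" "x < m * n * n"
    "after m J (Suc q) = assign J x (after m J q)" "cand_job n x \<notin> assigned (after m J q)"
    "assigned (after m J q) \<subseteq> {..<n}"
proof -
  let ?st = "after m J q"
  have "ok m J ?st" and c: "card (assigned ?st) = q"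
    using after_invariant[OF valid m, of q] assms unfolding len_J by simp_all
  from okD1[OF valid m this(1)] have sub: "assigned ?st \<subseteq> {..<n}" unfolding len_J .
  have "assigned ?st \<noteq> {..<n}"
  proof
    assume "assigned ?st = {..<n}"
    then show False using c assms by simp
  qed
  then obtain j where "j < length J" "j \<notin> assigned ?st" using sub unfolding len_J by blast
  from feasible_exists[OF valid m this] scan_None[of m J ?st "m * length J * length J"]
  obtain x where x: "scan m J ?st (m * n * n) = Some x" unfolding len_J by (cases "scan m J ?st (m * n * n)") auto
  then have "best m J ?st (m * n * n) x" by (rule scan_Some)
  moreover have "after m J (Suc q) = assign J x ?st"
    using x unfolding after_Suc advance_def len_J by simp
  ultimately show ?thesis using that x sub unfolding best_def feasible_def len_J by auto
qed

lemma assign_step: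
  assumes mn: "m < n" and q: "q < n" and sim: "sim (after m J q) q M"
    and fd: "found (after m J q) q (scan m J (after m J q) (m * n * n)) M"
  shows "exec_bounded B p_assign M \<and> sim (after m J (Suc q)) (Suc q) (exec p_assign M) \<and> exec p_assign M (V 4) = M (V 4)"
proof -
  obtain x where x: "scan m J (after m J q) (m * n * n) = Some x" "x < m * n * n"
    "after m J (Suc q) = assign J x (after m J q)" "cand_job n x \<notin> assigned (after m J q)"
    "assigned (after m J q) \<subseteq> {..<n}" using after_scan[OF q] .
  define i j st t where "i = cand_mach n x" and "j = cand_job n x" and "st = after m J q" and "t = cand_time J st x"
  have bnd: "i < m" "j < n" using cand_bounds[OF x(2)] unfolding i_def j_def by auto
  have f: "real_of_int (M (V 13)) = D * t" "0 \<le> M (V 13)" "M (V 13) \<le> (int q + 1) * U"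
    "M (V 14) = int i" "M (V 15) = int j"
    using fd unfolding found_def x(1) i_def j_def st_def t_def by auto
  have st': "after m J (Suc q) = \<lparr>assigned = insert j (assigned st), mach = (mach st)(j := i),
    begins = (begins st)(j := t), free = (free st)(i := t + ptime J j), now = t\<rparr>"
    unfolding x(3) assign_def Let_def i_def j_def st_def t_def len_J ..
  have sc: "scaled_ok M" using sim unfolding sim_def by simp
  have Pj: "M (A 1 (int j)) = P K j" using scaled_okD(5)[OF sc] bnd by simp
  have U0: "0 \<le> U" unfolding U_def by simp
  have sum: "0 \<le> M (V 13) + P K j" "M (V 13) + P K j \<le> (int (Suc q) + 1) * U"
    using f P_pos[OF bnd(2)] P_le[OF bnd(2)] by (simp_all add: algebra_simps)
  then have b: "\<bar>M (V 13) + P K j\<bar> \<le> 2 ^ B" using le_U_le[of _ "Suc q"] q by simp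
  have "M (V 13) \<le> 2 ^ B" using le_U_le[OF f(3)] q by simp
  then have b': "\<bar>M (V 13)\<bar> \<le> 2 ^ B" "\<bar>int i\<bar> \<le> 2 ^ B" using f bnd mn n_le_B by auto
  have e: "exec p_assign M = M(A 2 (int j) := M (V 13), A 3 (int j) := int i, A 5 (int j) := 1, A 6 (int i) := M (V 13) + P K j)"
    unfolding p_assign_def using f Pj by simp
  have "exec_bounded B p_assign M"
    unfolding p_assign_def using f Pj b b' by simp
  moreover have "sim (after m J (Suc q)) (Suc q) (exec p_assign M)"
  proof -
    have j: "j \<notin> assigned st" using x(4) unfolding j_def st_def .
    have 1: "scaled_ok (exec p_assign M)" unfolding e using sc by simp
    have 2: "exec p_assign M (V 10) = int (m * n * n)" "\<forall>k<n. exec p_assign M (A 4 (int k)) = WK K k"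
      unfolding e using sim unfolding sim_def by simp_all
    have 3: "\<forall>l<n. exec p_assign M (A 5 (int l)) = (if l \<in> insert j (assigned st) then 1 else 0)"
      unfolding e using sim unfolding sim_def st_def by auto
    have 4: "\<forall>l\<in>insert j (assigned st). exec p_assign M (A 3 (int l)) = int (((mach st)(j := i)) l) \<and>
      real_of_int (exec p_assign M (A 2 (int l))) = D * ((begins st)(j := t)) l"
      unfolding e using sim f(1) j unfolding sim_def st_def by auto
    have 5: "\<forall>l<m. real_of_int (exec p_assign M (A 6 (int l))) = D * ((free st)(i := t + ptime J j)) l \<and>
      0 \<le> exec p_assign M (A 6 (int l)) \<and> exec p_assign M (A 6 (int l)) \<le> (int (Suc q) + 1) * U"
    proof (intro allI impI)
      fix l assume l: "l < m"
      show "real_of_int (exec p_assign M (A 6 (int l))) = D * ((free st)(i := t + ptime J j)) l \<and>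
        0 \<le> exec p_assign M (A 6 (int l)) \<and> exec p_assign M (A 6 (int l)) \<le> (int (Suc q) + 1) * U"
      proof (cases "l = i")
        case True
        have "real_of_int (M (V 13) + P K j) = D * (t + ptime J j)"
          using f(1) P_eq[OF bnd(2)] by (simp add: distrib_left)
        then show ?thesis using True sum unfolding e by simp
      next
        case False
        have "real_of_int (M (A 6 (int l))) = D * free st l \<and> 0 \<le> M (A 6 (int l)) \<and> M (A 6 (int l)) \<le> (int q + 1) * U"
          using sim l unfolding sim_def st_def by blast
        moreover have "(int q + 1) * U \<le> (int (Suc q) + 1) * U" using U0 by (intro mult_right_mono) auto
        ultimately show ?thesis using False unfolding e by auto
      qed
    qed
    show ?thesis unfolding sim_def st' using 1 2 3 4 5 by simp
  qed
  moreover have "exec p_assign M (V 4) = M (V 4)" unfolding e by simp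
  ultimately show ?thesis by blast
qed

definition body_steps :: nat where "body_steps = steps p_body + 2"

lemma straight_body: "straight p_body" "straight p_assign"
  unfolding p_body_def p_pick_def p_time_def p_compare_def p_update_def e_admit_def p_assign_def
  by (simp_all add: straight_defs)

lemma candidates_le: "m < n \<Longrightarrow> int (m * n * n) \<le> 2 ^ B"
proof -
  assume mn: "m < n"
  have "m * n * n \<le> n * n * n" using mn by (intro mult_le_mono) auto
  then have "int (m * n * n) \<le> int (n * n * n)" by (simp only: of_nat_le_iff)
  also have "\<dots> = int n ^ 3" by (simp add: power3_eq_cube)
  also have "\<dots> \<le> (2 ^ L) ^ 3"
  proof (rule power_mono)
    show "int n \<le> 2 ^ L" using n_le by linarith
  qed simp
  also have "\<dots> = 2 ^ B" unfolding B_def by (simp add: power_mult[symmetric] mult.commute)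
  finally show ?thesis .
qed

lemma triple_round:
  assumes mn: "m < n" and q: "q < n"
  shows "triple B (\<lambda>M. sim (after m J q) q M \<and> M (V 4) = int q)
    (Seq (setv 11 (Num 0)) (Seq (For (V 5) (V 10) p_body) p_assign))
    (1 + ((2 + m * n * n * body_steps) + 4)) (\<lambda>M. sim (after m J (Suc q)) (Suc q) M \<and> M (V 4) = int q)"
proof (rule triple_Seq[OF _ triple_Seq])
  let ?st = "after m J q"
  let ?I = "\<lambda>x M. sim ?st q M \<and> found ?st q (scan m J ?st x) M \<and> M (V 4) = int q"
  have "triple B (\<lambda>M. sim ?st q M \<and> M (V 4) = int q) (setv 11 (Num 0)) (steps (setv 11 (Num 0))) (?I 0)"
    by (rule triple_straight) (simp_all add: straight_defs found_def)
  then show "triple B (\<lambda>M. sim ?st q M \<and> M (V 4) = int q) (setv 11 (Num 0)) 1 (?I 0)" by simp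
  show "triple B (?I 0) (For (V 5) (V 10) p_body) (2 + m * n * n * body_steps) (?I (m * n * n))"
  proof (rule triple_For_straight[where I = ?I])
    fix x M assume x: "x < m * n * n" and M: "?I x M" "M (V 5) = int x" and b: "bounded_mem B M"
    show "exec_bounded B p_body M \<and> ?I (Suc x) (exec p_body M) \<and> exec p_body M (V 5) = int x"
      using scan_step[OF mn x _ _ M(2) b, of ?st q] M(1) by simp
  next
    fix x M v assume "?I x M"
    then show "?I x (M(V 5 := v))" by simp
  next
    fix x M assume "?I x M"
    then show "M (V 10) = int (m * n * n)" unfolding sim_def by blast
  next
    show "int (m * n * n) \<le> 2 ^ B" by (rule candidates_le[OF mn])
  qed (simp_all add: straight_body body_steps_def)
  have "triple B (?I (m * n * n)) p_assign (steps p_assign) (\<lambda>M. sim (after m J (Suc q)) (Suc q) M \<and> M (V 4) = int q)"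
    by (rule triple_straight[OF straight_body(2)]) (use assign_step[OF mn q] in auto)
  then show "triple B (?I (m * n * n)) p_assign 4 (\<lambda>M. sim (after m J (Suc q)) (Suc q) M \<and> M (V 4) = int q)"
    by (rule triple_weaken) (simp_all add: p_assign_def)
qed

lemma triple_main:
  assumes mn: "m < n"
  shows "triple B (I_work n 0) p_main (1 + (2 + n * (9 + m * n * n * body_steps))) (solved (greedy m J))"
  unfolding p_main_def
proof (rule triple_Seq)
  let ?I = "\<lambda>q. sim (after m J q) q"
  have n3: "int m * (int n * int n) \<le> 2 ^ B"
  proof -
    show ?thesis using candidates_le[OF mn] by (simp add: mult.assoc)
  qed
  have "triple B (I_work n 0) (setv 10 (Times (va 2) (Times (va 1) (va 1)))) (steps (setv 10 (Times (va 2) (Times (va 1) (va 1))))) (?I 0)"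
  proof (rule triple_straight)
    fix M assume M: "I_work n 0 M"
    then have s: "scaled_ok M" unfolding I_work_def by simp
    note s' = scaled_okD(1,2)[OF s]
    have U0: "0 \<le> U" unfolding U_def by simp
    show "exec_bounded B (setv 10 (Times (va 2) (Times (va 1) (va 1)))) M \<and>
      ?I 0 (exec (setv 10 (Times (va 2) (Times (va 1) (va 1)))) M)"
      using M s s' n3 U0 unfolding I_work_def sim_def by (simp add: after_def initial_def abs_mult mult.assoc)
  qed (simp add: straight_defs)
  then show "triple B (I_work n 0) (setv 10 (Times (va 2) (Times (va 1) (va 1)))) 1 (?I 0)" by simp
  have "triple B (?I 0) (For (V 4) (V 1) (Seq (setv 11 (Num 0)) (Seq (For (V 5) (V 10) p_body) p_assign)))
      (2 + n * ((1 + ((2 + m * n * n * body_steps) + 4)) + 2)) (?I n)"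
  proof (rule triple_For_V[where I = ?I])
    fix q M v assume "?I q M"
    then show "?I q (M(V 4 := v))" by simp
  next
    fix q M assume "?I q M"
    then show "M (V 1) = int n" using scaled_okD(1) unfolding sim_def by blast
  qed (use triple_round[OF mn] n_le_B in simp_all)
  then show "triple B (?I 0) (For (V 4) (V 1) (Seq (setv 11 (Num 0)) (Seq (For (V 5) (V 10) p_body) p_assign)))
      (2 + n * (9 + m * n * n * body_steps)) (solved (greedy m J))"
  proof (rule triple_weaken)
    fix M assume M: "?I n M"
    then have s: "scaled_ok M" unfolding sim_def by simp
    have "assigned (after m J n) = {..<n}" using after_assigned[OF valid m] len_J by simp
    then show "solved (greedy m J) M"
      using M scaled_okD[OF s] greedy_start_machine[OF valid m] mn len_J unfolding sim_def solved_def by simp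
  qed simp_all
qed

text \<open>The dominating count is n rounds of m n^2 candidates. It is at most L^4 because the main
  loop runs only for m < n \<le> L, although m alone is not bounded polynomially in L.\<close>

lemma triple_greedy:
  "triple B (\<lambda>M. M = load (encode m K)) p_greedy (100 * (1 + body_steps) * L ^ 4) (I_out (greedy m J) n)"
proof -
  define k where "k = 30 * (1 + body_steps) * L ^ 4"
  have L1: "1 \<le> L" "n \<le> L" using L_ge by auto
  have pw: "L ^ a \<le> L ^ 4" if "a \<le> 4" for a using L1 that by (intro power_increasing) auto
  have n1: "n \<le> L ^ 4" using L1 pw[of 1] by simp
  have one: "1 \<le> L ^ 4" using L1 by simp
  have n2: "n * n \<le> L ^ 4"
    using mult_le_mono[OF L1(2) L1(2)] pw[of 2] by (simp add: power2_eq_square)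
  have k_ge: "30 * L ^ 4 + 30 * (body_steps * L ^ 4) \<le> k" unfolding k_def by (simp add: algebra_simps)
  have main: "triple B (\<lambda>M. I_scale n M \<and> 0 < val (Minus (va 1) (va 2)) M) (Seq p_work p_main) k (solved (greedy m J))"
  proof (cases "m < n")
    case True
    have "m * n * n * n \<le> L * L * L * L" using L1 True by (intro mult_le_mono) auto
    then have n4: "m * n * n * n \<le> L ^ 4" by (simp add: power4_eq_xxxx)
    have "n * (m * n * n * body_steps) = (m * n * n * n) * body_steps" by (simp add: mult_ac)
    also have "\<dots> \<le> L ^ 4 * body_steps" using n4 by (intro mult_le_mono1)
    finally have n5: "n * (m * n * n * body_steps) \<le> body_steps * L ^ 4" by (simp add: mult.commute)
    show ?thesis
    proof (rule triple_weaken[OF triple_Seq[OF triple_work triple_main[OF True]]])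
      show "2 + n * (4 + n * 5) + (1 + (2 + n * (9 + m * n * n * body_steps))) \<le> k"
      proof -
        have eq: "2 + n * (4 + n * 5) + (1 + (2 + n * (9 + x))) = 5 + 13 * n + 5 * (n * n) + n * x" for x
          by (simp add: algebra_simps)
        show ?thesis unfolding eq using n1 n2 n5 one k_ge by linarith
      qed
    qed auto
  next
    case False
    \<comment> \<open>The test in the precondition contradicts n \<le> m, so the triple holds
      vacuously.\<close>
    then show ?thesis
      unfolding triple_def I_scale_def input_ok_def by auto
  qed
  have idle: "triple B (\<lambda>M. I_scale n M \<and> \<not> 0 < val (Minus (va 1) (va 2)) M) p_idle k (solved (greedy m J))"
  proof (cases "n \<le> m")
    case True
    show ?thesis
    proof (rule triple_weaken[OF triple_idle[OF True]])
      show "2 + n * 4 \<le> k" using n1 one k_ge by simp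
    qed auto
  next
    case False
    then show ?thesis
      unfolding triple_def I_scale_def input_ok_def by auto
  qed
  have "simple (Minus (va 1) (va 2))" by (simp add: straight_defs)
  note branch = triple_If[OF this main idle]
  have den: "triple B (I_den 0) p_den (2 + n * 3) (I_scale 0)"
    by (rule triple_weaken[OF triple_den]) (simp_all add: I_den_def I_scale_def D_def)
  have "triple B (\<lambda>M. M = load (encode m K)) p_greedy (3 + ((2 + n * 3) + ((2 + n * 4) + (Suc k + (2 + n * 5))))) (I_out (greedy m J) n)"
    unfolding p_greedy_def by (intro triple_Seq[OF triple_init] triple_Seq[OF den] triple_Seq[OF triple_scale] triple_Seq[OF branch] triple_out)
  then show ?thesis
  proof (rule triple_weaken)
    have "100 * (1 + body_steps) * L ^ 4 = k + 70 * (1 + body_steps) * L ^ 4"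
      unfolding k_def by (simp add: algebra_simps)
    moreover have "70 * L ^ 4 \<le> 70 * (1 + body_steps) * L ^ 4" by simp
    ultimately show "3 + ((2 + n * 3) + ((2 + n * 4) + (Suc k + (2 + n * 5)))) \<le> 100 * (1 + body_steps) * L ^ 4"
      using n1 one by linarith
  qed auto
qed

end

text \<open>Degree 5 is 4 for the number of time units plus 1 for the price of a unit, linear in the
  input length; 15000000 = 100 * 50000 * 3.\<close>

lemma greedy_polynomial_time: "polynomial_time greedy"
proof -
  have "\<exists>t M. run p_greedy (load (encode m K)) t M \<and>
      t \<le> (15000000 * (1 + body_steps)) * input_size (encode m K) ^ 5 \<and> outputs M (greedy m (real_jobs K))"
    if m: "1 \<le> m" and valid: "valid_jobs (real_jobs K)" for m K
  proof -
    have "\<bar>load (encode m K) a\<bar> \<le> 2 ^ B m K" for a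
      using load_le[of "encode m K" a] L_le_B[OF m valid] unfolding L_def[OF m valid] by linarith
    then have "bounded_mem (B m K) (load (encode m K))"
      using B_ge[OF m valid] unfolding bounded_mem_def by blast
    from tripleD[OF triple_greedy[OF m valid] this refl] obtain t M where
      t: "run p_greedy (load (encode m K)) t M" "t \<le> 100 * (1 + body_steps) * L m K ^ 4 * unit_time (B m K)"
      "I_out K (greedy m (real_jobs K)) (length K) M" by blast
    have "outputs M (greedy m (real_jobs K))"
      using I_out_outputs[OF m valid _ t(3)] by (simp add: greedy_def real_jobs_def)
    moreover have "t \<le> (15000000 * (1 + body_steps)) * input_size (encode m K) ^ 5"
    proof -
      have five: "l ^ 5 = l ^ 4 * l" for l :: nat using power_Suc2[of l 4] by simp
      have "t \<le> 100 * (1 + body_steps) * input_size (encode m K) ^ 4 * (50000 * (3 * input_size (encode m K)))"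
        using t(2) unfolding unit_time_def B_def[OF m valid] L_def[OF m valid] .
      also have "100 * c * l ^ 4 * (50000 * (3 * l)) = (15000000 * c) * (l ^ 4 * l)" for c l :: nat
        by simp
      finally show ?thesis unfolding five .
    qed
    ultimately show ?thesis using t(1) by blast
  qed
  then show ?thesis unfolding polynomial_time_def by blast
qed

theorem mainTheorem5:
  shows "\<exists>(A :: algorithm) (\<Gamma> :: nat \<Rightarrow> nat \<Rightarrow> real).
           online_nonpreemptive A \<and>
           polynomial_time A \<and>
           (\<forall>n m. 1 \<le> n \<and> 1 \<le> m \<longrightarrow> competitive A n m (\<Gamma> n m)) \<and>
           (\<lambda>(n, m). \<Gamma> n m) \<in> O[principal {(n, m). 1 \<le> n \<and> 1 \<le> m}](
             \<lambda>(n, m). max 1 (real n / (real m)\<^sup>2 + sqrt (real n / real m) * log 2 (real m)))"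
  using greedy_online greedy_polynomial_time greedy_competitive ratio_bigo by blast

end
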